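(* Let $\Omega\subset\mathbb{C}$ be a non-empty bounded open set whose boundary $\partial\Omega$ is rectifiable and has a finite number of connected components. Assume that the set of uniform limits on $\overline\Omega$ of rational functions bounded in $\Omega$ is the algebra $\mathcal A(\overline\Omega)$ of all functions holomorphic in $\Omega$ and continuous in $\overline\Omega$. Let $A$ be a bounded linear operator on a complex Hilbert space with $\mathrm{Sp}(A)\subset\Omega$. Assume that there is a constant $c_2$ such that for every rational function $f$ satisfying $|f|\le 1$ in $\Omega$ there exists $\gamma(f)\in\mathbb{C}$ with $$\|S(f,A)+\gamma(f)I\|\le 2\,c_2 ,$$ where $c_2$ is independent of $f$. Then $\overline\Omega$ is a $K$-spectral set for $A$ with constant $$K=c_2+\sqrt{c_2^2+c_1+\hat\gamma},\qquad \hat\gamma:=\sup\{|\gamma(f)|\,:\ f\text{ rational},\ |f|\le 1\text{ in }\Omega\}.$$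
   Context: $\mathrm{Sp}(A)$ is the spectrum of $A$. A closed set $X\subset\mathbb{C}$ is a $K$-spectral set for a bounded operator $A$ if $\mathrm{Sp}(A)\subset X$ and $\|f(A)\|\le K\sup_{z\in X}|f(z)|$ for all rational functions $f$ bounded in $X$. $s$ denotes arc length on $\partial\Omega$, $\sigma=\sigma(s)$ is the arc-length parametrization of $\partial\Omega$, and $\partial\Omega$ is counterclockwise oriented, i.e. positively oriented with respect to $\Omega$ (inner boundary components are run through clockwise), so that the Cauchy formula holds in $\Omega$; $\sigma'(s)$ exists for almost every $s$. For $\sigma(s)\notin\mathrm{Sp}(A)$, $$\mu(\sigma(s),A):=\frac1{2\pi i}\big(\sigma'(s)(\sigma(s)I-A)^{-1}-\overline{\sigma'(s)}(\overline{\sigma(s)}I-A^* )^{-1}\big),$$ and for $f$ rational and bounded in $\Omega$, $$S(f,A):=\int_{\partial\Omega}f(\sigma(s))\,\mu(\sigma(s),A)\,ds .$$ For such $f$ let $g(z)=\frac1{2\pi i}\int_{\partial\Omega}\overline{f(\sigma)}\,\frac{d\sigma}{\sigma-z}$ for $z\in\Omega$; $g$ extends continuously to $\overline\Omega$, and $$c_1:=\sup\Big\{\max_{z\in\overline\Omega}|g(z)|\,:\ f\text{ rational function},\ |f|\le 1\text{ in }\Omega\Big\}$$ (if $c_1=+\infty$ nothing is asserted). *)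

theory Defs
  imports
    "HOL-Complex_Analysis.Complex_Analysis"
    "HOL-Computational_Algebra.Polynomial_Factorial"
    "HOL-Computational_Algebra.Field_as_Ring"
begin

subsection \<open>Complex Hilbert spaces\<close>

class scaleC =
  fixes scaleC :: "complex \<Rightarrow> 'a \<Rightarrow> 'a"  (infixr "*\<^sub>C" 75)

class complex_hilbert_space = banach + scaleC +
  fixes cinner :: "'a \<Rightarrow> 'a \<Rightarrow> complex"
  assumes scaleC_add_right: "c *\<^sub>C (x + y) = c *\<^sub>C x + c *\<^sub>C y"
    and scaleC_add_left: "(c + d) *\<^sub>C x = c *\<^sub>C x + d *\<^sub>C x"
    and scaleC_scaleC: "c *\<^sub>C (d *\<^sub>C x) = (c * d) *\<^sub>C x"
    and scaleR_eq_scaleC: "r *\<^sub>R x = complex_of_real r *\<^sub>C x"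
    and cinner_commute: "cinner x y = cnj (cinner y x)"
    and cinner_add_left: "cinner (x + y) z = cinner x z + cinner y z"
    and cinner_scaleC_left: "cinner (c *\<^sub>C x) y = c * cinner x y"
    and cinner_self: "cinner x x = complex_of_real ((norm x)\<^sup>2)"

instantiation complex :: complex_hilbert_space
begin

definition scaleC_complex :: "complex \<Rightarrow> complex \<Rightarrow> complex"
  where "scaleC_complex c x = c * x"

definition cinner_complex :: "complex \<Rightarrow> complex \<Rightarrow> complex"
  where "cinner_complex x y = x * cnj y"

instance
proof
  show "cinner x x = complex_of_real ((norm x)\<^sup>2)" for x :: complex
    unfolding cinner_complex_def complex_norm_square ..
qed (auto simp: scaleC_complex_def cinner_complex_def algebra_simps scaleR_conv_of_real)

end

lemma norm_scaleC: "norm (c *\<^sub>C x) = cmod c * norm (x :: 'a :: complex_hilbert_space)"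
proof -
  have "cinner (c *\<^sub>C x) (c *\<^sub>C x) = c * cnj (c * cinner x x)"
    by (metis cinner_commute cinner_scaleC_left)
  also have "\<dots> = complex_of_real ((cmod c * norm x)\<^sup>2)"
    by (simp add: cinner_self power_mult_distrib flip: complex_norm_square)
  finally have "(norm (c *\<^sub>C x))\<^sup>2 = (cmod c * norm x)\<^sup>2"
    unfolding cinner_self of_real_eq_iff .
  then show ?thesis
    by (simp add: power2_eq_iff_nonneg)
qed

lemma bounded_linear_scaleC: "bounded_linear (\<lambda>x :: 'a :: complex_hilbert_space. c *\<^sub>C x)"
proof (rule bounded_linear_intro[where K = "cmod c"])
  show "c *\<^sub>C (r *\<^sub>R x) = r *\<^sub>R (c *\<^sub>C x)" for r and x :: 'a
    by (simp add: scaleR_eq_scaleC scaleC_scaleC mult.commute)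
qed (simp_all add: scaleC_add_right norm_scaleC mult.commute)


subsection \<open>Bounded operators\<close>

text \<open>
  The type \<^typ>\<open>'a \<Rightarrow>\<^sub>L 'a\<close> consists of the real-linear bounded maps; complex linearity is the
  predicate \<open>clinear_op\<close>. The operator norm does not depend on the scalar field, and a two-sided
  inverse or an adjoint of a complex-linear map is automatically complex-linear.
\<close>

instantiation blinfun :: (real_normed_vector, complex_hilbert_space) scaleC
begin

lift_definition scaleC_blinfun :: "complex \<Rightarrow> 'a \<Rightarrow>\<^sub>L 'b \<Rightarrow> 'a \<Rightarrow>\<^sub>L 'b"
  is "\<lambda>c f x. c *\<^sub>C f x"
  by (rule bounded_linear_compose[OF bounded_linear_scaleC])

instance ..

end

definition clinear_op :: "('a::complex_hilbert_space \<Rightarrow>\<^sub>L 'a) \<Rightarrow> bool"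
  where "clinear_op T \<longleftrightarrow> (\<forall>c x. T (c *\<^sub>C x) = c *\<^sub>C T x)"

definition is_op_inverse :: "('a::complex_hilbert_space \<Rightarrow>\<^sub>L 'a) \<Rightarrow> ('a \<Rightarrow>\<^sub>L 'a) \<Rightarrow> bool"
  where "is_op_inverse T S \<longleftrightarrow> T o\<^sub>L S = id_blinfun \<and> S o\<^sub>L T = id_blinfun"

definition op_inverse :: "('a::complex_hilbert_space \<Rightarrow>\<^sub>L 'a) \<Rightarrow> ('a \<Rightarrow>\<^sub>L 'a)"
  where "op_inverse T = (THE S. is_op_inverse T S)"

definition op_adjoint :: "('a::complex_hilbert_space \<Rightarrow>\<^sub>L 'a) \<Rightarrow> ('a \<Rightarrow>\<^sub>L 'a)"
  where "op_adjoint T = (THE S :: 'a \<Rightarrow>\<^sub>L 'a. \<forall>x y. cinner (T x) y = cinner x (S y))"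

definition op_spectrum :: "('a::complex_hilbert_space \<Rightarrow>\<^sub>L 'a) \<Rightarrow> complex set"
  where "op_spectrum T = {z. \<not> (\<exists>S. is_op_inverse (z *\<^sub>C id_blinfun - T) S)}"

definition resolvent :: "complex \<Rightarrow> ('a::complex_hilbert_space \<Rightarrow>\<^sub>L 'a) \<Rightarrow> ('a \<Rightarrow>\<^sub>L 'a)"
  where "resolvent z T = op_inverse (z *\<^sub>C id_blinfun - T)"

definition poly_op :: "complex poly \<Rightarrow> ('a::complex_hilbert_space \<Rightarrow>\<^sub>L 'a) \<Rightarrow> ('a \<Rightarrow>\<^sub>L 'a)"
  where "poly_op p T = (\<Sum>i\<le>degree p. coeff p i *\<^sub>C (((o\<^sub>L) T ^^ i) id_blinfun))"


subsection \<open>Rational functions and spectral sets\<close>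

text \<open>
  A rational function is an element of the fraction field of the polynomial ring;
  \<^const>\<open>quot_of_fract\<close> returns its reduced representation, so that the poles are exactly the zeros
  of the denominator. The value of \<open>ratfun_eval\<close> at a pole is meaningless (division by zero),
  hence the separate condition in \<open>bounded_ratfuns\<close> and \<open>unit_ratfuns\<close>.
\<close>

type_synonym ratfun = "complex poly fract"

definition ratfun_num :: "ratfun \<Rightarrow> complex poly"
  where "ratfun_num r = fst (quot_of_fract r)"

definition ratfun_den :: "ratfun \<Rightarrow> complex poly"
  where "ratfun_den r = snd (quot_of_fract r)"

definition ratfun_eval :: "ratfun \<Rightarrow> complex \<Rightarrow> complex"
  where "ratfun_eval r z = poly (ratfun_num r) z / poly (ratfun_den r) z"

definition ratfun_op :: "ratfun \<Rightarrow> ('a::complex_hilbert_space \<Rightarrow>\<^sub>L 'a) \<Rightarrow> ('a \<Rightarrow>\<^sub>L 'a)"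
  where "ratfun_op r T = poly_op (ratfun_num r) T o\<^sub>L op_inverse (poly_op (ratfun_den r) T)"

definition bounded_ratfuns :: "complex set \<Rightarrow> ratfun set"
  where "bounded_ratfuns X =
    {r. (\<forall>z\<in>X. poly (ratfun_den r) z \<noteq> 0) \<and> bounded (ratfun_eval r ` X)}"

definition unit_ratfuns :: "complex set \<Rightarrow> ratfun set"
  where "unit_ratfuns X =
    {r. (\<forall>z\<in>X. poly (ratfun_den r) z \<noteq> 0) \<and> (\<forall>z\<in>X. cmod (ratfun_eval r z) \<le> 1)}"

definition K_spectral_set ::
    "real \<Rightarrow> complex set \<Rightarrow> ('a::complex_hilbert_space \<Rightarrow>\<^sub>L 'a) \<Rightarrow> bool"
  where "K_spectral_set K X T \<longleftrightarrow> closed X \<and> op_spectrum T \<subseteq> X \<and>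
    (\<forall>r\<in>bounded_ratfuns X. norm (ratfun_op r T) \<le> K * (SUP z\<in>X. cmod (ratfun_eval r z)))"


subsection \<open>Rectifiable oriented boundaries\<close>

text \<open>The length of a curve is the supremum of the lengths of inscribed polygons.\<close>

definition curve_length :: "(real \<Rightarrow> complex) \<Rightarrow> real \<Rightarrow> real \<Rightarrow> ereal"
  where "curve_length f a b =
    (SUP ts\<in>{ts. sorted ts \<and> set ts \<subseteq> {a..b}}.
       ereal (\<Sum>(s, t)\<leftarrow>zip ts (tl ts). dist (f s) (f t)))"

text \<open>
  The second conjunct follows from the first one by Lebesgue's theorem on functions of bounded
  variation, which the libraries do not contain.
\<close>

definition arc_length_param :: "real \<Rightarrow> (real \<Rightarrow> complex) \<Rightarrow> bool"
  where "arc_length_param l f \<longleftrightarrow>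
    (\<forall>a b. 0 \<le> a \<and> a \<le> b \<and> b \<le> l \<longrightarrow> curve_length f a b = ereal (b - a)) \<and>
    negligible {s\<in>{0..l}. \<not> f differentiable (at s)}"

text \<open>
  Every connected component \<open>C\<close> of the boundary is a closed curve \<open>\<sigma> C\<close> of finite length \<open>L C\<close>,
  parametrized by arc length on the interval from \<open>0\<close> to \<open>L C\<close>. The curve need not be simple:
  boundary components may touch themselves, a slit is run through once on each side, and an isolated
  point of the boundary is a curve of length zero.
\<close>

definition arc_length_boundary ::
    "complex set \<Rightarrow> (complex set \<Rightarrow> real) \<Rightarrow> (complex set \<Rightarrow> real \<Rightarrow> complex) \<Rightarrow> bool"
  where "arc_length_boundary \<Omega> L \<sigma> \<longleftrightarrow>
    (\<forall>C\<in>components (frontier \<Omega>).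
       0 \<le> L C \<and> arc_length_param (L C) (\<sigma> C) \<and>
       \<sigma> C ` {0..L C} = C \<and> \<sigma> C 0 = \<sigma> C (L C))"

text \<open>
  The orientation for which the Cauchy formula holds in \<open>\<Omega>\<close>. Together with \<open>arc_length_boundary\<close>
  it determines the complex measure \<open>\<sigma>'(s) ds\<close> on the boundary (its Cauchy transform is the
  indicator function of \<open>\<Omega>\<close> almost everywhere), hence all boundary integrals below.
\<close>

definition positively_oriented_boundary ::
    "complex set \<Rightarrow> (complex set \<Rightarrow> real) \<Rightarrow> (complex set \<Rightarrow> real \<Rightarrow> complex) \<Rightarrow> bool"
  where "positively_oriented_boundary \<Omega> L \<sigma> \<longleftrightarrow>
    (\<forall>z\<in>\<Omega>. (\<Sum>C\<in>components (frontier \<Omega>). winding_number (\<lambda>t. \<sigma> C (L C * t)) z) = 1) \<and>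
    (\<forall>z. z \<notin> closure \<Omega> \<longrightarrow>
      (\<Sum>C\<in>components (frontier \<Omega>). winding_number (\<lambda>t. \<sigma> C (L C * t)) z) = 0)"

text \<open>The integral over the boundary of \<open>F (\<sigma>(s)) (\<sigma>'(s)) ds\<close>.\<close>

definition boundary_integral ::
    "complex set \<Rightarrow> (complex set \<Rightarrow> real) \<Rightarrow> (complex set \<Rightarrow> real \<Rightarrow> complex) \<Rightarrow>
     (complex \<Rightarrow> complex \<Rightarrow> 'b::real_normed_vector) \<Rightarrow> 'b"
  where "boundary_integral \<Omega> L \<sigma> F =
    (\<Sum>C\<in>components (frontier \<Omega>).
       integral {0..L C} (\<lambda>s. F (\<sigma> C s) (vector_derivative (\<sigma> C) (at s))))"


subsection \<open>The operator \<open>S(f, A)\<close> and the constant \<open>c1\<close>\<close>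

text \<open>The argument \<open>\<tau>\<close> is the unit tangent vector \<open>\<sigma>'(s)\<close> at the boundary point \<open>\<zeta> = \<sigma>(s)\<close>.\<close>

definition mu_op ::
    "complex \<Rightarrow> complex \<Rightarrow> ('a::complex_hilbert_space \<Rightarrow>\<^sub>L 'a) \<Rightarrow> ('a \<Rightarrow>\<^sub>L 'a)"
  where "mu_op \<zeta> \<tau> A = (1 / (2 * complex_of_real pi * \<i>)) *\<^sub>C
    (\<tau> *\<^sub>C resolvent \<zeta> A - cnj \<tau> *\<^sub>C resolvent (cnj \<zeta>) (op_adjoint A))"

definition S_op ::
    "complex set \<Rightarrow> (complex set \<Rightarrow> real) \<Rightarrow> (complex set \<Rightarrow> real \<Rightarrow> complex) \<Rightarrow>
     (complex \<Rightarrow> complex) \<Rightarrow> ('a::complex_hilbert_space \<Rightarrow>\<^sub>L 'a) \<Rightarrow> ('a \<Rightarrow>\<^sub>L 'a)"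
  where "S_op \<Omega> L \<sigma> f A = boundary_integral \<Omega> L \<sigma> (\<lambda>\<zeta> \<tau>. f \<zeta> *\<^sub>C mu_op \<zeta> \<tau> A)"

definition conj_cauchy ::
    "complex set \<Rightarrow> (complex set \<Rightarrow> real) \<Rightarrow> (complex set \<Rightarrow> real \<Rightarrow> complex) \<Rightarrow>
     (complex \<Rightarrow> complex) \<Rightarrow> complex \<Rightarrow> complex"
  where "conj_cauchy \<Omega> L \<sigma> f z =
    1 / (2 * complex_of_real pi * \<i>) *
    boundary_integral \<Omega> L \<sigma> (\<lambda>\<zeta> \<tau>. cnj (f \<zeta>) * \<tau> / (\<zeta> - z))"

definition continuous_extension :: "complex set \<Rightarrow> (complex \<Rightarrow> complex) \<Rightarrow> complex \<Rightarrow> complex"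
  where "continuous_extension \<Omega> g z = (if z \<in> \<Omega> then g z else Lim (at z within \<Omega>) g)"

definition c1_const ::
    "complex set \<Rightarrow> (complex set \<Rightarrow> real) \<Rightarrow> (complex set \<Rightarrow> real \<Rightarrow> complex) \<Rightarrow> ereal"
  where "c1_const \<Omega> L \<sigma> =
    (SUP r\<in>unit_ratfuns \<Omega>. SUP z\<in>closure \<Omega>.
       ereal (cmod (continuous_extension \<Omega> (conj_cauchy \<Omega> L \<sigma> (ratfun_eval r)) z)))"

end

theory Submission
  imports Defs "HOL-Computational_Algebra.Fundamental_Theorem_Algebra"
begin

text \<open>
  Write \<open>F = f(A)\<close> for a rational \<open>f\<close> with \<open>|f| \<le> 1\<close> in \<open>\<Omega>\<close>, and let \<open>g\<close> be the Cauchy transform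
  of the conjugate of \<open>f\<close>. The Cauchy formula gives \<open>S(f, A) = F + g(A)\<^sup>*\<close>
  (\<open>cinner_S_op\<close>), so that
  \<open>F\<^sup>* F F\<^sup>* F = F\<^sup>* (S + \<gamma>) F\<^sup>* F - (F g(A) F)\<^sup>* F - \<gamma> (F F)\<^sup>* F\<close>.
  Let \<open>\<kappa>\<close> be the supremum of the norms \<open>\<parallel>f(A)\<parallel>\<close>; it is finite because \<open>f(A)\<close> is a Cauchy integral over
  a boundary of finite length, on which the resolvent is bounded. Since \<open>f g f\<close> and \<open>f f\<close> are
  bounded by \<open>c\<^sub>1\<close> and \<open>1\<close>, the identity yields
  \<open>\<parallel>F\<parallel>\<^sup>4 \<le> 2 c\<^sub>2 \<kappa>\<^sup>3 + \<kappa>\<^sup>2 (c\<^sub>1 + |\<gamma>|)\<close> (\<open>quartic_bound\<close>). Passing to the supremum over \<open>f\<close>,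
  \<open>\<kappa>\<^sup>2 \<le> 2 c\<^sub>2 \<kappa> + c\<^sub>1 + sup |\<gamma>|\<close>, and \<open>\<kappa>\<close> is at most the larger root of this quadratic inequality.

  The function \<open>g\<close> is not rational, so the bound for \<open>f g f\<close> requires a meaning of \<open>g(A)\<close>. The
  function \<open>g\<close> extends continuously to the closure (\<open>continuous_on_cauchy_closure\<close>); by
  the hypothesis on \<open>\<Omega>\<close> it is a uniform limit of rational functions \<open>h\<^sub>n\<close>, and \<open>h\<^sub>n(A)\<close> converges to the
  operator that occurs in \<open>S(f, A)\<close> (\<open>norm_product_le\<close>). The last point
  rests on the fact that two continuous boundary functions with the same Cauchy transform in \<open>\<Omega>\<close>
  define the same operator (\<open>calculus_eq_if_cauchy_eq\<close>). Its proof avoids homology: by the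
  resolvent identity, the resolvent applied to the difference of both operators extends across the
  spectrum to an entire function that vanishes at infinity (\<open>calculus_const_cauchy\<close>). The
  same argument underlies the Cauchy formula for \<open>f(A)\<close> (\<open>calculus_ratfun\<close>).

  The curves are merely rectifiable. What is needed of real analysis is the fundamental theorem of
  calculus for Lipschitz functions that are differentiable almost everywhere
  (\<open>has_integral_derivative_lipschitz\<close>) and, as a consequence, the representation of winding
  numbers as integrals (\<open>winding_number_arc\<close>).
\<close>

section \<open>Complex Hilbert spaces and adjoints\<close>

lemma cinner_add_right: "cinner x (y + z) = cinner x y + cinner x z"
  by (metis cinner_add_left cinner_commute complex_cnj_add)

lemma cinner_scaleC_right: "cinner x (c *\<^sub>C y) = cnj c * cinner x y"
  by (metis cinner_scaleC_left cinner_commute complex_cnj_mult)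

lemma scaleC_one [simp]: "1 *\<^sub>C x = (x :: 'a :: complex_hilbert_space)"
  using scaleR_eq_scaleC[of 1 x] by simp

lemma scaleC_zero_left [simp]: "0 *\<^sub>C x = (0 :: 'a :: complex_hilbert_space)"
  using scaleR_eq_scaleC[of 0 x] by simp

lemma scaleC_zero_right [simp]: "c *\<^sub>C 0 = (0 :: 'a :: complex_hilbert_space)"
  by (metis mult_zero_right scaleC_scaleC scaleC_zero_left)

lemma scaleC_minus_left: "(- c) *\<^sub>C x = - (c *\<^sub>C (x :: 'a :: complex_hilbert_space))"
  by (metis add.right_inverse add_eq_0_iff scaleC_add_left scaleC_zero_left)

lemma scaleC_minus_right: "c *\<^sub>C (- x) = - (c *\<^sub>C (x :: 'a :: complex_hilbert_space))"
  by (metis add.right_inverse add_eq_0_iff scaleC_add_right scaleC_zero_right)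

lemma scaleC_diff_right: "c *\<^sub>C (x - y) = c *\<^sub>C x - c *\<^sub>C (y :: 'a :: complex_hilbert_space)"
  by (metis diff_conv_add_uminus scaleC_add_right scaleC_minus_right)

lemma scaleC_diff_left: "(c - d) *\<^sub>C x = c *\<^sub>C x - d *\<^sub>C (x :: 'a :: complex_hilbert_space)"
  by (metis diff_conv_add_uminus scaleC_add_left scaleC_minus_left)

lemma cinner_minus_left: "cinner (- x) y = - cinner x y"
  by (metis cinner_scaleC_left mult_minus1 scaleC_minus_left scaleC_one)

lemma cinner_minus_right: "cinner x (- y) = - cinner x y"
  by (metis cinner_minus_left cinner_commute complex_cnj_minus)

lemma cinner_diff_left: "cinner (x - y) z = cinner x z - cinner y z"
  by (simp add: diff_conv_add_uminus cinner_add_left cinner_minus_left del: add_uminus_conv_diff)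

lemma cinner_diff_right: "cinner x (y - z) = cinner x y - cinner x z"
  by (simp add: diff_conv_add_uminus cinner_add_right cinner_minus_right del: add_uminus_conv_diff)

lemma cinner_zero_left [simp]: "cinner 0 x = 0"
  using cinner_diff_left[of 0 0 x] by simp

lemma cinner_zero_right [simp]: "cinner x 0 = 0"
  using cinner_diff_right[of x 0 0] by simp

lemma norm_add_squared:
  "(norm (x + y))\<^sup>2 = (norm x)\<^sup>2 + (norm y)\<^sup>2 + 2 * Re (cinner x (y :: 'a :: complex_hilbert_space))"
proof -
  have "complex_of_real ((norm (x + y))\<^sup>2)
      = of_real ((norm x)\<^sup>2) + of_real ((norm y)\<^sup>2) + (cinner x y + cnj (cinner x y))"
    using cinner_commute[of y x]
    by (simp add: cinner_self[symmetric] cinner_add_left cinner_add_right del: of_real_power)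
  also have "\<dots> = of_real ((norm x)\<^sup>2 + (norm y)\<^sup>2 + 2 * Re (cinner x y))"
    by (simp add: complex_add_cnj)
  finally show ?thesis
    unfolding of_real_eq_iff .
qed

lemma cmod_cinner_le: "cmod (cinner x y) \<le> norm x * norm (y :: 'a :: complex_hilbert_space)"
proof (cases "y = 0")
  case False
  then have ny: "norm y > 0" by simp
  define c where "c = - cinner x y / of_real ((norm y)\<^sup>2)"
  have "cinner x (c *\<^sub>C y) = - of_real ((cmod (cinner x y))\<^sup>2 / (norm y)\<^sup>2)"
    by (simp add: c_def cinner_scaleC_right complex_norm_square mult.commute flip: of_real_power)
  moreover have "norm (c *\<^sub>C y) = cmod (cinner x y) / norm y"
    using ny by (simp add: c_def norm_scaleC norm_divide power2_eq_square norm_mult)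
  ultimately have "(norm (x + c *\<^sub>C y))\<^sup>2 = (norm x)\<^sup>2 - (cmod (cinner x y) / norm y)\<^sup>2"
    by (simp add: norm_add_squared power_divide)
  then have "(cmod (cinner x y) / norm y)\<^sup>2 \<le> (norm x)\<^sup>2"
    by (metis diff_ge_0_iff_ge zero_le_power2)
  then show ?thesis
    using ny by (simp add: power2_le_iff_abs_le divide_le_eq)
qed simp

lemma bounded_linear_cinner_left: "bounded_linear (\<lambda>x :: 'a :: complex_hilbert_space. cinner x y)"
  by (rule bounded_linear_intro[where K = "norm y"])
     (auto simp: cinner_add_left scaleR_eq_scaleC cinner_scaleC_left cmod_cinner_le scaleC_complex_def)

lemma cinner_eqI:
  assumes "\<And>y. cinner x y = cinner x' (y :: 'a :: complex_hilbert_space)"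
  shows "x = x'"
proof -
  have "cinner (x - x') (x - x') = 0"
    by (simp only: cinner_diff_left assms) simp
  then show ?thesis
    by (simp add: cinner_self)
qed

lemma cinner_eqI_right:
  assumes "\<And>x. cinner x y = cinner x (y' :: 'a :: complex_hilbert_space)"
  shows "y = y'"
  by (rule cinner_eqI) (metis assms cinner_commute)

lemma norm_le_cinnerI:
  assumes "\<And>y. cmod (cinner x y) \<le> K * norm (y :: 'a :: complex_hilbert_space)" "0 \<le> K"
  shows "norm x \<le> K"
proof (cases "x = 0")
  case False
  have "norm x * norm x \<le> K * norm x"
    using assms(1)[of x] by (simp add: cinner_self power2_eq_square norm_mult)
  then show ?thesis
    using False by (simp add: mult_le_cancel_right)
qed (simp add: assms)

text \<open>
  The functional \<open>x \<mapsto> \<parallel>x\<parallel>\<^sup>2 - 2 Re \<phi>(x)\<close> is bounded below; by the parallelogram identity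
  each minimizing sequence is Cauchy, and the vanishing of the first variation at the minimizer
  \<open>v\<close> says that \<open>v\<close> represents \<open>\<phi>\<close>.
\<close>

lemma riesz_representation:
  fixes \<phi> :: "'a :: complex_hilbert_space \<Rightarrow> complex"
  assumes bl: "bounded_linear \<phi>" and cl: "\<And>c x. \<phi> (c *\<^sub>C x) = c * \<phi> x"
  shows "\<exists>v. \<forall>x. \<phi> x = cinner x v"
proof -
  interpret bounded_linear \<phi> by fact
  obtain M where M: "\<And>x. cmod (\<phi> x) \<le> norm x * M" "0 \<le> M"
    using nonneg_bounded by blast
  define J where "J x = (norm x)\<^sup>2 - 2 * Re (\<phi> x)" for x
  have lower: "- (M\<^sup>2) \<le> J x" for x
  proof -
    have "Re (\<phi> x) \<le> norm x * M"
      using complex_Re_le_cmod M(1) order_trans by blast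
    moreover have "0 \<le> (norm x - M)\<^sup>2" by simp
    ultimately show ?thesis
      by (simp add: J_def power2_diff)
  qed
  define m where "m = Inf (range J)"
  have bdd: "bdd_below (range J)"
    using lower by (auto intro!: bdd_belowI2)
  have m: "m \<le> J x" for x
    unfolding m_def by (rule cInf_lower[OF _ bdd]) simp
  have "\<exists>x. J x < m + inverse (real (Suc n))" for n
  proof -
    have "Inf (range J) < m + inverse (real (Suc n))"
      by (simp add: m_def)
    then show ?thesis
      by (subst (asm) cInf_less_iff) (use bdd in auto)
  qed
  then obtain X where X: "\<And>n. J (X n) < m + inverse (real (Suc n))"
    by metis
  have par: "(norm (x - y))\<^sup>2 \<le> 2 * (J x - m) + 2 * (J y - m)" for x y
  proof -
    have "(norm (x - y))\<^sup>2 + (norm (x + y))\<^sup>2 = 2 * (norm x)\<^sup>2 + 2 * (norm y)\<^sup>2"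
      using norm_add_squared[of x y] norm_add_squared[of x "- y"]
      by (simp add: cinner_minus_right)
    moreover have "4 * J ((1/2) *\<^sub>R (x + y)) = (norm (x + y))\<^sup>2 - 4 * Re (\<phi> x + \<phi> y)"
      by (simp add: J_def power2_eq_square scaleR add)
    moreover have "4 * m \<le> 4 * J ((1/2) *\<^sub>R (x + y))"
      using m by simp
    ultimately show ?thesis
      by (simp add: J_def)
  qed
  have "Cauchy X"
  proof (rule metric_CauchyI)
    fix e :: real assume "0 < e"
    obtain N where N: "inverse (real (Suc N)) < e\<^sup>2 / 4"
      using reals_Archimedean[of "e\<^sup>2 / 4"] \<open>0 < e\<close> by auto
    show "\<exists>M. \<forall>i\<ge>M. \<forall>n\<ge>M. dist (X i) (X n) < e"
    proof (intro exI allI impI)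
      fix i n assume "i \<ge> N" "n \<ge> N"
      have "inverse (real (Suc i)) \<le> inverse (real (Suc N))" "inverse (real (Suc n)) \<le> inverse (real (Suc N))"
        using \<open>i \<ge> N\<close> \<open>n \<ge> N\<close> by (auto intro!: le_imp_inverse_le)
      then have "J (X i) - m < e\<^sup>2 / 4" "J (X n) - m < e\<^sup>2 / 4"
        using X[of i] X[of n] N by linarith+
      then have "(norm (X i - X n))\<^sup>2 < e\<^sup>2"
        using par[of "X i" "X n"] by argo
      then show "dist (X i) (X n) < e"
        using \<open>0 < e\<close> by (simp add: dist_norm power2_less_imp_less)
    qed
  qed
  then obtain v where v: "X \<longlonglongrightarrow> v"
    using Cauchy_convergent_iff convergent_def by blast
  have 1: "(\<lambda>n. J (X n)) \<longlonglongrightarrow> J v"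
    unfolding J_def
    by (intro tendsto_diff tendsto_power tendsto_norm tendsto_mult tendsto_const tendsto_Re tendsto[OF v] v)
  have 2: "(\<lambda>n. m + inverse (real (Suc n))) \<longlonglongrightarrow> m + 0"
    by (intro tendsto_add tendsto_const LIMSEQ_inverse_real_of_nat)
  have "J v \<le> m + 0"
    by (rule LIMSEQ_le[OF 1 2]) (meson X less_imp_le)
  then have min: "J v \<le> J x" for x
    using m[of x] by linarith
  have re: "Re (\<phi> h) = Re (cinner h v)" for h
  proof -
    define a where "a = Re (cinner v h) - Re (\<phi> h)"
    have quad: "0 \<le> t\<^sup>2 * (norm h)\<^sup>2 + 2 * t * a" for t :: real
    proof -
      have "J (v + t *\<^sub>R h) = J v + t\<^sup>2 * (norm h)\<^sup>2 + 2 * t * a"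
        by (simp add: J_def norm_add_squared add cl a_def scaleR_eq_scaleC[of t h]
              cinner_scaleC_right norm_scaleC power_mult_distrib algebra_simps)
      with min[of "v + t *\<^sub>R h"] show ?thesis by linarith
    qed
    have "a = 0"
    proof (rule ccontr)
      assume "a \<noteq> 0"
      define q where "q = (norm h)\<^sup>2 + 1"
      have "q > 0"
        unfolding q_def by (simp add: add_nonneg_pos)
      define t where "t = - a / q"
      have "t\<^sup>2 * (norm h)\<^sup>2 + 2 * t * a \<le> t\<^sup>2 * q + 2 * t * a"
        by (simp add: q_def mult_left_mono)
      also have "\<dots> = t * (t * q) + 2 * t * a"
        by (simp add: power2_eq_square)
      also have "t * q = - a"
        using \<open>q > 0\<close> by (simp add: t_def)
      also have "t * - a + 2 * t * a = - (a * a / q)"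
        by (simp add: t_def)
      also have "\<dots> < 0"
        using divide_pos_pos[OF _ \<open>q > 0\<close>] \<open>a \<noteq> 0\<close> not_real_square_gt_zero[of a] neg_less_0_iff_less by blast
      finally show False
        using quad[of t] by linarith
    qed
    then show ?thesis
      using cinner_commute[of v h] by (simp add: a_def)
  qed
  have "\<phi> x = cinner x v" for x
  proof (rule complex_eqI)
    show "Re (\<phi> x) = Re (cinner x v)" by (rule re)
    show "Im (\<phi> x) = Im (cinner x v)"
      using re[of "\<i> *\<^sub>C x"] by (simp add: cl cinner_scaleC_left)
  qed
  then show ?thesis by blast
qed

lemma scaleC_blinfun_apply [simp]:
  fixes T :: "'b :: real_normed_vector \<Rightarrow>\<^sub>L 'a :: complex_hilbert_space"
  shows "blinfun_apply (c *\<^sub>C T) x = c *\<^sub>C T x"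
  by transfer simp

lemma blinfun_norm_cinnerI:
  fixes T :: "'a::complex_hilbert_space \<Rightarrow>\<^sub>L 'a"
  assumes "\<And>x y. cmod (cinner (T x) y) \<le> K * norm x * norm y" "0 \<le> K"
  shows "norm T \<le> K"
proof (rule norm_blinfun_bound[OF assms(2)])
  show "norm (T x) \<le> K * norm x" for x
    by (rule norm_le_cinnerI) (simp_all add: assms)
qed

lemma op_adjoint_exists:
  fixes T :: "'a::complex_hilbert_space \<Rightarrow>\<^sub>L 'a"
  assumes "clinear_op T"
  shows "\<exists>S :: 'a \<Rightarrow>\<^sub>L 'a. \<forall>x y. cinner (T x) y = cinner x (S y)"
proof -
  have "\<exists>v. \<forall>x. cinner (T x) y = cinner x v" for y
  proof (rule riesz_representation)
    show "bounded_linear (\<lambda>x. cinner (T x) y)"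
      by (rule bounded_linear_compose[OF bounded_linear_cinner_left blinfun.bounded_linear_right])
    show "cinner (T (c *\<^sub>C x)) y = c * cinner (T x) y" for c x
      using assms by (simp add: clinear_op_def cinner_scaleC_left)
  qed
  then obtain S where S: "\<And>x y. cinner (T x) y = cinner x (S y)"
    by metis
  have "bounded_linear S"
  proof (rule bounded_linear_intro[where K = "norm T"])
    show "S (x + y) = S x + S y" for x y
      by (rule cinner_eqI_right) (simp add: S[symmetric] cinner_add_right)
    show "S (r *\<^sub>R x) = r *\<^sub>R S x" for r x
      by (rule cinner_eqI_right) (simp add: S[symmetric] cinner_scaleC_right scaleR_eq_scaleC)
    show "norm (S y) \<le> norm y * norm T" for y
    proof (rule norm_le_cinnerI)
      show "cmod (cinner (S y) x) \<le> norm y * norm T * norm x" for x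
      proof -
        have "cmod (cinner (S y) x) = cmod (cinner (T x) y)"
          unfolding S by (subst cinner_commute) simp
        also have "\<dots> \<le> norm (T x) * norm y"
          by (rule cmod_cinner_le)
        also have "\<dots> \<le> (norm T * norm x) * norm y"
          by (rule mult_right_mono[OF norm_blinfun]) simp
        finally show ?thesis by (simp add: mult_ac)
      qed
    qed simp
  qed
  then show ?thesis
    using S by (intro exI[of _ "Blinfun S"]) (simp add: bounded_linear_Blinfun_apply)
qed

lemma cinner_op_adjoint:
  fixes T :: "'a::complex_hilbert_space \<Rightarrow>\<^sub>L 'a"
  assumes "clinear_op T"
  shows "cinner (T x) y = cinner x (op_adjoint T y)"
proof -
  have "\<exists>!S :: 'a \<Rightarrow>\<^sub>L 'a. \<forall>x y. cinner (T x) y = cinner x (S y)"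
  proof (rule ex_ex1I[OF op_adjoint_exists[OF assms]])
    fix S S' :: "'a \<Rightarrow>\<^sub>L 'a"
    assume "\<forall>x y. cinner (T x) y = cinner x (S y)" "\<forall>x y. cinner (T x) y = cinner x (S' y)"
    then have "cinner x (S y) = cinner x (S' y)" for x y
      by metis
    then show "S = S'"
      by (rule blinfun_eqI[OF cinner_eqI_right])
  qed
  from theI'[OF this] show ?thesis
    unfolding op_adjoint_def by (elim allE)
qed

lemma cinner_op_adjoint_left:
  assumes "clinear_op (T :: 'a::complex_hilbert_space \<Rightarrow>\<^sub>L 'a)"
  shows "cinner (op_adjoint T x) y = cinner x (T y)"
  by (subst (1 2) cinner_commute) (simp only: cinner_op_adjoint[OF assms])

section \<open>Inverses, resolvents and their adjoints\<close>

lemma norm_scaleC_blinfun_le: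
  fixes T :: "'b :: real_normed_vector \<Rightarrow>\<^sub>L 'a :: complex_hilbert_space"
  shows "norm (c *\<^sub>C T) \<le> cmod c * norm T"
proof (rule norm_blinfun_bound)
  show "norm ((c *\<^sub>C T) x) \<le> cmod c * norm T * norm x" for x
    using mult_left_mono[OF norm_blinfun[of T x], of "cmod c"]
    by (simp add: norm_scaleC mult_ac)
qed simp

lemma bounded_bilinear_scaleC_blinfun:
  "bounded_bilinear (\<lambda>c (T :: 'b :: real_normed_vector \<Rightarrow>\<^sub>L 'a :: complex_hilbert_space). c *\<^sub>C T)"
proof
  fix r c c' and T T' :: "'b \<Rightarrow>\<^sub>L 'a"
  show "(c + c') *\<^sub>C T = c *\<^sub>C T + c' *\<^sub>C T"
    by (rule blinfun_eqI) (simp add: scaleC_add_left blinfun.add_left)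
  show "c *\<^sub>C (T + T') = c *\<^sub>C T + c *\<^sub>C T'"
    by (rule blinfun_eqI) (simp add: scaleC_add_right blinfun.add_left)
  show "(r *\<^sub>R c) *\<^sub>C T = r *\<^sub>R c *\<^sub>C T"
    by (rule blinfun_eqI)
       (simp add: blinfun.scaleR_left scaleR_eq_scaleC[of r "c *\<^sub>C T x" for x] scaleC_scaleC scaleR_conv_of_real)
  show "c *\<^sub>C r *\<^sub>R T = r *\<^sub>R c *\<^sub>C T"
    by (rule blinfun_eqI)
       (simp add: blinfun.scaleR_left scaleR_eq_scaleC scaleC_scaleC mult.commute)
next
  show "\<exists>K. \<forall>c (T :: 'b \<Rightarrow>\<^sub>L 'a). norm (c *\<^sub>C T) \<le> norm c * norm T * K"
    by (rule exI[of _ 1]) (simp add: norm_scaleC_blinfun_le)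
qed

lemma is_op_inverse_apply:
  fixes T S :: "'a::complex_hilbert_space \<Rightarrow>\<^sub>L 'a"
  assumes "is_op_inverse T S"
  shows "T (S x) = x" "S (T x) = x"
  using assms unfolding is_op_inverse_def
  by (metis blinfun_apply_blinfun_compose blinfun_apply_id_blinfun id_apply)+

lemma is_op_inverseI:
  fixes T S :: "'a::complex_hilbert_space \<Rightarrow>\<^sub>L 'a"
  assumes "\<And>x. T (S x) = x" "\<And>x. S (T x) = x"
  shows "is_op_inverse T S"
  using assms unfolding is_op_inverse_def by (auto intro: blinfun_eqI)

lemma op_inverse_eq:
  assumes "is_op_inverse T S"
  shows "op_inverse T = S"
  unfolding op_inverse_def
proof (rule the_equality)
  show "is_op_inverse T S" by fact
  fix S' assume S': "is_op_inverse T S'"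
  show "S' = S"
    by (rule blinfun_eqI) (metis S' assms is_op_inverse_apply)
qed

lemma is_op_inverse_op_inverse:
  assumes "\<exists>S. is_op_inverse T S"
  shows "is_op_inverse T (op_inverse T)"
  using assms op_inverse_eq by metis

lemma is_op_inverse_compose:
  assumes "is_op_inverse T T'" "is_op_inverse S S'"
  shows "is_op_inverse (T o\<^sub>L S) (S' o\<^sub>L T')"
  by (rule is_op_inverseI) (simp_all add: is_op_inverse_apply[OF assms(1)] is_op_inverse_apply[OF assms(2)])

lemma neumann_series:
  fixes T :: "'a::complex_hilbert_space \<Rightarrow>\<^sub>L 'a"
  assumes "norm T < 1"
  shows "\<exists>S. is_op_inverse (id_blinfun - T) S"
proof -
  define p where "p n = ((o\<^sub>L) T ^^ n) id_blinfun" for n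
  have p0: "p 0 = id_blinfun" and pS: "p (Suc n) = T o\<^sub>L p n" for n
    by (simp_all add: p_def)
  have pS': "p (Suc n) = p n o\<^sub>L T" for n
  proof (induction n)
    case (Suc n)
    have "T o\<^sub>L (p n o\<^sub>L T) = (T o\<^sub>L p n) o\<^sub>L T"
      by (rule blinfun_eqI) simp
    then show ?case
      using Suc pS by metis
  qed (auto intro!: blinfun_eqI simp: pS p0)
  have norm_p: "norm (p n) \<le> norm T ^ n" for n
  proof (induction n)
    case (Suc n)
    have "norm (p (Suc n)) \<le> norm T * norm (p n)"
      unfolding pS by (rule norm_blinfun_compose)
    also have "\<dots> \<le> norm T * norm T ^ n"
      by (rule mult_left_mono[OF Suc]) simp
    finally show ?case by simp
  qed (simp add: p0 norm_blinfun_id_le)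
  have sm: "summable p"
    by (rule summable_comparison_test[OF _ summable_geometric[of "norm T"]])
       (use norm_p assms in auto)
  have split: "(\<Sum>n. p (Suc n)) = suminf p - id_blinfun"
    using suminf_split_head[OF sm] p0 by simp
  have l: "T o\<^sub>L suminf p = suminf p - id_blinfun"
    using bounded_linear.suminf[OF bounded_bilinear.bounded_linear_right[OF bounded_bilinear_blinfun_compose] sm, of T]
    by (simp add: split flip: pS)
  have r: "suminf p o\<^sub>L T = suminf p - id_blinfun"
    using bounded_linear.suminf[OF bounded_bilinear.bounded_linear_left[OF bounded_bilinear_blinfun_compose] sm, of T]
    by (simp add: split flip: pS')
  have "T (suminf p x) = suminf p x - x" "suminf p (T x) = suminf p x - x" for x
    using arg_cong[OF l, of "\<lambda>S. blinfun_apply S x"] arg_cong[OF r, of "\<lambda>S. blinfun_apply S x"]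
    by (simp_all add: blinfun.diff_left)
  then have "is_op_inverse (id_blinfun - T) (suminf p)"
    by (intro is_op_inverseI) (simp_all add: blinfun.diff_left blinfun.diff_right)
  then show ?thesis by blast
qed

lemma invertible_perturbation:
  fixes T :: "'a::complex_hilbert_space \<Rightarrow>\<^sub>L 'a"
  assumes "is_op_inverse T R" "norm R * norm E < 1"
  shows "\<exists>S. is_op_inverse (T + E) S"
proof -
  have "norm (- (R o\<^sub>L E)) < 1"
    using norm_blinfun_compose[of R E] assms(2) by simp
  then obtain S where "is_op_inverse (id_blinfun - - (R o\<^sub>L E)) S"
    using neumann_series by blast
  from is_op_inverse_compose[OF assms(1) this]
  have "is_op_inverse (T o\<^sub>L (id_blinfun - - (R o\<^sub>L E))) (S o\<^sub>L R)" .
  moreover have "T o\<^sub>L (id_blinfun - - (R o\<^sub>L E)) = T + E"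
    by (rule blinfun_eqI)
       (simp add: blinfun.add_left blinfun.add_right is_op_inverse_apply[OF assms(1)])
  ultimately show ?thesis by auto
qed

lemma resolvent_inverse:
  fixes A :: "'a::complex_hilbert_space \<Rightarrow>\<^sub>L 'a"
  assumes "z \<notin> op_spectrum A"
  shows "z *\<^sub>C resolvent z A x - A (resolvent z A x) = x"
    and "resolvent z A (z *\<^sub>C x - A x) = x"
proof -
  have "is_op_inverse (z *\<^sub>C id_blinfun - A) (resolvent z A)"
    unfolding resolvent_def using assms by (intro is_op_inverse_op_inverse) (simp add: op_spectrum_def)
  from is_op_inverse_apply[OF this, of x]
  show "z *\<^sub>C resolvent z A x - A (resolvent z A x) = x"
    and "resolvent z A (z *\<^sub>C x - A x) = x"
    by (simp_all add: blinfun.diff_left)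
qed

lemma clinear_op_scaleC: "clinear_op T \<Longrightarrow> T (c *\<^sub>C x) = c *\<^sub>C T x"
  by (simp add: clinear_op_def)

lemma clinear_op_resolvent:
  fixes A :: "'a::complex_hilbert_space \<Rightarrow>\<^sub>L 'a"
  assumes "clinear_op A" "z \<notin> op_spectrum A"
  shows "clinear_op (resolvent z A)"
  unfolding clinear_op_def
proof safe
  fix c x
  define u where "u = resolvent z A x"
  have "z *\<^sub>C (c *\<^sub>C u) - A (c *\<^sub>C u) = c *\<^sub>C (z *\<^sub>C u - A u)"
    by (simp add: clinear_op_scaleC[OF assms(1)] scaleC_scaleC mult.commute scaleC_diff_right)
  also have "\<dots> = c *\<^sub>C x"
    using resolvent_inverse(1)[OF assms(2), of x] by (simp add: u_def)
  finally have "resolvent z A (c *\<^sub>C x) = resolvent z A (z *\<^sub>C (c *\<^sub>C u) - A (c *\<^sub>C u))"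
    by (rule arg_cong[OF sym])
  then show "resolvent z A (c *\<^sub>C x) = c *\<^sub>C resolvent z A x"
    by (simp add: resolvent_inverse(2)[OF assms(2)] u_def)
qed

lemma open_resolvent_set:
  fixes A :: "'a::complex_hilbert_space \<Rightarrow>\<^sub>L 'a"
  shows "open (- op_spectrum A)"
  unfolding open_dist
proof (intro ballI)
  fix z assume z: "z \<in> - op_spectrum A"
  then obtain R where R: "is_op_inverse (z *\<^sub>C id_blinfun - A) R"
    by (auto simp: op_spectrum_def)
  define e where "e = inverse (norm R + 1)"
  have "e > 0" unfolding e_def by (simp add: add_nonneg_pos)
  have "w \<notin> op_spectrum A" if w: "dist w z < e" for w
  proof -
    have "norm ((w - z) *\<^sub>C (id_blinfun :: 'a \<Rightarrow>\<^sub>L 'a)) \<le> cmod (w - z)"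
      using norm_scaleC_blinfun_le[of "w - z" "id_blinfun :: 'a \<Rightarrow>\<^sub>L 'a"]
        mult_left_mono[OF norm_blinfun_id_le[where 'a = 'a], of "cmod (w - z)"] by simp
    then have "norm R * norm ((w - z) *\<^sub>C (id_blinfun :: 'a \<Rightarrow>\<^sub>L 'a)) \<le> norm R * e"
      using w by (intro mult_left_mono) (auto simp: dist_norm)
    also have "\<dots> < 1"
      by (simp add: e_def divide_simps add_nonneg_pos) 
    finally have "norm R * norm ((w - z) *\<^sub>C (id_blinfun :: 'a \<Rightarrow>\<^sub>L 'a)) < 1" .
    then obtain S where "is_op_inverse (z *\<^sub>C id_blinfun - A + (w - z) *\<^sub>C id_blinfun) S"
      using invertible_perturbation[OF R] by blast
    moreover have "z *\<^sub>C id_blinfun - A + (w - z) *\<^sub>C id_blinfun = w *\<^sub>C id_blinfun - A"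
      by (rule blinfun_eqI) (simp add: blinfun.add_left blinfun.diff_left scaleC_diff_left)
    ultimately show ?thesis
      by (auto simp: op_spectrum_def)
  qed
  then show "\<exists>e>0. \<forall>y. dist y z < e \<longrightarrow> y \<in> - op_spectrum A"
    using \<open>e > 0\<close> by auto
qed

lemma resolvent_identity:
  fixes A :: "'a::complex_hilbert_space \<Rightarrow>\<^sub>L 'a"
  assumes "clinear_op A" "z \<notin> op_spectrum A" "w \<notin> op_spectrum A"
  shows "resolvent z A x - resolvent w A x = (w - z) *\<^sub>C resolvent z A (resolvent w A x)"
proof -
  define u where "u = resolvent w A x"
  have x: "x = w *\<^sub>C u - A u"
    using resolvent_inverse(1)[OF assms(3), of x] by (simp add: u_def)
  have x: "x = (z *\<^sub>C u - A u) + (w - z) *\<^sub>C u"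
    unfolding x by (simp add: scaleC_diff_left)
  have "resolvent z A x = u + (w - z) *\<^sub>C resolvent z A u"
    by (subst x) (simp add: blinfun.add_right resolvent_inverse(2)[OF assms(2)]
          clinear_op_scaleC[OF clinear_op_resolvent[OF assms(1,2)]])
  then show ?thesis
    by (simp add: u_def)
qed

lemma isCont_resolvent:
  fixes A :: "'a::complex_hilbert_space \<Rightarrow>\<^sub>L 'a"
  assumes A: "clinear_op A" and z: "z \<notin> op_spectrum A"
  shows "isCont (\<lambda>w. resolvent w A) z"
proof -
  define N where "N = norm (resolvent z A)"
  have bound: "norm (resolvent w A - resolvent z A) \<le> 2 * N * N * cmod (w - z)"
    if w: "w \<notin> op_spectrum A" "cmod (w - z) * N \<le> 1/2" for w
  proof -
    have eq: "resolvent w A - resolvent z A = (z - w) *\<^sub>C (resolvent z A o\<^sub>L resolvent w A)"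
      using resolvent_identity[OF A z w(1)]
      by (intro blinfun_eqI) (simp add: blinfun.diff_left, simp add: scaleC_diff_left algebra_simps)
    have le: "norm (resolvent w A - resolvent z A) \<le> cmod (w - z) * (N * norm (resolvent w A))"
      unfolding eq N_def
      by (rule order_trans[OF norm_scaleC_blinfun_le])
         (simp add: norm_minus_commute mult_left_mono norm_blinfun_compose)
    have "norm (resolvent w A) \<le> N + norm (resolvent w A - resolvent z A)"
      unfolding N_def by (rule norm_triangle_sub)
    also have "\<dots> \<le> N + 1/2 * norm (resolvent w A)"
      using le mult_right_mono[OF w(2), of "norm (resolvent w A)"] by (simp add: mult_ac)
    finally have "norm (resolvent w A) \<le> 2 * N" by simp
    then have "cmod (w - z) * (N * norm (resolvent w A)) \<le> cmod (w - z) * (N * (2 * N))"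
      by (intro mult_left_mono) (auto simp: N_def)
    with le show ?thesis
      by (simp add: mult_ac)
  qed
  have "((\<lambda>w. cmod (w - z) * N) \<longlongrightarrow> cmod (z - z) * N) (at z)"
    by (intro tendsto_intros)
  then have "\<forall>\<^sub>F w in at z. cmod (w - z) * N < 1/2"
    by (rule order_tendstoD) simp
  moreover have "\<forall>\<^sub>F w in at z. w \<in> - op_spectrum A"
    using eventually_at_topological open_resolvent_set z by blast
  ultimately have "\<forall>\<^sub>F w in at z. norm (resolvent w A - resolvent z A) \<le> 2 * N * N * cmod (w - z)"
    by eventually_elim (rule bound, auto)
  moreover have "((\<lambda>w. 2 * N * N * cmod (w - z)) \<longlongrightarrow> 2 * N * N * cmod (z - z)) (at z)"
    by (intro tendsto_intros)
  ultimately have "((\<lambda>w. resolvent w A - resolvent z A) \<longlongrightarrow> 0) (at z)"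
    unfolding diff_self norm_zero mult_zero_right by (rule Lim_null_comparison)
  then show ?thesis
    unfolding isCont_def by (rule LIM_zero_cancel)
qed

lemma continuous_on_resolvent:
  assumes "clinear_op A" "X \<inter> op_spectrum A = {}"
  shows "continuous_on X (\<lambda>w. resolvent w A)"
  using isCont_resolvent[OF assms(1)] assms(2) by (intro continuous_at_imp_continuous_on) auto

lemma continuous_on_cinner_resolvent:
  assumes "clinear_op A" "X \<inter> op_spectrum A = {}"
  shows "continuous_on X (\<lambda>w. cinner (resolvent w A x) y)"
  by (rule continuous_on_compose2[OF linear_continuous_on[OF bounded_linear_cinner_left]])
     (auto intro!: continuous_intros continuous_on_resolvent assms)

text \<open>
  Scalar matrix coefficients suffice below, which reduces Liouville's theorem for operator-valued
  functions to the one for complex functions. The difference quotient is a continuous function of the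
  resolvent, by the resolvent identity.
\<close>

lemma holomorphic_cinner_resolvent:
  fixes A :: "'a::complex_hilbert_space \<Rightarrow>\<^sub>L 'a"
  assumes A: "clinear_op A"
  shows "(\<lambda>w. cinner (resolvent w A x) y) holomorphic_on - op_spectrum A"
proof -
  have "((\<lambda>w. cinner (resolvent w A x) y) has_field_derivative - cinner (resolvent z A (resolvent z A x)) y) (at z)"
    if z: "z \<notin> op_spectrum A" for z
  proof -
    have "isCont (\<lambda>w. - cinner (resolvent z A (resolvent w A x)) y) z"
      by (rule bounded_linear.isCont[OF _ isCont_resolvent[OF A z]])
         (rule bounded_linear_minus
            bounded_linear_compose[OF bounded_linear_cinner_left bounded_linear_compose]
            blinfun.bounded_linear_right blinfun.bounded_linear_left)+
    moreover have "\<forall>\<^sub>F w in at z. - cinner (resolvent z A (resolvent w A x)) y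
        = (cinner (resolvent w A x) y - cinner (resolvent z A x) y) / (w - z)"
    proof -
      have "\<forall>\<^sub>F w in at z. w \<in> - op_spectrum A"
        using eventually_at_topological open_resolvent_set z by blast
      moreover have "\<forall>\<^sub>F w in at z. w \<noteq> z"
        by (simp add: eventually_at_filter)
      ultimately show ?thesis
      proof eventually_elim
        case (elim w)
        have "cinner (resolvent z A x) y - cinner (resolvent w A x) y
            = (w - z) * cinner (resolvent z A (resolvent w A x)) y"
          using elim resolvent_identity[OF A z, of w x]
          by (simp add: cinner_scaleC_left flip: cinner_diff_left)
        with elim show ?case by (simp add: field_simps)
      qed
    qed
    ultimately show ?thesis
      unfolding isCont_def has_field_derivative_iff by (rule Lim_transform_eventually)
  qed
  then show ?thesis
    unfolding holomorphic_on_def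
    using field_differentiable_at_within field_differentiable_def by blast
qed

text \<open>
  This is the decay at infinity that makes Liouville's theorem applicable to the resolvent.
\<close>

lemma norm_resolvent_le:
  fixes A :: "'a::complex_hilbert_space \<Rightarrow>\<^sub>L 'a"
  assumes "z \<notin> op_spectrum A" "norm A < cmod z"
  shows "norm (resolvent z A x) \<le> norm x / (cmod z - norm A)"
proof -
  define u where "u = resolvent z A x"
  have "z *\<^sub>C u = x + A u"
    using resolvent_inverse(1)[OF assms(1), of x] unfolding u_def by (simp add: diff_eq_eq)
  then have "cmod z * norm u \<le> norm x + norm (A u)"
    using norm_triangle_ineq[of x "A u"] by (simp flip: norm_scaleC)
  also have "norm (A u) \<le> norm A * norm u"
    by (rule norm_blinfun)
  finally have "norm u * (cmod z - norm A) \<le> norm x"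
    by (simp add: algebra_simps)
  then show ?thesis
    using assms(2) by (simp add: u_def pos_le_divide_eq)
qed

lemma clinear_op_adjoint:
  fixes A :: "'a::complex_hilbert_space \<Rightarrow>\<^sub>L 'a"
  assumes A: "clinear_op A"
  shows "clinear_op (op_adjoint A)"
  unfolding clinear_op_def
proof (intro allI)
  fix c x
  show "op_adjoint A (c *\<^sub>C x) = c *\<^sub>C op_adjoint A x"
    by (rule cinner_eqI) (simp add: cinner_op_adjoint_left[OF A] cinner_scaleC_left)
qed

lemma resolvent_op_adjoint_inverse:
  fixes A :: "'a::complex_hilbert_space \<Rightarrow>\<^sub>L 'a"
  assumes A: "clinear_op A" and z: "z \<notin> op_spectrum A"
  shows "is_op_inverse (cnj z *\<^sub>C id_blinfun - op_adjoint A) (op_adjoint (resolvent z A))"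
proof -
  note R = clinear_op_resolvent[OF A z]
  let ?R = "op_adjoint (resolvent z A)"
  show ?thesis
  proof (rule is_op_inverseI)
    show "(cnj z *\<^sub>C id_blinfun - op_adjoint A) (?R x) = x" for x
    proof (rule cinner_eqI)
      fix y
      have "cinner (cnj z *\<^sub>C ?R x - op_adjoint A (?R x)) y = cinner x (resolvent z A (z *\<^sub>C y - A y))"
        by (simp add: cinner_diff_left cinner_scaleC_left cinner_op_adjoint_left A R
              blinfun.diff_right cinner_diff_right clinear_op_scaleC[OF R] cinner_scaleC_right)
      then show "cinner ((cnj z *\<^sub>C id_blinfun - op_adjoint A) (?R x)) y = cinner x y"
        by (simp add: resolvent_inverse(2)[OF z] blinfun.diff_left)
    qed
    show "?R ((cnj z *\<^sub>C id_blinfun - op_adjoint A) x) = x" for x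
    proof (rule cinner_eqI)
      fix y
      have "cinner (?R (cnj z *\<^sub>C x - op_adjoint A x)) y
          = cinner x (z *\<^sub>C resolvent z A y - A (resolvent z A y))"
        by (simp add: cinner_diff_left cinner_scaleC_left cinner_op_adjoint_left A R
              cinner_diff_right cinner_scaleC_right)
      then show "cinner (?R ((cnj z *\<^sub>C id_blinfun - op_adjoint A) x)) y = cinner x y"
        by (simp add: resolvent_inverse(1)[OF z] blinfun.diff_left)
    qed
  qed
qed

lemma resolvent_op_adjoint:
  fixes A :: "'a::complex_hilbert_space \<Rightarrow>\<^sub>L 'a"
  assumes A: "clinear_op A" and z: "z \<notin> op_spectrum A"
  shows "cinner (resolvent (cnj z) (op_adjoint A) x) y = cinner x (resolvent z A y)"
  unfolding resolvent_def[of "cnj z"] op_inverse_eq[OF resolvent_op_adjoint_inverse[OF A z]]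
  by (rule cinner_op_adjoint_left[OF clinear_op_resolvent[OF A z]])

lemma op_spectrum_adjoint:
  fixes A :: "'a::complex_hilbert_space \<Rightarrow>\<^sub>L 'a"
  assumes "clinear_op A" "z \<notin> op_spectrum A"
  shows "cnj z \<notin> op_spectrum (op_adjoint A)"
  using resolvent_op_adjoint_inverse[OF assms] by (auto simp: op_spectrum_def)

section \<open>Rational functions and their operators\<close>

lemma poly_op_0 [simp]: "poly_op 0 A = 0"
  by (auto intro!: blinfun_eqI simp: poly_op_def)

lemma poly_op_pCons:
  fixes A :: "'a::complex_hilbert_space \<Rightarrow>\<^sub>L 'a"
  assumes A: "clinear_op A"
  shows "poly_op (pCons a p) A x = a *\<^sub>C x + A (poly_op p A x)"
proof -
  have expand: "poly_op p A x = (\<Sum>i\<le>n. coeff p i *\<^sub>C ((o\<^sub>L) A ^^ i) id_blinfun x)" if "degree p \<le> n" for p n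
  proof -
    have "(\<Sum>i\<le>degree p. coeff p i *\<^sub>C ((o\<^sub>L) A ^^ i) id_blinfun x)
        = (\<Sum>i\<le>n. coeff p i *\<^sub>C ((o\<^sub>L) A ^^ i) id_blinfun x)"
      using that by (intro sum.mono_neutral_left) (auto simp: coeff_eq_0)
    then show ?thesis
      by (simp add: poly_op_def blinfun.sum_left)
  qed
  have "poly_op (pCons a p) A x
      = (\<Sum>i\<le>Suc (degree p). coeff (pCons a p) i *\<^sub>C ((o\<^sub>L) A ^^ i) id_blinfun x)"
    by (rule expand) (simp add: degree_pCons_le)
  also have "\<dots> = a *\<^sub>C x + (\<Sum>i\<le>degree p. A (coeff p i *\<^sub>C ((o\<^sub>L) A ^^ i) id_blinfun x))"
    by (simp only: sum.atMost_Suc_shift coeff_pCons_Suc coeff_pCons_0)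
       (simp add: clinear_op_scaleC[OF A])
  also have "\<dots> = a *\<^sub>C x + A (poly_op p A x)"
    by (simp add: expand[of p "degree p"] blinfun.sum_right)
  finally show ?thesis .
qed

lemma poly_op_add:
  fixes A :: "'a::complex_hilbert_space \<Rightarrow>\<^sub>L 'a"
  assumes A: "clinear_op A"
  shows "poly_op (p + q) A x = poly_op p A x + poly_op q A x"
  by (induction p q rule: poly_induct2)
     (simp_all add: poly_op_pCons[OF A] blinfun.add_right scaleC_add_left)

lemma poly_op_smult:
  fixes A :: "'a::complex_hilbert_space \<Rightarrow>\<^sub>L 'a"
  assumes A: "clinear_op A"
  shows "poly_op (smult c p) A x = c *\<^sub>C poly_op p A x"
  by (induction p)
     (simp_all add: poly_op_pCons[OF A] clinear_op_scaleC[OF A] scaleC_add_right scaleC_scaleC)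

lemma poly_op_mult:
  fixes A :: "'a::complex_hilbert_space \<Rightarrow>\<^sub>L 'a"
  assumes A: "clinear_op A"
  shows "poly_op (p * q) A x = poly_op p A (poly_op q A x)"
proof (induction p)
  case (pCons a p)
  have "poly_op (pCons a p * q) A x = poly_op (smult a q + pCons 0 (p * q)) A x"
    by simp
  also have "\<dots> = a *\<^sub>C poly_op q A x + A (poly_op (p * q) A x)"
    unfolding poly_op_add[OF A] by (simp add: poly_op_smult[OF A] poly_op_pCons[OF A])
  finally show ?case
    by (simp add: pCons.IH poly_op_pCons[OF A])
qed simp

text \<open>
  Over the complex numbers \<open>d\<close> splits into linear factors; its roots lie off the spectrum, so each factor
  of \<open>d(A)\<close> is the negative of an inverse of a resolvent.
\<close>

lemma poly_op_invertible:
  fixes A :: "'a::complex_hilbert_space \<Rightarrow>\<^sub>L 'a"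
  assumes A: "clinear_op A" and "d \<noteq> 0" "\<And>z. z \<in> op_spectrum A \<Longrightarrow> poly d z \<noteq> 0"
  shows "\<exists>S. is_op_inverse (poly_op d A) S"
  using assms(2,3)
proof (induction "degree d" arbitrary: d)
  case 0
  then obtain c where c: "d = [:c:]" "c \<noteq> 0"
    by (metis degree_eq_zeroE pCons_0_0)
  have "is_op_inverse (poly_op d A) (inverse c *\<^sub>C id_blinfun)"
    by (rule is_op_inverseI) (simp_all add: c poly_op_pCons[OF A] scaleC_scaleC)
  then show ?case by blast
next
  case (Suc n)
  then have "\<not> constant (poly d)"
    by (metis Zero_not_Suc constant_degree)
  then obtain a where "poly d a = 0"
    using Fundamental_Theorem_Algebra.fundamental_theorem_of_algebra by blast
  then have a: "a \<notin> op_spectrum A" and "[:- a, 1:] dvd d"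
    using Suc.prems by (auto simp: poly_eq_0_iff_dvd)
  then obtain q where q: "d = [:- a, 1:] * q"
    by (auto elim: dvdE)
  then have "q \<noteq> 0" using Suc.prems by auto
  moreover have "n = degree q"
    using \<open>q \<noteq> 0\<close> Suc.hyps(2) degree_mult_eq[of "[:- a, 1:]" q] unfolding q by simp
  moreover have "\<And>z. z \<in> op_spectrum A \<Longrightarrow> poly q z \<noteq> 0"
    using Suc.prems(2) by (simp add: q)
  ultimately obtain S where S: "is_op_inverse (poly_op q A) S"
    using Suc.hyps(1) by blast
  have lin: "poly_op [:- a, 1:] A x = - (a *\<^sub>C x - A x)" for x
    by (simp add: poly_op_pCons[OF A] scaleC_minus_left)
  have "is_op_inverse (poly_op [:- a, 1:] A) (- resolvent a A)"
  proof (rule is_op_inverseI)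
    show "poly_op [:- a, 1:] A ((- resolvent a A) x) = x" for x
      unfolding lin blinfun.minus_left blinfun.minus_right scaleC_minus_right
      using resolvent_inverse(1)[OF a, of x] by simp
    show "(- resolvent a A) (poly_op [:- a, 1:] A x) = x" for x
      unfolding lin blinfun.minus_left blinfun.minus_right
      using resolvent_inverse(2)[OF a, of x] by simp
  qed
  from is_op_inverse_compose[OF this S]
  have "is_op_inverse (poly_op [:- a, 1:] A o\<^sub>L poly_op q A) (S o\<^sub>L - resolvent a A)" .
  moreover have "poly_op [:- a, 1:] A o\<^sub>L poly_op q A = poly_op d A"
    unfolding q by (rule blinfun_eqI) (simp only: blinfun_apply_blinfun_compose poly_op_mult[OF A])
  ultimately show ?case by auto
qed

lemma ratfun_den_nonzero [simp]: "ratfun_den r \<noteq> 0"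
  by (simp add: ratfun_den_def)

lemma Fract_num_den: "Fract (ratfun_num r) (ratfun_den r) = r"
  by (simp add: ratfun_num_def ratfun_den_def)

lemma ratfun_coprime: "poly (ratfun_num r) z \<noteq> 0 \<or> poly (ratfun_den r) z \<noteq> 0"
proof (rule ccontr)
  assume "\<not> ?thesis"
  then have "[:- z, 1:] dvd ratfun_num r" "[:- z, 1:] dvd ratfun_den r"
    by (auto simp: poly_eq_0_iff_dvd)
  then have "is_unit [:- z, 1:]"
    using coprime_common_divisor[OF coprime_quot_of_fract[of r]]
    by (simp add: ratfun_num_def ratfun_den_def)
  then show False
    by (simp add: is_unit_pCons_iff)
qed

text \<open>
  By coprimality, the cross-multiplied form determines the values and the poles of the reduced fraction.
\<close>

lemma ratfun_num_Fract:
  assumes "d \<noteq> 0"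
  shows "ratfun_num (Fract p d) * d = p * ratfun_den (Fract p d)"
  using assms by (subst eq_fract(1)[symmetric]) (simp_all add: Fract_num_den)

lemma ratfun_Fract:
  assumes "poly d z \<noteq> 0"
  shows "poly (ratfun_den (Fract p d)) z \<noteq> 0" "ratfun_eval (Fract p d) z = poly p z / poly d z"
proof -
  have "d \<noteq> 0" using assms by auto
  from arg_cong[OF ratfun_num_Fract[OF this, of p], of "\<lambda>p. poly p z"]
  have eq: "poly (ratfun_num (Fract p d)) z * poly d z = poly p z * poly (ratfun_den (Fract p d)) z"
    by simp
  with ratfun_coprime[of "Fract p d" z] assms
  show den: "poly (ratfun_den (Fract p d)) z \<noteq> 0" by auto
  with eq assms show "ratfun_eval (Fract p d) z = poly p z / poly d z"
    by (simp add: ratfun_eval_def frac_eq_eq)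
qed

lemma ratfun_mult:
  assumes "poly (ratfun_den r) z \<noteq> 0" "poly (ratfun_den s) z \<noteq> 0"
  shows "poly (ratfun_den (r * s)) z \<noteq> 0" "ratfun_eval (r * s) z = ratfun_eval r z * ratfun_eval s z"
proof -
  have "r * s = Fract (ratfun_num r * ratfun_num s) (ratfun_den r * ratfun_den s)"
    by (metis Fract_num_den mult_fract)
  then show "poly (ratfun_den (r * s)) z \<noteq> 0" "ratfun_eval (r * s) z = ratfun_eval r z * ratfun_eval s z"
    using ratfun_Fract[of "ratfun_den r * ratfun_den s" z "ratfun_num r * ratfun_num s"] assms
    by (simp_all add: ratfun_eval_def)
qed

text \<open>
  The reduced fraction may be replaced by any other one whose denominator does not vanish on the
  spectrum. This makes the functional calculus multiplicative although products of reduced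
  fractions need not be reduced.
\<close>

lemma ratfun_op_Fract:
  fixes A :: "'a::complex_hilbert_space \<Rightarrow>\<^sub>L 'a"
  assumes A: "clinear_op A" and d: "d \<noteq> 0" "\<And>z. z \<in> op_spectrum A \<Longrightarrow> poly d z \<noteq> 0"
    and D: "is_op_inverse (poly_op d A) D"
  shows "ratfun_op (Fract p d) A x = poly_op p A (D x)"
proof -
  define n m where "n = ratfun_num (Fract p d)" and "m = ratfun_den (Fract p d)"
  have "\<exists>M. is_op_inverse (poly_op m A) M"
    unfolding m_def by (rule poly_op_invertible[OF A]) (use ratfun_Fract(1) d in auto)
  then obtain M where M: "is_op_inverse (poly_op m A) M" by blast
  define u where "u = M (D x)"
  have x: "D x = poly_op m A u" "x = poly_op d A (D x)"
    by (simp_all add: u_def is_op_inverse_apply[OF M] is_op_inverse_apply[OF D])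
  have "M x = poly_op d A u"
  proof -
    have "x = poly_op m A (poly_op d A u)"
      by (subst x(2), subst x(1)) (simp add: mult.commute flip: poly_op_mult[OF A])
    then show ?thesis
      using is_op_inverse_apply(2)[OF M] by metis
  qed
  then have "ratfun_op (Fract p d) A x = poly_op (n * d) A u"
    by (simp add: ratfun_op_def op_inverse_eq[OF M] poly_op_mult[OF A] flip: n_def m_def)
  also have "n * d = p * m"
    unfolding n_def m_def by (rule ratfun_num_Fract[OF d(1)])
  also have "poly_op (p * m) A u = poly_op p A (D x)"
    by (simp add: poly_op_mult[OF A] x(1))
  finally show ?thesis .
qed

lemma ratfun_op_mult:
  fixes A :: "'a::complex_hilbert_space \<Rightarrow>\<^sub>L 'a"
  assumes A: "clinear_op A"
    and r: "\<And>z. z \<in> op_spectrum A \<Longrightarrow> poly (ratfun_den r) z \<noteq> 0"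
    and s: "\<And>z. z \<in> op_spectrum A \<Longrightarrow> poly (ratfun_den s) z \<noteq> 0"
  shows "ratfun_op (r * s) A x = ratfun_op r A (ratfun_op s A x)"
proof -
  obtain R S where R: "is_op_inverse (poly_op (ratfun_den r) A) R"
    and S: "is_op_inverse (poly_op (ratfun_den s) A) S"
    using poly_op_invertible[OF A _ r] poly_op_invertible[OF A _ s] by auto
  have "is_op_inverse (poly_op (ratfun_den r * ratfun_den s) A) (S o\<^sub>L R)"
    using is_op_inverse_compose[OF R S]
    by (metis (no_types, lifting) A blinfun_apply_blinfun_compose blinfun_eqI poly_op_mult)
  moreover have "r * s = Fract (ratfun_num r * ratfun_num s) (ratfun_den r * ratfun_den s)"
    by (metis Fract_num_den mult_fract)
  ultimately have 1: "ratfun_op (r * s) A x = poly_op (ratfun_num r * ratfun_num s) A (S (R x))"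
    using ratfun_op_Fract[OF A, of "ratfun_den r * ratfun_den s" "S o\<^sub>L R"] r s by simp
  have "R (poly_op (ratfun_num s) A y) = poly_op (ratfun_num s) A (R y)" for y
    by (metis A is_op_inverse_apply[OF R] mult.commute poly_op_mult)
  moreover have "R (S y) = S (R y)" for y
    by (metis A is_op_inverse_apply[OF R] is_op_inverse_apply[OF S] mult.commute poly_op_mult)
  ultimately show ?thesis
    unfolding 1
    by (simp add: ratfun_op_def op_inverse_eq[OF R] op_inverse_eq[OF S] poly_op_mult[OF A])
qed

text \<open>
  A rational function that is bounded on a set has no pole on its closure: at such a pole the
  numerator would have to vanish as well.
\<close>

lemma ratfun_den_closure:
  assumes "\<And>z. z \<in> X \<Longrightarrow> poly (ratfun_den r) z \<noteq> 0" "\<And>z. z \<in> X \<Longrightarrow> cmod (ratfun_eval r z) \<le> M"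
    and "z \<in> closure X"
  shows "poly (ratfun_den r) z \<noteq> 0" "cmod (ratfun_eval r z) \<le> M"
proof -
  have "cmod (poly (ratfun_num r) z) - M * cmod (poly (ratfun_den r) z) \<le> 0"
  proof (rule continuous_le_on_closure[OF _ assms(3)])
    show "continuous_on (closure X) (\<lambda>z. cmod (poly (ratfun_num r) z) - M * cmod (poly (ratfun_den r) z))"
      by (intro continuous_intros)
    show "cmod (poly (ratfun_num r) z) - M * cmod (poly (ratfun_den r) z) \<le> 0" if "z \<in> X" for z
      using assms(1,2)[OF that] by (simp add: ratfun_eval_def norm_divide divide_le_eq)
  qed
  then show den: "poly (ratfun_den r) z \<noteq> 0"
    using ratfun_coprime[of r z] by auto
  with \<open>_ \<le> 0\<close> show "cmod (ratfun_eval r z) \<le> M"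
    by (simp add: ratfun_eval_def norm_divide divide_le_eq)
qed

lemma continuous_on_ratfun_eval:
  assumes "\<And>z. z \<in> X \<Longrightarrow> poly (ratfun_den r) z \<noteq> 0"
  shows "continuous_on X (ratfun_eval r)"
  unfolding ratfun_eval_def using assms by (auto intro!: continuous_intros)

lemma poly_lipschitz_on_bounded:
  fixes p :: "complex poly"
  assumes "bounded X"
  shows "\<exists>B\<ge>0. \<forall>x\<in>X. \<forall>y\<in>X. cmod (poly p x - poly p y) \<le> B * cmod (x - y)"
proof (induction p)
  case (pCons a p)
  then obtain B where B: "B \<ge> 0" "\<And>x y. x \<in> X \<Longrightarrow> y \<in> X \<Longrightarrow> cmod (poly p x - poly p y) \<le> B * cmod (x - y)"
    by blast
  obtain M where M: "M > 0" "\<And>x. x \<in> X \<Longrightarrow> cmod x \<le> M"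
    using assms by (auto simp: bounded_pos)
  have "bounded (poly p ` X)"
  proof (rule bounded_subset)
    show "bounded (poly p ` closure X)"
      using assms by (intro compact_imp_bounded compact_continuous_image continuous_intros)
                     (simp_all add: compact_closure)
    show "poly p ` X \<subseteq> poly p ` closure X"
      by (rule image_mono[OF closure_subset])
  qed
  then obtain N where N: "N > 0" "\<And>x. x \<in> X \<Longrightarrow> cmod (poly p x) \<le> N"
    unfolding bounded_pos by blast
  have "cmod (poly (pCons a p) x - poly (pCons a p) y) \<le> (M * B + N) * cmod (x - y)"
    if "x \<in> X" "y \<in> X" for x y
  proof -
    have "poly (pCons a p) x - poly (pCons a p) y = x * (poly p x - poly p y) + (x - y) * poly p y"
      by (simp add: algebra_simps)
    then have "cmod (poly (pCons a p) x - poly (pCons a p) y)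
        \<le> cmod x * cmod (poly p x - poly p y) + cmod (x - y) * cmod (poly p y)"
      by (metis norm_mult norm_triangle_ineq)
    also have "\<dots> \<le> M * (B * cmod (x - y)) + cmod (x - y) * N"
      using that M N B by (intro add_mono mult_mono) auto
    finally show ?thesis by (simp add: algebra_simps)
  qed
  moreover have "M * B + N \<ge> 0" using M N B by simp
  ultimately show ?case by blast
qed auto

lemma ratfun_lipschitz_on_compact:
  assumes "compact X" "\<And>z. z \<in> X \<Longrightarrow> poly (ratfun_den r) z \<noteq> 0"
  shows "\<exists>B\<ge>0. \<forall>x\<in>X. \<forall>y\<in>X. cmod (ratfun_eval r x - ratfun_eval r y) \<le> B * cmod (x - y)"
proof -
  define n d where "n = poly (ratfun_num r)" and "d = poly (ratfun_den r)"
  have cont: "continuous_on X (\<lambda>x. inverse (d x))" "continuous_on X n"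
    unfolding n_def d_def using assms(2) by (auto intro!: continuous_intros)
  obtain M where M: "M > 0" "\<And>x. x \<in> X \<Longrightarrow> cmod (inverse (d x)) \<le> M"
    using compact_imp_bounded[OF compact_continuous_image[OF cont(1) assms(1)]] by (auto simp: bounded_pos)
  obtain N where N: "N > 0" "\<And>x. x \<in> X \<Longrightarrow> cmod (n x) \<le> N"
    using compact_imp_bounded[OF compact_continuous_image[OF cont(2) assms(1)]] by (auto simp: bounded_pos)
  obtain B where B: "B \<ge> 0" "\<And>x y. x \<in> X \<Longrightarrow> y \<in> X \<Longrightarrow> cmod (n x - n y) \<le> B * cmod (x - y)"
    using poly_lipschitz_on_bounded[OF compact_imp_bounded[OF assms(1)]] unfolding n_def by blast
  obtain C where C: "C \<ge> 0" "\<And>x y. x \<in> X \<Longrightarrow> y \<in> X \<Longrightarrow> cmod (d x - d y) \<le> C * cmod (x - y)"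
    using poly_lipschitz_on_bounded[OF compact_imp_bounded[OF assms(1)]] unfolding d_def by blast
  have "cmod (ratfun_eval r x - ratfun_eval r y) \<le> (B * M + N * M * M * C) * cmod (x - y)"
    if xy: "x \<in> X" "y \<in> X" for x y
  proof -
    have "d x \<noteq> 0" "d y \<noteq> 0" using assms(2) xy by (auto simp: d_def)
    then have "ratfun_eval r x - ratfun_eval r y
        = (n x - n y) * inverse (d x) + n y * inverse (d x) * inverse (d y) * (d y - d x)"
      by (simp add: ratfun_eval_def flip: n_def d_def) (simp add: field_simps)
    also have "cmod \<dots> \<le> cmod ((n x - n y) * inverse (d x)) + cmod (n y * inverse (d x) * inverse (d y) * (d y - d x))"
      by (rule norm_triangle_ineq)
    also have "\<dots> \<le> (B * cmod (x - y)) * M + N * M * M * (C * cmod (x - y))"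
      unfolding norm_mult
      using xy M N B(1) C(1) B(2)[OF xy] C(2)[OF xy(2,1)]
      by (intro add_mono mult_mono) (auto simp: norm_minus_commute)
    finally show ?thesis by (simp add: algebra_simps)
  qed
  moreover have "B * M + N * M * M * C \<ge> 0" using M N B C by simp
  ultimately show ?thesis by blast
qed

section \<open>Integration along rectifiable curves\<close>

lemma vector_derivative_sequentially:
  fixes f :: "real \<Rightarrow> 'b::real_normed_vector"
  assumes "(f has_vector_derivative d) (at x)"
  shows "(\<lambda>n. real (Suc n) *\<^sub>R (f (x + inverse (real (Suc n))) - f x)) \<longlonglongrightarrow> d"
proof -
  have "(\<lambda>h. norm (f (x + h) - f x - h *\<^sub>R d) / norm h) \<midarrow>0\<rightarrow> 0"
    using assms unfolding has_vector_derivative_def has_derivative_at by blast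
  moreover have "filterlim (\<lambda>n. inverse (real (Suc n))) (at 0) sequentially"
    unfolding filterlim_at using LIMSEQ_inverse_real_of_nat by auto
  ultimately have "(\<lambda>n. norm (f (x + inverse (real (Suc n))) - f x - inverse (real (Suc n)) *\<^sub>R d)
      / norm (inverse (real (Suc n)))) \<longlonglongrightarrow> 0"
    by (rule filterlim_compose)
  moreover have "norm (f (x + inverse (real (Suc n))) - f x - inverse (real (Suc n)) *\<^sub>R d)
      / norm (inverse (real (Suc n)))
      = norm (real (Suc n) *\<^sub>R (f (x + inverse (real (Suc n))) - f x) - d)" for n
  proof -
    let ?q = "real (Suc n)"
    have "norm (f (x + inverse ?q) - f x - inverse ?q *\<^sub>R d) / norm (inverse ?q)
        = norm (?q *\<^sub>R (f (x + inverse ?q) - f x - inverse ?q *\<^sub>R d))"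
      by (simp add: divide_inverse mult.commute)
    then show ?thesis
      by (simp add: scaleR_diff_right)
  qed
  ultimately have "(\<lambda>n. norm (real (Suc n) *\<^sub>R (f (x + inverse (real (Suc n))) - f x) - d)) \<longlonglongrightarrow> 0"
    by simp
  then show ?thesis
    by (rule LIM_zero_cancel[OF tendsto_norm_zero_cancel])
qed

text \<open>
  The fundamental theorem of calculus for Lipschitz functions that are differentiable almost
  everywhere. The difference quotients of step \<open>1/n\<close> are bounded by the Lipschitz constant
  and converge to the derivative almost everywhere, and their integrals are computed from an
  antiderivative of the (continuous) function itself; dominated convergence gives the claim.
  It suffices that the Lipschitz bound holds at a uniform small scale.
\<close>

lemma has_integral_derivative_lipschitz:
  fixes f :: "real \<Rightarrow> complex"
  assumes ab: "a \<le> b" and "0 < \<delta>" "0 \<le> M"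
    and lip: "\<And>x y. x \<in> {a..b} \<Longrightarrow> y \<in> {a..b} \<Longrightarrow> \<bar>x - y\<bar> < \<delta> \<Longrightarrow> norm (f x - f y) \<le> M * \<bar>x - y\<bar>"
    and N: "negligible N"
    and der: "\<And>x. x \<in> {a<..<b} - N \<Longrightarrow> (f has_vector_derivative g x) (at x)"
  shows "(g has_integral f b - f a) {a..b}"
proof -
  define c where "c x = max a (min b x)" for x :: real
  define h where "h = f \<circ> c"
  have c: "c x \<in> {a..b}" "\<bar>c x - c y\<bar> \<le> \<bar>x - y\<bar>" for x y
    using ab by (auto simp: c_def)
  have lip_h: "norm (h x - h y) \<le> M * \<bar>x - y\<bar>" if "\<bar>x - y\<bar> < \<delta>" for x y
  proof -
    have "norm (h x - h y) \<le> M * \<bar>c x - c y\<bar>"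
      unfolding h_def o_def using c that by (intro lip) (auto intro: le_less_trans)
    also have "\<dots> \<le> M * \<bar>x - y\<bar>"
      using c \<open>0 \<le> M\<close> by (intro mult_left_mono)
    finally show ?thesis .
  qed
  have cont: "isCont h x" for x
  proof -
    have "((\<lambda>y. M * \<bar>y - x\<bar>) \<longlongrightarrow> M * \<bar>x - x\<bar>) (at x)"
      by (intro tendsto_intros)
    moreover have "\<forall>\<^sub>F y in at x. \<bar>y - x\<bar> < \<delta>"
      unfolding eventually_at using \<open>0 < \<delta>\<close> by (auto simp: dist_real_def)
    then have "\<forall>\<^sub>F y in at x. norm (h y - h x) \<le> M * \<bar>y - x\<bar>"
      by eventually_elim (rule lip_h)
    ultimately have "((\<lambda>y. h y - h x) \<longlongrightarrow> 0) (at x)"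
      unfolding diff_self abs_zero mult_zero_right by (rule Lim_null_comparison[rotated])
    then show ?thesis
      unfolding isCont_def by (rule LIM_zero_cancel)
  qed
  then have "continuous_on {a - 1..b + 2} h"
    by (intro continuous_at_imp_continuous_on) auto
  from antiderivative_continuous[OF this] obtain H
    where H': "\<And>x. x \<in> {a - 1..b + 2} \<Longrightarrow> (H has_vector_derivative h x) (at x within {a - 1..b + 2})"
    by metis
  have H: "(H has_vector_derivative h x) (at x)" if "x \<in> {a..b + 1}" for x
  proof -
    have "x \<in> interior {a - 1..b + 2}"
      unfolding interior_atLeastAtMost_real using that by auto
    then have "at x within {a - 1..b + 2} = at x"
      by (rule at_within_interior)
    moreover have "x \<in> {a - 1..b + 2}"
      using that by auto
    ultimately show ?thesis
      using H' by metis
  qed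
  obtain n0 where n0: "inverse (real (Suc n0)) < \<delta>"
    using reals_Archimedean[OF \<open>0 < \<delta>\<close>] by blast
  define q where "q n = real (Suc (n + n0))" for n
  define e where "e n = inverse (q n)" for n
  have e: "0 < e n" "e n < \<delta>" "e n \<le> 1" "q n * e n = 1" for n
  proof -
    have "e n \<le> inverse (real (Suc n0))"
      unfolding e_def q_def by (intro le_imp_inverse_le) auto
    then show "e n < \<delta>" using n0 by simp
    show "0 < e n" "e n \<le> 1" "q n * e n = 1"
      by (simp_all add: e_def q_def inverse_le_1_iff)
  qed
  define D where "D n x = q n *\<^sub>R (h (x + e n) - h x)" for n x
  have D_int: "(D n has_integral q n *\<^sub>R (H (b + e n) - H b) - q n *\<^sub>R (H (a + e n) - H a)) {a..b}" for n
  proof -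
    have "((\<lambda>x. h (x + e n)) has_integral H (b + e n) - H (a + e n)) {a..b}"
    proof (rule fundamental_theorem_of_calculus[OF ab])
      fix x assume "x \<in> {a..b}"
      then have "(H has_vector_derivative h (x + e n)) (at (x + e n))"
        using e[of n] by (intro H) auto
      moreover have "((\<lambda>x. x + e n) has_vector_derivative 1) (at x)"
        by (rule has_vector_derivative_add_const[THEN iffD2, OF has_vector_derivative_id])
      ultimately have "((H \<circ> (\<lambda>x. x + e n)) has_vector_derivative 1 *\<^sub>R h (x + e n)) (at x)"
        by (intro vector_diff_chain_at)
      then show "((\<lambda>x. H (x + e n)) has_vector_derivative h (x + e n)) (at x within {a..b})"
        unfolding o_def scaleR_one by (rule has_vector_derivative_at_within)
    qed
    moreover have "(h has_integral H b - H a) {a..b}"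
    proof (rule fundamental_theorem_of_calculus[OF ab])
      show "(H has_vector_derivative h x) (at x within {a..b})" if "x \<in> {a..b}" for x
        by (rule has_vector_derivative_at_within[OF H]) (use that in auto)
    qed
    ultimately have "(D n has_integral q n *\<^sub>R ((H (b + e n) - H (a + e n)) - (H b - H a))) {a..b}"
      unfolding D_def by (intro has_integral_cmul has_integral_diff)
    then show ?thesis
      by (simp add: algebra_simps)
  qed
  have D_norm: "norm (D n x) \<le> M" for n x
  proof -
    have "norm (D n x) = q n * norm (h (x + e n) - h x)"
      by (simp add: D_def q_def)
    also have "\<dots> \<le> q n * (M * e n)"
      using lip_h[of "x + e n" x] e[of n] by (intro mult_left_mono) (auto simp: q_def)
    also have "\<dots> = M"
      using e(4)[of n] by (simp add: mult.left_commute mult.commute)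
    finally show ?thesis .
  qed
  define N' where "N' = N \<union> {a, b}"
  have N': "negligible N'"
    unfolding N'_def using N by (intro negligible_Un) auto
  have D_lim: "(\<lambda>n. if x \<in> N' then 0 else D n x) \<longlonglongrightarrow> (if x \<in> N' then 0 else g x)" if "x \<in> {a..b}" for x
  proof (cases "x \<in> N'")
    case False
    then have x: "x \<in> {a<..<b} - N"
      using that by (auto simp: N'_def)
    have "(h has_vector_derivative g x) (at x)"
    proof (rule has_vector_derivative_transform_within_open[OF der[OF x]])
      show "open {a<..<b}" "x \<in> {a<..<b}"
        using x by auto
      show "f y = h y" if "y \<in> {a<..<b}" for y
        using that by (auto simp: h_def c_def)
    qed
    from LIMSEQ_ignore_initial_segment[OF vector_derivative_sequentially[OF this], of n0]
    show ?thesis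
      unfolding D_def e_def q_def using False by (simp only: if_False)
  qed simp
  have D'_int: "(\<lambda>x. if x \<in> N' then 0 else D n x) integrable_on {a..b}" for n
    by (rule integrable_spike[OF has_integral_integrable[OF D_int[of n]] N']) auto
  have DC: "(\<lambda>x. if x \<in> N' then 0 else g x) integrable_on {a..b}"
    "(\<lambda>n. integral {a..b} (\<lambda>x. if x \<in> N' then 0 else D n x)) \<longlonglongrightarrow> integral {a..b} (\<lambda>x. if x \<in> N' then 0 else g x)"
    by (rule dominated_convergence[OF D'_int integrable_const_ivl[of M] _ D_lim];
        use D_norm \<open>0 \<le> M\<close> in simp)+
  have int_eq: "integral {a..b} (\<lambda>x. if x \<in> N' then 0 else D n x)
      = q n *\<^sub>R (H (b + e n) - H b) - q n *\<^sub>R (H (a + e n) - H a)" for n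
    by (rule integral_unique, rule has_integral_spike[OF N' _ D_int[of n]]) auto
  have "(\<lambda>n. q n *\<^sub>R (H (x + e n) - H x)) \<longlonglongrightarrow> h x" if "x \<in> {a..b}" for x
    unfolding q_def e_def
    by (rule LIMSEQ_ignore_initial_segment[OF vector_derivative_sequentially[OF H]]) (use that in auto)
  then have "(\<lambda>n. integral {a..b} (\<lambda>x. if x \<in> N' then 0 else D n x)) \<longlonglongrightarrow> h b - h a"
    unfolding int_eq using ab by (intro tendsto_diff) auto
  then have "integral {a..b} (\<lambda>x. if x \<in> N' then 0 else g x) = h b - h a"
    using DC(2) LIMSEQ_unique by blast
  then have "((\<lambda>x. if x \<in> N' then 0 else g x) has_integral h b - h a) {a..b}"
    using DC(1) by (simp add: has_integral_iff)
  then have "(g has_integral h b - h a) {a..b}"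
    by (rule has_integral_spike[OF N', rotated]) auto
  moreover have "h b = f b" "h a = f a"
    using ab by (simp_all add: h_def c_def)
  ultimately show ?thesis by simp
qed

text \<open>
  Values in an arbitrary Banach space are needed for operator-valued integrands; \<open>T\<close> is
  uniformly approximated by step functions, as in the proof that continuous functions are
  integrable.
\<close>

lemma integrable_bilinear_continuous:
  fixes u :: "real \<Rightarrow> complex" and T :: "real \<Rightarrow> 'b::banach" and prod :: "complex \<Rightarrow> 'b \<Rightarrow> 'c::banach"
  assumes bb: "bounded_bilinear prod"
    and u: "u integrable_on {a..b}" "\<And>s. s \<in> {a..b} \<Longrightarrow> norm (u s) \<le> M"
    and T: "continuous_on {a..b} T"
  shows "(\<lambda>s. prod (u s) (T s)) integrable_on {a..b}"
proof -
  obtain K where K: "K > 0" "\<And>x y. norm (prod x y) \<le> norm x * norm y * K"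
    using bounded_bilinear.pos_bounded[OF bb] by blast
  define M' where "M' = max M 1"
  have M': "M' > 0" "\<And>s. s \<in> {a..b} \<Longrightarrow> norm (u s) \<le> M'"
    using u(2) by (force simp: M'_def)+
  have "(\<lambda>s. prod (u s) (T s)) integrable_on cbox a b"
  proof (rule integrable_uniform_limit)
    fix e :: real assume "0 < e"
    define e' where "e' = e / (M' * K)"
    have "0 < e'" using \<open>0 < e\<close> M' K by (simp add: e'_def)
    obtain d where "0 < d" and d: "\<And>x x'. x \<in> cbox a b \<Longrightarrow> x' \<in> cbox a b \<Longrightarrow> dist x' x < d \<Longrightarrow> dist (T x') (T x) < e'"
      using compact_uniformly_continuous[of "cbox a b" T] T \<open>0 < e'\<close>
      unfolding uniformly_continuous_on_def cbox_interval by (metis compact_Icc)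
    obtain p where p: "p tagged_division_of cbox a b" "(\<lambda>x. ball x d) fine p"
      using fine_division_exists[OF gauge_ball[OF \<open>0 < d\<close>], of a b] .
    have "\<exists>g. (\<forall>x\<in>i. norm (prod (u x) (T x) - g x) \<le> e) \<and> g integrable_on i" if i: "i \<in> snd ` p" for i
    proof -
      obtain t where t: "(t, i) \<in> p" using i by force
      obtain a' b' where i': "i = cbox a' b'" using t p by blast
      have sub: "i \<subseteq> cbox a b" and ti: "t \<in> i"
        using t p(1) by (auto dest: tagged_division_ofD(2,3))
      have "u integrable_on i"
        using integrable_on_subcbox[of u "{a..b}" a' b'] u(1) sub by (simp add: i')
      then have "(\<lambda>s. prod (u s) (T t)) integrable_on i"
        using integrable_linear[OF _ bounded_bilinear.bounded_linear_left[OF bb]] by (force simp: o_def)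
      moreover have "norm (prod (u x) (T x) - prod (u x) (T t)) \<le> e" if x: "x \<in> i" for x
      proof -
        have "x \<in> ball t d" using fineD[OF p(2) t] x by blast
        then have "norm (T x - T t) \<le> e'"
          using d[of x t] x ti sub by (auto simp: norm_minus_commute dist_norm less_imp_le subset_iff)
        then have "norm (u x) * norm (T x - T t) * K \<le> M' * e' * K"
          using M'(2)[of x] x sub K(1) M'(1) by (intro mult_right_mono mult_mono) (auto simp: cbox_interval)
        also have "\<dots> = e"
          using M' K by (simp add: e'_def)
        finally show ?thesis
          using K(2)[of "u x" "T x - T t"] by (simp add: bounded_bilinear.diff_right[OF bb])
      qed
      ultimately show ?thesis
        by (intro exI[of _ "\<lambda>s. prod (u s) (T t)"] conjI ballI)
    qed
    then have "\<forall>i\<in>snd ` p. \<exists>g. (\<forall>x\<in>i. norm (prod (u x) (T x) - g x) \<le> e) \<and> g integrable_on i"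
      by (rule ballI)
    from approximable_on_division[OF less_imp_le[OF \<open>0 < e\<close>] division_of_tagged_division[OF p(1)] this]
    show "\<exists>g. (\<forall>x\<in>cbox a b. norm (prod (u x) (T x) - g x) \<le> e) \<and> g integrable_on cbox a b"
      by metis
  qed
  then show ?thesis
    by (simp add: cbox_interval)
qed

subsection \<open>Curves parametrized by arc length\<close>

lemma arc_length_param_lipschitz:
  assumes "arc_length_param l \<sigma>" "x \<in> {0..l}" "y \<in> {0..l}"
  shows "norm (\<sigma> x - \<sigma> y) \<le> \<bar>x - y\<bar>"
proof -
  have *: "dist (\<sigma> x) (\<sigma> y) \<le> y - x" if "0 \<le> x" "x \<le> y" "y \<le> l" for x y
  proof -
    have "ereal (\<Sum>(s, t)\<leftarrow>zip [x, y] (tl [x, y]). dist (\<sigma> s) (\<sigma> t)) \<le> curve_length \<sigma> x y"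
      unfolding curve_length_def using that by (intro SUP_upper) auto
    then show ?thesis
      using assms(1) that by (simp add: arc_length_param_def)
  qed
  show ?thesis
    using *[of x y] *[of y x] assms(2,3) by (cases "x \<le> y") (auto simp: dist_norm norm_minus_commute)
qed

text \<open>
  The derivative is replaced by \<open>0\<close> where it does not exist, and at both ends, where it depends on values
  off the parameter interval. The result is bounded everywhere, not just almost everywhere.
\<close>

definition tangent :: "(real \<Rightarrow> complex) \<Rightarrow> real \<Rightarrow> real \<Rightarrow> complex"
  where "tangent \<sigma> l s =
    (if s \<in> {0<..<l} \<and> \<sigma> differentiable (at s) then vector_derivative \<sigma> (at s) else 0)"

definition corners :: "(real \<Rightarrow> complex) \<Rightarrow> real \<Rightarrow> real set"
  where "corners \<sigma> l = {s\<in>{0..l}. \<not> \<sigma> differentiable (at s)} \<union> {0, l}"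

lemma negligible_corners: "arc_length_param l \<sigma> \<Longrightarrow> negligible (corners \<sigma> l)"
  unfolding corners_def arc_length_param_def by (intro negligible_Un) auto

lemma tangent_derivative:
  "s \<in> {0..l} - corners \<sigma> l \<Longrightarrow> (\<sigma> has_vector_derivative tangent \<sigma> l s) (at s)"
  by (auto simp: corners_def tangent_def vector_derivative_works)

lemma tangent_eq:
  "s \<in> {0..l} - corners \<sigma> l \<Longrightarrow> tangent \<sigma> l s = vector_derivative \<sigma> (at s)"
  by (auto simp: corners_def tangent_def)

lemma norm_tangent_le:
  assumes "arc_length_param l \<sigma>"
  shows "norm (tangent \<sigma> l s) \<le> 1"
proof (cases "s \<in> {0<..<l} \<and> \<sigma> differentiable (at s)")
  case True
  then have "(\<sigma> has_vector_derivative tangent \<sigma> l s) (at s)"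
    by (simp add: tangent_def vector_derivative_works)
  from vector_derivative_sequentially[OF this]
  have lim: "(\<lambda>n. real (Suc n) *\<^sub>R (\<sigma> (s + inverse (real (Suc n))) - \<sigma> s)) \<longlonglongrightarrow> tangent \<sigma> l s" .
  have "(\<lambda>n. s + inverse (real (Suc n))) \<longlonglongrightarrow> s + 0"
    by (intro tendsto_add tendsto_const LIMSEQ_inverse_real_of_nat)
  then have "\<forall>\<^sub>F n in sequentially. s + inverse (real (Suc n)) < l"
    using True by (intro order_tendstoD) auto
  then have "\<forall>\<^sub>F n in sequentially. norm (real (Suc n) *\<^sub>R (\<sigma> (s + inverse (real (Suc n))) - \<sigma> s)) \<le> 1"
  proof eventually_elim
    case (elim n)
    have "norm (\<sigma> (s + inverse (real (Suc n))) - \<sigma> s) \<le> \<bar>s + inverse (real (Suc n)) - s\<bar>"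
      by (rule arc_length_param_lipschitz[OF assms]) (use True elim in \<open>auto intro: add_nonneg_nonneg\<close>)
    then have "real (Suc n) * norm (\<sigma> (s + inverse (real (Suc n))) - \<sigma> s) \<le> real (Suc n) * inverse (real (Suc n))"
      by (intro mult_left_mono) auto
    then show ?case by simp
  qed
  then show ?thesis
    by (rule Lim_norm_ubound[OF _ lim, rotated]) simp
qed (auto simp: tangent_def)

lemma has_integral_tangent:
  assumes "arc_length_param l \<sigma>" "0 \<le> l"
  shows "(tangent \<sigma> l has_integral \<sigma> l - \<sigma> 0) {0..l}"
  by (rule has_integral_derivative_lipschitz[where \<delta> = 1 and M = 1 and N = "corners \<sigma> l"])
     (use assms arc_length_param_lipschitz[OF assms(1)] negligible_corners tangent_derivative in auto)

lemma continuous_on_arc: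
  assumes "arc_length_param l \<sigma>"
  shows "continuous_on {0..l} \<sigma>"
  unfolding continuous_on_iff
proof (intro ballI allI impI)
  fix x e :: real assume x: "x \<in> {0..l}" and "0 < e"
  have "dist (\<sigma> y) (\<sigma> x) < e" if "y \<in> {0..l}" "dist y x < e" for y
    using arc_length_param_lipschitz[OF assms that(1) x] that(2) unfolding dist_norm by simp
  then show "\<exists>d>0. \<forall>x'\<in>{0..l}. dist x' x < d \<longrightarrow> dist (\<sigma> x') (\<sigma> x) < e"
    using \<open>0 < e\<close> by blast
qed

text \<open>
  Only points of the curve at a small distance can be joined by a segment inside \<open>U\<close>, so the composition
  of \<open>F\<close> with the curve is known to be Lipschitz at a small scale only.
\<close>

lemma integral_holomorphic_derivative:
  assumes arc: "arc_length_param l \<sigma>" "0 \<le> l"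
    and F: "F holomorphic_on U" "open U" "\<sigma> ` {0..l} \<subseteq> U"
  shows "((\<lambda>s. deriv F (\<sigma> s) * tangent \<sigma> l s) has_integral F (\<sigma> l) - F (\<sigma> 0)) {0..l}"
proof -
  have cpt: "compact (\<sigma> ` {0..l})"
    by (intro compact_continuous_image continuous_on_arc arc) simp
  obtain e where e: "0 < e" "(\<Union>x\<in>\<sigma> ` {0..l}. cball x e) \<subseteq> U"
    using compact_subset_open_imp_cball_epsilon_subset[OF cpt F(2,3)] by blast
  define K where "K = (\<Union>x\<in>\<sigma> ` {0..l}. cball x e)"
  have "compact K"
    unfolding K_def by (rule compact_minkowski_sum_cball[OF cpt])
  then have "compact (deriv F ` K)"
    using e(2) by (intro compact_continuous_image holomorphic_on_imp_continuous_on)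
      (auto intro: holomorphic_on_subset[OF holomorphic_deriv[OF F(1,2)]] simp: K_def)
  then obtain B where B: "B > 0" "\<And>w. w \<in> K \<Longrightarrow> cmod (deriv F w) \<le> B"
    using compact_imp_bounded[OF \<open>compact (deriv F ` K)\<close>] unfolding bounded_pos by auto
  have lip: "norm ((F \<circ> \<sigma>) x - (F \<circ> \<sigma>) y) \<le> B * \<bar>x - y\<bar>"
    if xy: "x \<in> {0..l}" "y \<in> {0..l}" "\<bar>x - y\<bar> < e" for x y
  proof -
    have xy': "norm (\<sigma> x - \<sigma> y) \<le> \<bar>x - y\<bar>"
      using arc_length_param_lipschitz[OF arc(1)] xy by simp
    have "norm (F (\<sigma> x) - F (\<sigma> y)) \<le> B * norm (\<sigma> x - \<sigma> y)"
    proof (rule field_differentiable_bound[of "cball (\<sigma> y) e" F "deriv F"])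
      fix w assume "w \<in> cball (\<sigma> y) e"
      then have w: "w \<in> K" unfolding K_def using xy by blast
      then show "cmod (deriv F w) \<le> B" by (rule B)
      have "w \<in> U" using w e(2) unfolding K_def by blast
      then show "(F has_field_derivative deriv F w) (at w within cball (\<sigma> y) e)"
        by (rule has_field_derivative_at_within[OF holomorphic_derivI[OF F(1,2)]])
    qed (use xy' xy e(1) in \<open>auto simp: dist_norm norm_minus_commute\<close>)
    also have "\<dots> \<le> B * \<bar>x - y\<bar>"
      using xy' B(1) by (intro mult_left_mono) auto
    finally show ?thesis by simp
  qed
  have "((\<lambda>s. tangent \<sigma> l s * deriv F (\<sigma> s)) has_integral (F \<circ> \<sigma>) l - (F \<circ> \<sigma>) 0) {0..l}"
  proof (rule has_integral_derivative_lipschitz[OF arc(2) e(1) less_imp_le[OF B(1)] lip negligible_corners[OF arc(1)]])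
    fix x assume x: "x \<in> {0<..<l} - corners \<sigma> l"
    then have "(F has_field_derivative deriv F (\<sigma> x)) (at (\<sigma> x))"
      using F by (intro holomorphic_derivI) auto
    then show "((F \<circ> \<sigma>) has_vector_derivative tangent \<sigma> l x * deriv F (\<sigma> x)) (at x)"
      using x by (intro field_vector_diff_chain_at tangent_derivative) auto
  qed
  then show ?thesis
    by (simp add: mult.commute)
qed

text \<open>
  A continuous logarithm of \<open>\<sigma> - z\<close> inherits from \<open>\<sigma>\<close> the Lipschitz bound (at a small scale)
  and the differentiability almost everywhere, so the integral of \<open>\<sigma>'/(\<sigma> - z)\<close> is its increment.
\<close>

lemma winding_number_arc:
  assumes arc: "arc_length_param l \<sigma>" "0 \<le> l" and z: "z \<notin> \<sigma> ` {0..l}"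
  shows "((\<lambda>s. tangent \<sigma> l s / (\<sigma> s - z)) has_integral 2 * of_real pi * \<i> * winding_number (\<lambda>t. \<sigma> (l * t)) z) {0..l}"
proof (cases "l = 0")
  case True
  have "winding_number (\<lambda>t. \<sigma> (l * t)) z = 0"
    by (rule winding_number_constI[of "\<sigma> 0"]) (use z True in auto)
  then show ?thesis
    using True by auto
next
  case False
  then have l: "l > 0" using arc(2) by simp
  define p where "p t = \<sigma> (l * t)" for t
  have "path p"
    unfolding path_def p_def
    by (rule continuous_on_compose2[OF continuous_on_arc[OF arc(1)]])
       (use l in \<open>auto simp: mult_left_le intro!: continuous_intros\<close>)
  moreover have "z \<notin> path_image p"
    using z l unfolding path_image_def p_def by (auto simp: mult_left_le image_iff)
  ultimately obtain q where q: "path q" "pathfinish q - pathstart q = 2 * of_real pi * \<i> * winding_number p z"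
    "\<And>t. t \<in> {0..1} \<Longrightarrow> p t = z + exp (q t)"
    using winding_number_as_continuous_log by blast
  define Q where "Q s = q (s / l)" for s
  have Q: "\<sigma> s - z = exp (Q s)" if "s \<in> {0..l}" for s
    using q(3)[of "s / l"] that l by (simp add: p_def Q_def)
  have Q_cont: "continuous_on {0..l} Q"
    unfolding Q_def
    by (rule continuous_on_compose2[OF q(1)[unfolded path_def]])
       (use l in \<open>auto intro!: continuous_intros\<close>)
  have cpt: "compact (\<sigma> ` {0..l})"
    by (intro compact_continuous_image continuous_on_arc arc) simp
  obtain m where m: "0 < m" "\<And>s. s \<in> {0..l} \<Longrightarrow> m \<le> cmod (\<sigma> s - z)"
    using separate_point_closed[OF compact_imp_closed[OF cpt] z]
    by (metis (no_types, lifting) dist_norm image_eqI norm_minus_commute)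
  obtain d where d: "0 < d" "\<And>x y. x \<in> {0..l} \<Longrightarrow> y \<in> {0..l} \<Longrightarrow> \<bar>x - y\<bar> < d \<Longrightarrow> cmod (Q x - Q y) < 1"
    using uniformly_continuous_onE[OF compact_uniformly_continuous[OF Q_cont compact_Icc] zero_less_one]
    unfolding dist_norm real_norm_def by metis
  define \<delta> where "\<delta> = min d (m / 2)"
  have \<delta>: "0 < \<delta>" using d m by (simp add: \<delta>_def)
  have log: "Q x - Q y = Ln (1 + (\<sigma> x - \<sigma> y) / (\<sigma> y - z))" and small: "cmod ((\<sigma> x - \<sigma> y) / (\<sigma> y - z)) \<le> \<bar>x - y\<bar> / m"
    if xy: "x \<in> {0..l}" "y \<in> {0..l}" "\<bar>x - y\<bar> < \<delta>" for x y
  proof -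
    have ne: "\<sigma> y - z \<noteq> 0" using Q[OF xy(2)] by simp
    have "cmod (\<sigma> x - \<sigma> y) / cmod (\<sigma> y - z) \<le> \<bar>x - y\<bar> / m"
      using arc_length_param_lipschitz[OF arc(1) xy(1,2)] m xy by (intro frac_le) auto
    then show "cmod ((\<sigma> x - \<sigma> y) / (\<sigma> y - z)) \<le> \<bar>x - y\<bar> / m"
      by (simp add: norm_divide)
    have "cmod (Q x - Q y) < 1" using d xy by (simp add: \<delta>_def)
    then have "\<bar>Im (Q x - Q y)\<bar> < pi"
      using abs_Im_le_cmod[of "Q x - Q y"] pi_gt3 by linarith
    then have "Ln (exp (Q x - Q y)) = Q x - Q y"
      by (intro Ln_exp) auto
    moreover have "exp (Q x - Q y) = 1 + (\<sigma> x - \<sigma> y) / (\<sigma> y - z)"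
      using ne by (simp add: exp_diff Q[OF xy(1), symmetric] Q[OF xy(2), symmetric] field_simps)
    ultimately show "Q x - Q y = Ln (1 + (\<sigma> x - \<sigma> y) / (\<sigma> y - z))" by simp
  qed
  have "((\<lambda>s. tangent \<sigma> l s / (\<sigma> s - z)) has_integral Q l - Q 0) {0..l}"
  proof (rule has_integral_derivative_lipschitz[OF arc(2) \<delta> _ _ negligible_corners[OF arc(1)]])
    show "0 \<le> 2 / m" using m by simp
    fix x y assume xy: "x \<in> {0..l}" "y \<in> {0..l}" "\<bar>x - y\<bar> < \<delta>"
    have "\<bar>x - y\<bar> / m < 1 / 2" using xy(3) m by (simp add: \<delta>_def field_simps)
    then have "cmod ((\<sigma> x - \<sigma> y) / (\<sigma> y - z)) < 1 / 2"
      by (rule le_less_trans[OF small[OF xy]])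
    then have "cmod (Q x - Q y) \<le> 2 * cmod ((\<sigma> x - \<sigma> y) / (\<sigma> y - z))"
      unfolding log[OF xy] by (rule norm_Ln_le)
    also have "\<dots> \<le> 2 * (\<bar>x - y\<bar> / m)"
      using small[OF xy] by (rule mult_left_mono) simp
    finally show "cmod (Q x - Q y) \<le> 2 / m * \<bar>x - y\<bar>"
      by simp
  next
    fix x assume x: "x \<in> {0<..<l} - corners \<sigma> l"
    then have x': "x \<in> {0..l}" by auto
    have ne: "\<sigma> x - z \<noteq> 0" using Q[OF x'] by simp
    define G where "G w = Q x + Ln (1 + (w - \<sigma> x) / (\<sigma> x - z))" for w
    have "(G has_field_derivative 1 / (\<sigma> x - z)) (at (\<sigma> x))"
      unfolding G_def using ne by (auto intro!: derivative_eq_intros)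
    then have "(G \<circ> \<sigma> has_vector_derivative tangent \<sigma> l x * (1 / (\<sigma> x - z))) (at x)"
      using x by (intro field_vector_diff_chain_at tangent_derivative) auto
    then have "(Q has_vector_derivative tangent \<sigma> l x * (1 / (\<sigma> x - z))) (at x)"
    proof (rule has_vector_derivative_transform_within_open)
      show "open ({0<..<l} \<inter> ball x \<delta>)" "x \<in> {0<..<l} \<inter> ball x \<delta>"
        using x \<delta> by auto
      show "(G \<circ> \<sigma>) y = Q y" if "y \<in> {0<..<l} \<inter> ball x \<delta>" for y
        using that log[of y x] x' by (auto simp: G_def dist_real_def abs_minus_commute algebra_simps)
    qed
    then show "(Q has_vector_derivative tangent \<sigma> l x / (\<sigma> x - z)) (at x)"
      by simp
  qed
  moreover have "Q l - Q 0 = 2 * of_real pi * \<i> * winding_number (\<lambda>t. \<sigma> (l * t)) z"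
    using q(2) l by (simp add: Q_def pathfinish_def pathstart_def flip: p_def)
  ultimately show ?thesis by simp
qed

text \<open>A point is passed only countably often with a nonzero velocity, since such times are isolated.\<close>

lemma negligible_fibre:
  "negligible {s\<in>{0..l}. \<sigma> s = z \<and> tangent \<sigma> l s \<noteq> 0}"
proof -
  define E where "E = {s\<in>{0..l}. \<sigma> s = z \<and> tangent \<sigma> l s \<noteq> 0}"
  have "\<exists>q r. q \<in> \<rat> \<and> r \<in> \<rat> \<and> q < s \<and> s < r \<and> {q<..<r} \<inter> E = {s}" if s: "s \<in> E" for s
  proof -
    have "(\<sigma> has_vector_derivative tangent \<sigma> l s) (at s)"
      using s by (auto simp: E_def tangent_def vector_derivative_works split: if_splits)
    then have "((\<lambda>t. norm (\<sigma> t - \<sigma> s - (t - s) *\<^sub>R tangent \<sigma> l s) / norm (t - s)) \<longlongrightarrow> 0) (at s)"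
      unfolding has_vector_derivative_def has_derivative_iff_norm by blast
    moreover have "0 < norm (tangent \<sigma> l s)"
      using s by (simp add: E_def)
    ultimately have "\<forall>\<^sub>F t in at s. norm (\<sigma> t - \<sigma> s - (t - s) *\<^sub>R tangent \<sigma> l s) / norm (t - s) < norm (tangent \<sigma> l s)"
      by (rule order_tendstoD)
    moreover have "\<forall>\<^sub>F t in at s. t \<noteq> s"
      by (simp add: eventually_at_filter)
    ultimately have "\<forall>\<^sub>F t in at s. \<sigma> t \<noteq> \<sigma> s"
      by eventually_elim (auto simp: norm_minus_commute)
    then obtain d where d: "d > 0" "\<And>t. t \<noteq> s \<Longrightarrow> dist t s < d \<Longrightarrow> \<sigma> t \<noteq> \<sigma> s"
      unfolding eventually_at by auto
    obtain q r where "q \<in> \<rat>" "s - d < q" "q < s" "r \<in> \<rat>" "s < r" "r < s + d"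
      using Rats_dense_in_real[of "s - d" s] Rats_dense_in_real[of s "s + d"] d(1) by auto
    then have "s \<in> {q<..<r}" by simp
    moreover have "{q<..<r} \<inter> E = {s}"
    proof -
      have "t = s" if t: "t \<in> {q<..<r}" "t \<in> E" for t
      proof (rule ccontr)
        assume "t \<noteq> s"
        moreover have "dist t s < d"
          unfolding dist_real_def using \<open>s - d < q\<close> \<open>q < s\<close> \<open>s < r\<close> \<open>r < s + d\<close> t(1) by auto
        ultimately show False
          using d(2) t(2) s by (auto simp: E_def)
      qed
      then show ?thesis using s \<open>s \<in> {q<..<r}\<close> by blast
    qed
    ultimately show ?thesis
      using \<open>q \<in> \<rat>\<close> \<open>r \<in> \<rat>\<close> by (intro exI[of _ q] exI[of _ r]) simp
  qed
  then obtain q r where qr: "\<And>s. s \<in> E \<Longrightarrow> q s \<in> \<rat> \<and> r s \<in> \<rat> \<and> {q s<..<r s} \<inter> E = {s}"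
    by metis
  have "inj_on (\<lambda>s. (q s, r s)) E"
    by (rule inj_onI) (metis Pair_inject qr singleton_inject)
  moreover have "countable ((\<lambda>s. (q s, r s)) ` E)"
    by (rule countable_subset[of _ "\<rat> \<times> \<rat>"]) (use qr countable_rat in auto)
  ultimately have "countable E"
    by (rule countable_image_inj_on[rotated])
  then show ?thesis
    unfolding E_def using countable_imp_null_set_lborel negligible_iff_null_sets null_sets_completionI
    by blast
qed

section \<open>Integration along the boundary of a rectifiable domain\<close>

locale rectifiable_domain =
  fixes \<Omega> :: "complex set" and L :: "complex set \<Rightarrow> real" and \<sigma> :: "complex set \<Rightarrow> real \<Rightarrow> complex"
  assumes bounded_domain: "bounded \<Omega>" and open_domain: "open \<Omega>"
    and finite_boundary: "finite (components (frontier \<Omega>))"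
    and arc_boundary: "arc_length_boundary \<Omega> L \<sigma>"
    and oriented_boundary: "positively_oriented_boundary \<Omega> L \<sigma>"
begin

lemma arc_component:
  assumes "C \<in> components (frontier \<Omega>)"
  shows "0 \<le> L C" "arc_length_param (L C) (\<sigma> C)" "\<sigma> C ` {0..L C} = C" "\<sigma> C 0 = \<sigma> C (L C)"
  using assms arc_boundary by (auto simp: arc_length_boundary_def)

lemma arc_in_frontier:
  assumes "C \<in> components (frontier \<Omega>)" "s \<in> {0..L C}"
  shows "\<sigma> C s \<in> frontier \<Omega>"
  using arc_component(3)[OF assms(1)] assms in_components_subset by blast

lemma frontier_not_in_domain: "z \<in> frontier \<Omega> \<Longrightarrow> z \<notin> \<Omega>"
  using open_domain by (simp add: frontier_def interior_open)

lemma frontier_in_closure: "z \<in> frontier \<Omega> \<Longrightarrow> z \<in> closure \<Omega>"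
  by (simp add: frontier_def)

lemma compact_frontier_domain: "compact (frontier \<Omega>)"
  using bounded_domain by (rule compact_frontier_bounded)

text \<open>
  Integrability is stated for the modified tangent, and boundary integrals are evaluated with it as
  well: the exceptional times form a null set.
\<close>

definition boundary_integrable :: "(complex \<Rightarrow> complex \<Rightarrow> 'b::real_normed_vector) \<Rightarrow> bool"
  where "boundary_integrable F \<longleftrightarrow> (\<forall>C\<in>components (frontier \<Omega>).
    (\<lambda>s. F (\<sigma> C s) (tangent (\<sigma> C) (L C) s)) integrable_on {0..L C})"

abbreviation bint :: "(complex \<Rightarrow> complex \<Rightarrow> 'b::real_normed_vector) \<Rightarrow> 'b"
  where "bint \<equiv> boundary_integral \<Omega> L \<sigma>"

lemma boundary_integral_tangent:
  "bint F = (\<Sum>C\<in>components (frontier \<Omega>). integral {0..L C} (\<lambda>s. F (\<sigma> C s) (tangent (\<sigma> C) (L C) s)))"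
  unfolding boundary_integral_def
proof (rule sum.cong[OF refl])
  fix C assume C: "C \<in> components (frontier \<Omega>)"
  show "integral {0..L C} (\<lambda>s. F (\<sigma> C s) (vector_derivative (\<sigma> C) (at s)))
      = integral {0..L C} (\<lambda>s. F (\<sigma> C s) (tangent (\<sigma> C) (L C) s))"
    by (rule integral_spike[OF negligible_corners[OF arc_component(2)[OF C]]]) (simp add: tangent_eq)
qed

lemma boundary_integral_cong:
  assumes "\<And>\<zeta> \<tau>. \<zeta> \<in> frontier \<Omega> \<Longrightarrow> F \<zeta> \<tau> = G \<zeta> \<tau>"
  shows "bint F = bint G"
  unfolding boundary_integral_def
  by (intro sum.cong refl integral_cong) (simp add: assms arc_in_frontier)

lemma boundary_integral_linear:
  assumes "bounded_linear h" "boundary_integrable F"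
  shows "bint (\<lambda>\<zeta> \<tau>. h (F \<zeta> \<tau>)) = h (bint F)" "boundary_integrable (\<lambda>\<zeta> \<tau>. h (F \<zeta> \<tau>))"
proof -
  have int: "integral {0..L C} (\<lambda>s. h (F (\<sigma> C s) (tangent (\<sigma> C) (L C) s)))
      = h (integral {0..L C} (\<lambda>s. F (\<sigma> C s) (tangent (\<sigma> C) (L C) s)))"
    "(\<lambda>s. h (F (\<sigma> C s) (tangent (\<sigma> C) (L C) s))) integrable_on {0..L C}"
    if "C \<in> components (frontier \<Omega>)" for C
    using integral_linear[OF _ assms(1), of "\<lambda>s. F (\<sigma> C s) (tangent (\<sigma> C) (L C) s)" "{0..L C}"]
      integrable_linear[OF _ assms(1), of "\<lambda>s. F (\<sigma> C s) (tangent (\<sigma> C) (L C) s)" "{0..L C}"]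
      assms(2) that
    by (auto simp: boundary_integrable_def o_def)
  show "bint (\<lambda>\<zeta> \<tau>. h (F \<zeta> \<tau>)) = h (bint F)"
    unfolding boundary_integral_tangent linear_sum[OF bounded_linear.linear[OF assms(1)]]
    by (rule sum.cong) (simp_all add: int)
  show "boundary_integrable (\<lambda>\<zeta> \<tau>. h (F \<zeta> \<tau>))"
    unfolding boundary_integrable_def using int(2) by blast
qed

lemma boundary_integral_add:
  assumes "boundary_integrable F" "boundary_integrable G"
  shows "bint (\<lambda>\<zeta> \<tau>. F \<zeta> \<tau> + G \<zeta> \<tau>) = bint F + bint G" "boundary_integrable (\<lambda>\<zeta> \<tau>. F \<zeta> \<tau> + G \<zeta> \<tau>)"
  using assms unfolding boundary_integral_tangent boundary_integrable_def
  by (auto simp: integral_add integrable_add sum.distrib)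

lemma boundary_integrable_bilinear:
  fixes T :: "complex \<Rightarrow> 'b::banach" and prod :: "complex \<Rightarrow> 'b \<Rightarrow> 'c::banach"
  assumes bb: "bounded_bilinear prod" and T: "continuous_on (frontier \<Omega>) T"
  shows "boundary_integrable (\<lambda>\<zeta> \<tau>. prod \<tau> (T \<zeta>))" "boundary_integrable (\<lambda>\<zeta> \<tau>. prod (cnj \<tau>) (T \<zeta>))"
proof -
  have "(\<lambda>s. prod (tangent (\<sigma> C) (L C) s) (T (\<sigma> C s))) integrable_on {0..L C} \<and>
      (\<lambda>s. prod (cnj (tangent (\<sigma> C) (L C) s)) (T (\<sigma> C s))) integrable_on {0..L C}"
    if C: "C \<in> components (frontier \<Omega>)" for C
  proof -
    note arc = arc_component[OF C]
    have T': "continuous_on {0..L C} (\<lambda>s. T (\<sigma> C s))"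
      by (rule continuous_on_compose2[OF T continuous_on_arc[OF arc(2)]])
         (use arc_in_frontier[OF C] in auto)
    have "tangent (\<sigma> C) (L C) integrable_on {0..L C}"
      using has_integral_tangent[OF arc(2,1)] by blast
    moreover from integrable_linear[OF this bounded_linear_cnj]
    have "(\<lambda>s. cnj (tangent (\<sigma> C) (L C) s)) integrable_on {0..L C}"
      by (simp add: o_def)
    ultimately show ?thesis
      using norm_tangent_le[OF arc(2)]
      by (auto intro!: integrable_bilinear_continuous[OF bb _ _ T', where M = 1])
  qed
  then show "boundary_integrable (\<lambda>\<zeta> \<tau>. prod \<tau> (T \<zeta>))" "boundary_integrable (\<lambda>\<zeta> \<tau>. prod (cnj \<tau>) (T \<zeta>))"
    by (simp_all add: boundary_integrable_def)
qed

definition len :: real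
  where "len = (\<Sum>C\<in>components (frontier \<Omega>). L C)"

lemma len_nonneg: "0 \<le> len"
  unfolding len_def by (intro sum_nonneg arc_component)

lemma boundary_integral_bound:
  fixes F :: "complex \<Rightarrow> complex \<Rightarrow> complex"
  assumes F: "boundary_integrable F" and "\<And>\<zeta> \<tau>. \<zeta> \<in> frontier \<Omega> \<Longrightarrow> norm (F \<zeta> \<tau>) \<le> B * norm \<tau>" "0 \<le> B"
  shows "norm (bint F) \<le> B * len"
proof -
  have "norm (integral {0..L C} (\<lambda>s. F (\<sigma> C s) (tangent (\<sigma> C) (L C) s))) \<le> B * L C"
    if C: "C \<in> components (frontier \<Omega>)" for C
  proof -
    note arc = arc_component[OF C]
    have "norm (integral {0..L C} (\<lambda>s. F (\<sigma> C s) (tangent (\<sigma> C) (L C) s))) \<le> integral {0..L C} (\<lambda>s. B)"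
    proof (rule integral_norm_bound_integral)
      show "(\<lambda>s. F (\<sigma> C s) (tangent (\<sigma> C) (L C) s)) integrable_on {0..L C}"
        using F C by (simp add: boundary_integrable_def)
      fix s assume s: "s \<in> {0..L C}"
      have "norm (F (\<sigma> C s) (tangent (\<sigma> C) (L C) s)) \<le> B * norm (tangent (\<sigma> C) (L C) s)"
        by (rule assms(2)[OF arc_in_frontier[OF C s]])
      also have "\<dots> \<le> B"
        using norm_tangent_le[OF arc(2)] assms(3) by (simp add: mult_left_le)
      finally show "norm (F (\<sigma> C s) (tangent (\<sigma> C) (L C) s)) \<le> B" .
    qed (rule integrable_const_ivl)
    then show ?thesis using arc(1) by (simp add: mult.commute)
  qed
  then show ?thesis
    unfolding boundary_integral_tangent len_def sum_distrib_left
    by (intro order_trans[OF norm_sum] sum_mono) auto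
qed

subsection \<open>Complex line integrals\<close>

definition cint :: "(complex \<Rightarrow> complex) \<Rightarrow> complex"
  where "cint u = bint (\<lambda>\<zeta> \<tau>. u \<zeta> * \<tau>)"

lemma boundary_integrable_mult:
  assumes "continuous_on (frontier \<Omega>) u"
  shows "boundary_integrable (\<lambda>\<zeta> \<tau>. u \<zeta> * \<tau>)"
  using boundary_integrable_bilinear(1)[OF bounded_bilinear_mult assms] by (simp add: mult.commute)

lemma cint_cong: "(\<And>\<zeta>. \<zeta> \<in> frontier \<Omega> \<Longrightarrow> u \<zeta> = v \<zeta>) \<Longrightarrow> cint u = cint v"
  unfolding cint_def by (rule boundary_integral_cong) simp

lemma cint_add:
  assumes "continuous_on (frontier \<Omega>) u" "continuous_on (frontier \<Omega>) v"
  shows "cint (\<lambda>\<zeta>. u \<zeta> + v \<zeta>) = cint u + cint v"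
  using boundary_integral_add(1)[OF boundary_integrable_mult[OF assms(1)] boundary_integrable_mult[OF assms(2)]]
  by (simp add: cint_def distrib_right)

lemma cint_cmult:
  assumes "continuous_on (frontier \<Omega>) u"
  shows "cint (\<lambda>\<zeta>. c * u \<zeta>) = c * cint u"
  using boundary_integral_linear(1)[OF bounded_linear_mult_right boundary_integrable_mult[OF assms], of c]
  by (simp add: cint_def mult.assoc)

lemma cint_diff:
  assumes "continuous_on (frontier \<Omega>) u" "continuous_on (frontier \<Omega>) v"
  shows "cint (\<lambda>\<zeta>. u \<zeta> - v \<zeta>) = cint u - cint v"
  using cint_add[OF assms(1) continuous_on_mult[OF continuous_on_const[of _ "-1"] assms(2)]]
    cint_cmult[OF assms(2), of "-1"] by simp

lemma cint_bound:
  assumes "continuous_on (frontier \<Omega>) u" "\<And>\<zeta>. \<zeta> \<in> frontier \<Omega> \<Longrightarrow> cmod (u \<zeta>) \<le> B" "0 \<le> B"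
  shows "cmod (cint u) \<le> B * len"
  unfolding cint_def
  by (rule boundary_integral_bound[OF boundary_integrable_mult[OF assms(1)]])
     (auto simp: norm_mult assms intro!: mult_right_mono)

lemma cint_deriv:
  assumes "F holomorphic_on U" "open U" "frontier \<Omega> \<subseteq> U"
  shows "cint (deriv F) = 0"
  unfolding cint_def boundary_integral_tangent
proof (rule sum.neutral, intro ballI)
  fix C assume C: "C \<in> components (frontier \<Omega>)"
  note arc = arc_component[OF C]
  have "\<sigma> C ` {0..L C} \<subseteq> U"
    using arc_in_frontier[OF C] assms(3) by blast
  from integral_holomorphic_derivative[OF arc(2,1) assms(1,2) this]
  show "integral {0..L C} (\<lambda>s. deriv F (\<sigma> C s) * tangent (\<sigma> C) (L C) s) = 0"
    using arc(4) by (simp add: integral_unique)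
qed

lemma cint_inverse:
  assumes "z \<notin> frontier \<Omega>"
  shows "cint (\<lambda>\<zeta>. 1 / (\<zeta> - z)) = 2 * of_real pi * \<i> * (if z \<in> \<Omega> then 1 else 0)"
proof -
  let ?w = "\<lambda>C. winding_number (\<lambda>t. \<sigma> C (L C * t)) z"
  have "integral {0..L C} (\<lambda>s. tangent (\<sigma> C) (L C) s / (\<sigma> C s - z)) = 2 * of_real pi * \<i> * ?w C"
    if C: "C \<in> components (frontier \<Omega>)" for C
  proof (rule integral_unique, rule winding_number_arc)
    show "z \<notin> \<sigma> C ` {0..L C}"
      using arc_in_frontier[OF C] assms by blast
  qed (rule arc_component[OF C])+
  then have "cint (\<lambda>\<zeta>. 1 / (\<zeta> - z)) = 2 * of_real pi * \<i> * (\<Sum>C\<in>components (frontier \<Omega>). ?w C)"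
    unfolding cint_def boundary_integral_tangent by (simp add: sum_distrib_left)
  moreover have "z \<in> \<Omega> \<or> z \<notin> closure \<Omega>"
    using assms open_domain by (auto simp: frontier_def interior_open)
  ultimately show ?thesis
    using oriented_boundary closure_subset[of \<Omega>] by (auto simp: positively_oriented_boundary_def)
qed

end

subsection \<open>Cauchy's theorem and integral formula for rational functions\<close>

text \<open>
  The integrals of rational functions are computed term by term from a partial fraction
  decomposition. Closure under equality on \<open>X\<close> replaces existence statements
  about decompositions.
\<close>

inductive partial_fractions :: "complex set \<Rightarrow> (complex \<Rightarrow> complex) \<Rightarrow> bool" for X where
  power: "partial_fractions X (\<lambda>z. z ^ n)"
| pole: "a \<notin> X \<Longrightarrow> partial_fractions X (\<lambda>z. 1 / (z - a) ^ Suc n)"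
| add: "partial_fractions X u \<Longrightarrow> partial_fractions X v \<Longrightarrow> partial_fractions X (\<lambda>z. u z + v z)"
| cmult: "partial_fractions X u \<Longrightarrow> partial_fractions X (\<lambda>z. c * u z)"
| cong: "partial_fractions X u \<Longrightarrow> (\<And>z. z \<in> X \<Longrightarrow> v z = u z) \<Longrightarrow> partial_fractions X v"

text \<open>
  With \<open>1/((z - b)\<^sup>k\<^sup>+\<^sup>1 (z - a)) = (1/(z - b)\<^sup>k\<^sup>+\<^sup>1 - 1/((z - b)\<^sup>k (z - a)))/(b - a)\<close> the order of one pole drops;
  powers of \<open>z\<close> are treated alike by \<open>z\<^sup>n\<^sup>+\<^sup>1 = (z - a) z\<^sup>n + a z\<^sup>n\<close>.
\<close>

lemma partial_fractions_divide:
  assumes "partial_fractions X u" "a \<notin> X"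
  shows "partial_fractions X (\<lambda>z. u z / (z - a))"
  using assms(1)
proof induction
  case (power n)
  show ?case
  proof (induction n)
    case 0
    show ?case using partial_fractions.pole[OF assms(2), of 0] by simp
  next
    case (Suc n)
    have "z ^ Suc n / (z - a) = z ^ n + a * (z ^ n / (z - a))" if "z \<in> X" for z
    proof -
      have "z - a \<noteq> 0" using that assms(2) by auto
      moreover have "z ^ Suc n = (z - a) * z ^ n + a * z ^ n"
        by (simp add: algebra_simps)
      ultimately show ?thesis
        by (simp only: add_divide_distrib) simp
    qed
    then show ?case
      by (rule partial_fractions.cong[OF partial_fractions.add[OF partial_fractions.power
            partial_fractions.cmult[OF Suc.IH]]])
  qed
next
  case (pole b n)
  show ?case
  proof (cases "b = a")
    case True
    then show ?thesis
      using partial_fractions.pole[OF assms(2), of "Suc n"] by (simp add: mult.commute)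
  next
    case False
    have split: "1 / (z - b) ^ Suc k / (z - a) = (1 / (b - a)) * (1 / (z - b) ^ Suc k + (-1) * (1 / (z - b) ^ k / (z - a)))"
      if "z \<in> X" for z k
    proof -
      have "z - a \<noteq> 0" "z - b \<noteq> 0" "b - a \<noteq> 0" using that assms(2) pole False by auto
      then show ?thesis
        by (simp add: divide_simps)
    qed
    have "partial_fractions X (\<lambda>z. 1 / (z - b) ^ k / (z - a))" for k
    proof (induction k)
      case 0
      show ?case using partial_fractions.pole[OF assms(2), of 0] by simp
    next
      case (Suc k)
      show ?case
        by (rule partial_fractions.cong[OF partial_fractions.cmult[OF partial_fractions.add[OF
              partial_fractions.pole[OF pole] partial_fractions.cmult[OF Suc.IH]]] split])
    qed
    then show ?thesis by blast
  qed
next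
  case (add u v)
  then show ?case
    using partial_fractions.add[OF add.IH] by (simp add: add_divide_distrib)
next
  case (cmult u c)
  then show ?case
    using partial_fractions.cmult[OF cmult.IH, of c] by simp
next
  case (cong u v)
  show ?case
    by (rule partial_fractions.cong[OF cong.IH]) (simp add: cong.hyps)
qed

lemma partial_fractions_poly: "partial_fractions X (poly p)"
proof -
  have "partial_fractions X (\<lambda>z. z ^ k * poly p z)" for k
  proof (induction p arbitrary: k)
    case 0
    show ?case
      using partial_fractions.cmult[OF partial_fractions.power, of X 0 0] by simp
  next
    case (pCons a p)
    show ?case
      by (rule partial_fractions.cong[OF partial_fractions.add[OF
            partial_fractions.cmult[OF partial_fractions.power[of X k], of a] pCons.IH[of "Suc k"]]])
         (simp add: algebra_simps)
  qed
  from this[of 0] show ?thesis by simp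
qed

lemma partial_fractions_rational:
  assumes "\<And>z. z \<in> X \<Longrightarrow> poly d z \<noteq> 0"
  shows "partial_fractions X (\<lambda>z. poly p z / poly d z)"
  using assms
proof (induction "degree d" arbitrary: d)
  case 0
  then obtain c where "d = [:c:]"
    by (metis degree_eq_zeroE)
  then show ?case
    using partial_fractions.cmult[OF partial_fractions_poly[of X p], of "1 / c"] by simp
next
  case (Suc n)
  then have "\<not> constant (poly d)"
    by (metis Zero_not_Suc constant_degree)
  then obtain a where a: "poly d a = 0"
    using Fundamental_Theorem_Algebra.fundamental_theorem_of_algebra by blast
  then obtain q where q: "d = [:- a, 1:] * q"
    by (auto simp: poly_eq_0_iff_dvd elim: dvdE)
  have "q \<noteq> 0" using Suc.hyps(2) q by auto
  then have "n = degree q"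
    using Suc.hyps(2) degree_mult_eq[of "[:- a, 1:]" q] unfolding q by simp
  moreover have "poly q z \<noteq> 0" if "z \<in> X" for z
    using Suc.prems[OF that] by (simp add: q)
  ultimately have "partial_fractions X (\<lambda>z. poly p z / poly q z)"
    using Suc.hyps(1) by blast
  moreover have "a \<notin> X" using a Suc.prems by blast
  ultimately have "partial_fractions X (\<lambda>z. poly p z / poly q z / (z - a))"
    by (rule partial_fractions_divide)
  then show ?case
    by (rule partial_fractions.cong) (simp add: q algebra_simps)
qed

lemma partial_fractions_continuous_on:
  assumes "partial_fractions X u" "Y \<subseteq> X"
  shows "continuous_on Y u"
  using assms(1)
proof induction
  case (cong u v)
  then show ?case using assms(2) by (metis continuous_on_cong subsetD)
qed (use assms(2) in \<open>auto intro!: continuous_intros\<close>)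

context rectifiable_domain
begin

text \<open>
  Powers and poles of higher order have holomorphic antiderivatives near the boundary, and the boundary
  curves are closed; a simple pole off the closure contributes the total winding number, which is \<open>0\<close>.
\<close>

lemma cint_partial_fractions:
  assumes "partial_fractions (closure \<Omega>) u"
  shows "cint u = 0"
  using assms
proof induction
  case (power n)
  define F where "F z = z ^ Suc n / of_nat (Suc n)" for z :: complex
  have F': "(F has_field_derivative z ^ n) (at z)" for z
    using DERIV_cdivide[OF DERIV_power[OF DERIV_ident, of "Suc n" z UNIV], of "of_nat (Suc n)"]
    unfolding F_def by (simp del: of_nat_Suc)
  have "cint (deriv F) = 0"
  proof (rule cint_deriv[of _ UNIV])
    show "F holomorphic_on UNIV"
      unfolding F_def by (intro holomorphic_intros) simp
  qed simp_all
  moreover have "deriv F = (\<lambda>z. z ^ n)"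
    by (rule ext) (rule DERIV_imp_deriv[OF F'])
  ultimately show ?case by simp
next
  case (pole a n)
  show ?case
  proof (cases n)
    case 0
    have "a \<notin> frontier \<Omega>" "a \<notin> \<Omega>"
      using pole frontier_in_closure closure_subset by auto
    then show ?thesis
      using 0 cint_inverse[of a] by simp
  next
    case (Suc m)
    define N :: complex where "N = of_nat (Suc m)"
    have "N \<noteq> 0" unfolding N_def by (rule of_nat_neq_0)
    define F where "F z = (- 1 / N) * inverse ((z - a) ^ Suc m)" for z :: complex
    have F': "deriv F z = 1 / (z - a) ^ Suc n" if "z \<noteq> a" for z
    proof (rule DERIV_imp_deriv)
      define w P where "w = z - a" and "P = w ^ m"
      have nz: "w \<noteq> 0" "P \<noteq> 0" using that by (auto simp: w_def P_def)
      have "((\<lambda>z. (z - a) ^ Suc m) has_field_derivative N * w ^ m) (at z)"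
        unfolding N_def w_def by (rule derivative_eq_intros refl | simp)+
      then have "((\<lambda>z. inverse ((z - a) ^ Suc m)) has_field_derivative
          - (inverse (w * P) * (N * P) * inverse (w * P))) (at z)"
        using DERIV_inverse'[of "\<lambda>z. (z - a) ^ Suc m" "N * w ^ m" z UNIV] nz
        by (simp add: P_def w_def)
      from DERIV_cmult[OF this, of "- 1 / N"]
      have "(F has_field_derivative (- 1 / N) * - (inverse (w * P) * (N * P) * inverse (w * P))) (at z)"
        unfolding F_def .
      moreover have "(- 1 / N) * - (inverse (w * P) * (N * P) * inverse (w * P)) = 1 / (w * (w * P))"
        using nz \<open>N \<noteq> 0\<close> by (simp add: field_simps)
      ultimately show "(F has_field_derivative 1 / (z - a) ^ Suc n) (at z)"
        using Suc by (simp add: w_def P_def)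
    qed
    have "cint (deriv F) = 0"
    proof (rule cint_deriv[of _ "- {a}"])
      show "F holomorphic_on - {a}"
        unfolding F_def by (intro holomorphic_intros) auto
      show "frontier \<Omega> \<subseteq> - {a}"
        using pole frontier_in_closure by auto
    qed auto
    moreover have "cint (deriv F) = cint (\<lambda>z. 1 / (z - a) ^ Suc n)"
    proof (rule cint_cong)
      fix \<zeta> assume "\<zeta> \<in> frontier \<Omega>"
      then have "\<zeta> \<noteq> a" using pole frontier_in_closure by blast
      then show "deriv F \<zeta> = 1 / (\<zeta> - a) ^ Suc n" by (rule F')
    qed
    ultimately show ?thesis by simp
  qed
next
  case (add u v)
  then show ?case
    using cint_add partial_fractions_continuous_on frontier_in_closure by (metis add_0 subsetI)
next
  case (cmult u c)
  then show ?case
    using cint_cmult partial_fractions_continuous_on frontier_in_closure by (metis mult_zero_right subsetI)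
next
  case (cong u v)
  then show ?case
    using cint_cong[of v u] frontier_in_closure by simp
qed

lemma cint_rational:
  assumes "\<And>z. z \<in> closure \<Omega> \<Longrightarrow> poly d z \<noteq> 0"
  shows "cint (\<lambda>z. poly p z / poly d z) = 0"
  by (rule cint_partial_fractions[OF partial_fractions_rational[OF assms]])

definition cauchy :: "(complex \<Rightarrow> complex) \<Rightarrow> complex \<Rightarrow> complex"
  where "cauchy u z = 1 / (2 * of_real pi * \<i>) * cint (\<lambda>\<zeta>. u \<zeta> / (\<zeta> - z))"

lemma conj_cauchy_eq: "conj_cauchy \<Omega> L \<sigma> f z = cauchy (\<lambda>\<zeta>. cnj (f \<zeta>)) z"
  by (simp add: conj_cauchy_def cauchy_def cint_def)

lemma continuous_on_cauchy_kernel: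
  assumes "continuous_on (frontier \<Omega>) u" "z \<in> \<Omega>"
  shows "continuous_on (frontier \<Omega>) (\<lambda>\<zeta>. u \<zeta> / (\<zeta> - z))"
  using assms frontier_not_in_domain by (intro continuous_intros) auto

lemma cauchy_const:
  assumes "z \<in> \<Omega>"
  shows "cauchy (\<lambda>\<zeta>. c) z = c"
proof -
  have "z \<notin> frontier \<Omega>"
    using assms frontier_not_in_domain by blast
  then show ?thesis
    using cint_cmult[OF continuous_on_cauchy_kernel[OF continuous_on_const[of _ 1] assms], of c]
      cint_inverse[of z] assms
    by (simp add: cauchy_def)
qed

lemma cauchy_diff:
  assumes "continuous_on (frontier \<Omega>) u" "continuous_on (frontier \<Omega>) v" "z \<in> \<Omega>"
  shows "cauchy (\<lambda>\<zeta>. u \<zeta> - v \<zeta>) z = cauchy u z - cauchy v z"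
  using cint_diff[OF continuous_on_cauchy_kernel[OF assms(1,3)] continuous_on_cauchy_kernel[OF assms(2,3)]]
  by (simp add: cauchy_def diff_divide_distrib right_diff_distrib)

text \<open>
  With \<open>u = 1/d\<close> all integrals of \<open>p u\<close>, \<open>p\<close> a polynomial, vanish; hence the Cauchy transform
  of \<open>p u\<close> at \<open>z\<close> is \<open>p(z)\<close> times that of \<open>u\<close>, and the choice \<open>p = d\<close> evaluates the latter.
\<close>

lemma cauchy_rational:
  assumes d: "\<And>z. z \<in> closure \<Omega> \<Longrightarrow> poly d z \<noteq> 0" and z: "z \<in> \<Omega>"
  shows "cauchy (\<lambda>\<zeta>. poly p \<zeta> / poly d \<zeta>) z = poly p z / poly d z"
proof -
  define u where "u \<zeta> = 1 / poly d \<zeta>" for \<zeta>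
  have u: "continuous_on (frontier \<Omega>) u"
    unfolding u_def using d frontier_in_closure by (intro continuous_intros) auto
  have mult: "cauchy (\<lambda>\<zeta>. poly q \<zeta> * u \<zeta>) z = poly q z * cauchy u z" for q
  proof -
    have "[:- z, 1:] dvd q - [:poly q z:]"
      by (simp flip: poly_eq_0_iff_dvd)
    then obtain q' where q': "q - [:poly q z:] = [:- z, 1:] * q'"
      by (elim dvdE)
    have eq: "poly q \<zeta> * u \<zeta> / (\<zeta> - z) = poly q' \<zeta> / poly d \<zeta> + poly q z * (u \<zeta> / (\<zeta> - z))"
      if "\<zeta> \<in> frontier \<Omega>" for \<zeta>
    proof -
      have "\<zeta> - z \<noteq> 0" using that z frontier_not_in_domain by auto
      have "poly q \<zeta> = (\<zeta> - z) * poly q' \<zeta> + poly q z"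
        using arg_cong[OF q', of "\<lambda>p. poly p \<zeta>"] by (simp add: algebra_simps)
      then show ?thesis
        using \<open>\<zeta> - z \<noteq> 0\<close> by (simp add: u_def add_divide_distrib)
    qed
    have "cint (\<lambda>\<zeta>. poly q \<zeta> * u \<zeta> / (\<zeta> - z))
        = cint (\<lambda>\<zeta>. poly q' \<zeta> / poly d \<zeta> + poly q z * (u \<zeta> / (\<zeta> - z)))"
      by (rule cint_cong) (rule eq)
    also have "\<dots> = cint (\<lambda>\<zeta>. poly q' \<zeta> / poly d \<zeta>) + cint (\<lambda>\<zeta>. poly q z * (u \<zeta> / (\<zeta> - z)))"
      by (intro cint_add continuous_on_mult continuous_on_const continuous_on_cauchy_kernel u z)
         (use d frontier_in_closure in \<open>auto intro!: continuous_intros\<close>)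
    also have "\<dots> = poly q z * cint (\<lambda>\<zeta>. u \<zeta> / (\<zeta> - z))"
      by (simp add: cint_rational[OF d] cint_cmult continuous_on_cauchy_kernel u z del: times_divide_eq_right)
    finally show ?thesis
      by (simp add: cauchy_def)
  qed
  have "cauchy (\<lambda>\<zeta>. poly d \<zeta> * u \<zeta>) z = cauchy (\<lambda>\<zeta>. 1) z"
    unfolding cauchy_def
    by (intro arg_cong2[where f = "(*)"] refl cint_cong) (use d frontier_in_closure in \<open>auto simp: u_def\<close>)
  then have "poly d z * cauchy u z = 1"
    by (simp add: mult cauchy_const z)
  then have "cauchy u z = 1 / poly d z"
    using d[of z] z subsetD[OF closure_subset z] by (simp add: eq_divide_eq mult.commute)
  with mult[of p] show ?thesis
    by (simp add: u_def)
qed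

text \<open>
  Differentiation under the integral, by a direct estimate of the difference quotient of the kernel:
  the tangent is merely measurable, while \<open>1/(\<zeta> - w)\<close> is smooth in \<open>w\<close> with bounds
  that are uniform in \<open>\<zeta>\<close>, as \<open>w\<close> keeps a distance \<open>r\<close> from the boundary.
\<close>

lemma holomorphic_cauchy:
  assumes u: "continuous_on (frontier \<Omega>) u"
  shows "cauchy u holomorphic_on \<Omega>"
proof -
  obtain B where B: "B > 0" "\<And>\<zeta>. \<zeta> \<in> frontier \<Omega> \<Longrightarrow> cmod (u \<zeta>) \<le> B"
    using compact_imp_bounded[OF compact_continuous_image[OF u compact_frontier_domain]]
    unfolding bounded_pos by auto
  have "(cauchy u has_field_derivative 1 / (2 * of_real pi * \<i>) * cint (\<lambda>\<zeta>. u \<zeta> / (\<zeta> - z) / (\<zeta> - z))) (at z)"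
    if z: "z \<in> \<Omega>" for z
  proof -
    obtain r where r: "r > 0" "ball z (2 * r) \<subseteq> \<Omega>"
      using open_domain z by (metis field_sum_of_halves half_gt_zero mult_2 openE)
    have far: "r \<le> cmod (\<zeta> - w)" if "\<zeta> \<in> frontier \<Omega>" "w \<in> ball z r" for \<zeta> w
    proof -
      have "\<zeta> \<notin> ball z (2 * r)" using that r frontier_not_in_domain by blast
      then show ?thesis
        using that norm_triangle_ineq[of "\<zeta> - w" "w - z"] by (simp add: dist_norm norm_minus_commute)
    qed
    define D where "D = cint (\<lambda>\<zeta>. u \<zeta> / (\<zeta> - z) / (\<zeta> - z))"
    define q where "q w = cint (\<lambda>\<zeta>. u \<zeta> / (\<zeta> - w))" for w
    have le: "cmod ((q w - q z) / (w - z) - D) \<le> cmod (w - z) * (B / (r * r * r) * len)"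
      if w: "w \<in> ball z r" "w \<noteq> z" for w
    proof -
      have wz: "w \<in> \<Omega>" using w r by auto
      note c = continuous_on_cauchy_kernel
      have "cint (\<lambda>\<zeta>. 1 / (w - z) * (u \<zeta> / (\<zeta> - w) - u \<zeta> / (\<zeta> - z)) - u \<zeta> / (\<zeta> - z) / (\<zeta> - z))
          = cint (\<lambda>\<zeta>. 1 / (w - z) * (u \<zeta> / (\<zeta> - w) - u \<zeta> / (\<zeta> - z))) - D"
        unfolding D_def
        by (intro cint_diff continuous_on_mult continuous_on_const continuous_on_diff c u z wz)
      also have "cint (\<lambda>\<zeta>. 1 / (w - z) * (u \<zeta> / (\<zeta> - w) - u \<zeta> / (\<zeta> - z)))
          = 1 / (w - z) * cint (\<lambda>\<zeta>. u \<zeta> / (\<zeta> - w) - u \<zeta> / (\<zeta> - z))"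
        by (intro cint_cmult continuous_on_diff c u z wz)
      also have "cint (\<lambda>\<zeta>. u \<zeta> / (\<zeta> - w) - u \<zeta> / (\<zeta> - z)) = q w - q z"
        unfolding q_def by (intro cint_diff c u z wz)
      finally have "(q w - q z) / (w - z) - D
          = cint (\<lambda>\<zeta>. 1 / (w - z) * (u \<zeta> / (\<zeta> - w) - u \<zeta> / (\<zeta> - z)) - u \<zeta> / (\<zeta> - z) / (\<zeta> - z))"
        by simp
      also have "\<dots> = cint (\<lambda>\<zeta>. (w - z) * (u \<zeta> / (\<zeta> - w) / (\<zeta> - z) / (\<zeta> - z)))"
      proof (rule cint_cong)
        fix \<zeta> assume "\<zeta> \<in> frontier \<Omega>"
        then have "\<zeta> - w \<noteq> 0" "\<zeta> - z \<noteq> 0" "w - z \<noteq> 0"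
          using z wz frontier_not_in_domain w by auto
        then show "1 / (w - z) * (u \<zeta> / (\<zeta> - w) - u \<zeta> / (\<zeta> - z)) - u \<zeta> / (\<zeta> - z) / (\<zeta> - z)
            = (w - z) * (u \<zeta> / (\<zeta> - w) / (\<zeta> - z) / (\<zeta> - z))"
          by (simp add: divide_simps) (simp add: algebra_simps)
      qed
      also have "\<dots> = (w - z) * cint (\<lambda>\<zeta>. u \<zeta> / (\<zeta> - w) / (\<zeta> - z) / (\<zeta> - z))"
        by (intro cint_cmult c u z wz)
      finally have "cmod ((q w - q z) / (w - z) - D)
          = cmod (w - z) * cmod (cint (\<lambda>\<zeta>. u \<zeta> / (\<zeta> - w) / (\<zeta> - z) / (\<zeta> - z)))"
        by (simp add: norm_mult)
      also have "\<dots> \<le> cmod (w - z) * (B / (r * r * r) * len)"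
      proof (intro mult_left_mono cint_bound c u z wz)
        fix \<zeta> assume \<zeta>: "\<zeta> \<in> frontier \<Omega>"
        have "r * r * r \<le> cmod (\<zeta> - w) * cmod (\<zeta> - z) * cmod (\<zeta> - z)"
          using far[OF \<zeta> w(1)] far[OF \<zeta>, of z] r by (intro mult_mono) auto
        then show "cmod (u \<zeta> / (\<zeta> - w) / (\<zeta> - z) / (\<zeta> - z)) \<le> B / (r * r * r)"
          using B r \<zeta> by (auto simp: norm_divide norm_mult intro!: frac_le)
      qed (use B r in auto)
      finally show ?thesis .
    qed
    have "((\<lambda>w. cmod (w - z) * (B / (r * r * r) * len)) \<longlongrightarrow> cmod (z - z) * (B / (r * r * r) * len)) (at z)"
      by (intro tendsto_intros)
    then have lim: "((\<lambda>w. cmod (w - z) * (B / (r * r * r) * len)) \<longlongrightarrow> 0) (at z)"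
      by simp
    have "\<forall>\<^sub>F w in at z. w \<in> ball z r"
      using r(1) by (intro eventually_at_in_open') auto
    moreover have "\<forall>\<^sub>F w in at z. w \<noteq> z"
      by (simp add: eventually_at_filter)
    ultimately have "\<forall>\<^sub>F w in at z. cmod ((q w - q z) / (w - z) - D) \<le> cmod (w - z) * (B / (r * r * r) * len)"
      by eventually_elim (rule le)
    then have "(q has_field_derivative D) (at z)"
      unfolding has_field_derivative_iff by (rule LIM_zero_cancel[OF Lim_null_comparison[OF _ lim]])
    from DERIV_cmult[OF this, of "1 / (2 * of_real pi * \<i>)"] show ?thesis
      by (simp add: cauchy_def[abs_def] q_def D_def)
  qed
  then show ?thesis
    unfolding holomorphic_on_def
    by (metis field_differentiable_at_within field_differentiable_def)
qed

end

section \<open>The holomorphic functional calculus\<close>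

locale spectral_domain = rectifiable_domain +
  fixes A :: "'a::complex_hilbert_space \<Rightarrow>\<^sub>L 'a"
  assumes clinear_A: "clinear_op A" and spectrum_A: "op_spectrum A \<subseteq> \<Omega>"
begin

lemma not_in_spectrum: "z \<notin> \<Omega> \<Longrightarrow> z \<notin> op_spectrum A"
  using spectrum_A by blast

lemma frontier_not_in_spectrum: "z \<in> frontier \<Omega> \<Longrightarrow> z \<notin> op_spectrum A"
  using frontier_not_in_domain not_in_spectrum by blast

lemma continuous_on_frontier_resolvent: "continuous_on (frontier \<Omega>) (\<lambda>\<zeta>. resolvent \<zeta> A)"
  by (rule continuous_on_resolvent[OF clinear_A]) (use frontier_not_in_spectrum in blast)

lemma continuous_on_frontier_cinner: "continuous_on (frontier \<Omega>) (\<lambda>\<zeta>. cinner (resolvent \<zeta> A x) y)"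
  by (rule continuous_on_cinner_resolvent[OF clinear_A]) (use frontier_not_in_spectrum in blast)

text \<open>
  The Riesz-Dunford integral over the boundary of \<open>\<Omega>\<close>, also for symbols without holomorphic extension
  to \<open>\<Omega>\<close>, such as the conjugate of a rational function.
\<close>

definition calculus :: "(complex \<Rightarrow> complex) \<Rightarrow> 'a \<Rightarrow>\<^sub>L 'a"
  where "calculus u = (1 / (2 * of_real pi * \<i>)) *\<^sub>C bint (\<lambda>\<zeta> \<tau>. \<tau> *\<^sub>C (u \<zeta> *\<^sub>C resolvent \<zeta> A))"

lemma bounded_linear_cinner_apply: "bounded_linear (\<lambda>T :: 'a \<Rightarrow>\<^sub>L 'a. cinner (T x) y)"
  by (rule bounded_linear_compose[OF bounded_linear_cinner_left blinfun.bounded_linear_left])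

lemma cinner_calculus:
  assumes u: "continuous_on (frontier \<Omega>) u"
  shows "cinner (calculus u x) y
    = 1 / (2 * of_real pi * \<i>) * cint (\<lambda>\<zeta>. u \<zeta> * cinner (resolvent \<zeta> A x) y)"
proof -
  have "continuous_on (frontier \<Omega>) (\<lambda>\<zeta>. u \<zeta> *\<^sub>C resolvent \<zeta> A)"
    by (rule bounded_bilinear.continuous_on[OF bounded_bilinear_scaleC_blinfun u
          continuous_on_frontier_resolvent])
  from boundary_integral_linear(1)[OF bounded_linear_cinner_apply
      boundary_integrable_bilinear(1)[OF bounded_bilinear_scaleC_blinfun this], of x y]
  show ?thesis
    by (simp add: calculus_def cinner_scaleC_left cint_def mult_ac)
qed

lemma calculus_cong:
  assumes "\<And>\<zeta>. \<zeta> \<in> frontier \<Omega> \<Longrightarrow> u \<zeta> = v \<zeta>"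
  shows "calculus u = calculus v"
  unfolding calculus_def
  by (rule arg_cong[where f = "scaleC _"], rule boundary_integral_cong) (simp add: assms)

lemma calculus_diff:
  assumes "continuous_on (frontier \<Omega>) u" "continuous_on (frontier \<Omega>) v"
  shows "calculus (\<lambda>\<zeta>. u \<zeta> - v \<zeta>) x = calculus u x - calculus v x"
proof (rule cinner_eqI)
  fix y
  show "cinner (calculus (\<lambda>\<zeta>. u \<zeta> - v \<zeta>) x) y = cinner (calculus u x - calculus v x) y"
    using cint_diff[OF continuous_on_mult[OF assms(1) continuous_on_frontier_cinner[of x y]]
        continuous_on_mult[OF assms(2) continuous_on_frontier_cinner[of x y]]]
    by (simp add: cinner_diff_left cinner_calculus assms continuous_on_diff left_diff_distrib
        right_diff_distrib diff_divide_distrib)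
qed

lemma calculus_bounded:
  "\<exists>K\<ge>0. \<forall>u M. continuous_on (frontier \<Omega>) u \<longrightarrow> (\<forall>\<zeta>\<in>frontier \<Omega>. cmod (u \<zeta>) \<le> M) \<longrightarrow> 0 \<le> M \<longrightarrow>
     norm (calculus u) \<le> K * M"
proof -
  obtain \<rho> where \<rho>: "\<rho> > 0" "\<And>\<zeta>. \<zeta> \<in> frontier \<Omega> \<Longrightarrow> norm (resolvent \<zeta> A) \<le> \<rho>"
    using compact_imp_bounded[OF compact_continuous_image[OF continuous_on_frontier_resolvent compact_frontier_domain]]
    unfolding bounded_pos by auto
  define K where "K = \<rho> * len / (2 * pi)"
  have K: "0 \<le> K" using \<rho> len_nonneg by (simp add: K_def)
  have "norm (calculus u) \<le> K * M"
    if u: "continuous_on (frontier \<Omega>) u" and M: "\<forall>\<zeta>\<in>frontier \<Omega>. cmod (u \<zeta>) \<le> M" "0 \<le> M" for u M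
  proof (rule blinfun_norm_cinnerI)
    fix x y :: 'a
    have "cmod (cint (\<lambda>\<zeta>. u \<zeta> * cinner (resolvent \<zeta> A x) y)) \<le> M * (\<rho> * norm x * norm y) * len"
    proof (rule cint_bound)
      show "continuous_on (frontier \<Omega>) (\<lambda>\<zeta>. u \<zeta> * cinner (resolvent \<zeta> A x) y)"
        by (intro continuous_on_mult u continuous_on_frontier_cinner)
      fix \<zeta> assume \<zeta>: "\<zeta> \<in> frontier \<Omega>"
      have "norm (resolvent \<zeta> A x) \<le> \<rho> * norm x"
        using norm_blinfun[of "resolvent \<zeta> A" x] mult_right_mono[OF \<rho>(2)[OF \<zeta>] norm_ge_zero[of x]] by linarith
      then have "cmod (cinner (resolvent \<zeta> A x) y) \<le> \<rho> * norm x * norm y"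
        using cmod_cinner_le[of "resolvent \<zeta> A x" y] mult_right_mono[of "norm (resolvent \<zeta> A x)" "\<rho> * norm x" "norm y"]
        by simp
      then show "cmod (u \<zeta> * cinner (resolvent \<zeta> A x) y) \<le> M * (\<rho> * norm x * norm y)"
        unfolding norm_mult using M \<zeta> by (intro mult_mono) auto
    qed (use M \<rho> in simp)
    then show "cmod (cinner (calculus u x) y) \<le> K * M * norm x * norm y"
      by (simp add: cinner_calculus[OF u] norm_mult norm_divide K_def divide_le_eq field_simps)
  qed (use K M in simp)
  with K show ?thesis by blast
qed

text \<open>
  If the Cauchy transform of \<open>u\<close> is a constant \<open>c\<close> in \<open>\<Omega>\<close>, the resolvent identity shows that
  \<open>R(z)(c I - u(A))\<close> coincides, in the weak sense, with a Cauchy transform for \<open>z\<close> in \<open>\<Omega>\<close> off the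
  spectrum, and thus extends holomorphically across the spectrum. This entire function vanishes at
  infinity, so it is zero by Liouville's theorem. The injectivity of the resolvent then gives the
  claim.
\<close>

lemma calculus_const_cauchy:
  assumes u: "continuous_on (frontier \<Omega>) u" and c: "\<And>z. z \<in> \<Omega> \<Longrightarrow> cauchy u z = c"
  shows "calculus u x = c *\<^sub>C x"
proof -
  define D where "D = c *\<^sub>C x - calculus u x"
  have zero: "cinner (resolvent z A D) y = 0" if z: "z \<notin> \<Omega>" for z y
  proof -
    define k where "k \<zeta> = u \<zeta> * cinner (resolvent \<zeta> A x) y" for \<zeta>
    have k: "continuous_on (frontier \<Omega>) k"
      unfolding k_def by (intro continuous_on_mult u continuous_on_frontier_cinner)
    \<comment> \<open>The adjoint moves \<open>R(z)\<close> inside the integral, where the resolvent identity splits the product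
      \<open>R(z) R(\<zeta>)\<close>; the first part contains the Cauchy transform of \<open>u\<close>.\<close>
    have eq: "cinner (resolvent z A D) y = cauchy k z" if z: "z \<in> \<Omega>" "z \<notin> op_spectrum A" for z
    proof -
      note R = clinear_op_resolvent[OF clinear_A z(2)]
      define r where "r = cinner (resolvent z A x) y"
      have "cinner (resolvent z A (calculus u x)) y = cinner (calculus u x) (op_adjoint (resolvent z A) y)"
        by (rule cinner_op_adjoint[OF R])
      also have "\<dots> = 1 / (2 * of_real pi * \<i>) * cint (\<lambda>\<zeta>. u \<zeta> * cinner (resolvent z A (resolvent \<zeta> A x)) y)"
        unfolding cinner_calculus[OF u] by (simp add: cinner_op_adjoint[OF R])
      also have "cint (\<lambda>\<zeta>. u \<zeta> * cinner (resolvent z A (resolvent \<zeta> A x)) y)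
          = cint (\<lambda>\<zeta>. r * (u \<zeta> / (\<zeta> - z)) - k \<zeta> / (\<zeta> - z))"
      proof (rule cint_cong)
        fix \<zeta> assume \<zeta>: "\<zeta> \<in> frontier \<Omega>"
        then have ne: "\<zeta> - z \<noteq> 0" using z frontier_not_in_domain by auto
        have "r - cinner (resolvent \<zeta> A x) y = (\<zeta> - z) * cinner (resolvent z A (resolvent \<zeta> A x)) y"
          using resolvent_identity[OF clinear_A z(2) frontier_not_in_spectrum[OF \<zeta>], of x]
          by (simp add: r_def cinner_scaleC_left flip: cinner_diff_left)
        then have "cinner (resolvent z A (resolvent \<zeta> A x)) y = (r - cinner (resolvent \<zeta> A x) y) / (\<zeta> - z)"
          using ne by (simp add: eq_divide_eq mult.commute)
        then show "u \<zeta> * cinner (resolvent z A (resolvent \<zeta> A x)) y = r * (u \<zeta> / (\<zeta> - z)) - k \<zeta> / (\<zeta> - z)"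
          by (simp add: k_def right_diff_distrib diff_divide_distrib mult.commute)
      qed
      also have "\<dots> = r * cint (\<lambda>\<zeta>. u \<zeta> / (\<zeta> - z)) - cint (\<lambda>\<zeta>. k \<zeta> / (\<zeta> - z))"
        by (simp add: cint_diff cint_cmult continuous_on_mult continuous_on_const
            continuous_on_cauchy_kernel u k z(1) del: times_divide_eq_right)
      also have "1 / (2 * of_real pi * \<i>) * \<dots> = r * cauchy u z - cauchy k z"
        by (simp add: cauchy_def right_diff_distrib diff_divide_distrib)
      finally show ?thesis
        by (simp add: D_def blinfun.diff_right cinner_diff_left clinear_op_scaleC[OF R] cinner_scaleC_left
            c[OF z(1)] r_def mult.commute)
    qed
    define H where "H z = (if z \<in> \<Omega> then cauchy k z else cinner (resolvent z A D) y)" for z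
    have "H holomorphic_on \<Omega> \<union> - op_spectrum A"
    proof (rule holomorphic_on_Un[OF _ _ open_domain open_resolvent_set])
      show "H holomorphic_on \<Omega>"
        by (rule holomorphic_transform[OF holomorphic_cauchy[OF k]]) (simp add: H_def)
      show "H holomorphic_on - op_spectrum A"
        by (rule holomorphic_transform[OF holomorphic_cinner_resolvent[OF clinear_A, of D y]])
           (auto simp: H_def eq)
    qed
    moreover have "\<Omega> \<union> - op_spectrum A = UNIV"
      using spectrum_A by blast
    ultimately have hol: "H holomorphic_on UNIV" by simp
    obtain B where B: "\<And>z. z \<in> \<Omega> \<Longrightarrow> cmod z \<le> B"
      using bounded_domain unfolding bounded_iff by blast
    have "\<forall>\<^sub>F z in at_infinity. cmod (H z) \<le> norm D * norm y / (cmod z - norm A)"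
      unfolding eventually_at_infinity
    proof (intro exI allI impI)
      fix z assume "max B (norm A) + 1 \<le> cmod z"
      then have z: "z \<notin> \<Omega>" "norm A < cmod z" using B[of z] by auto
      have "cmod (H z) \<le> norm (resolvent z A D) * norm y"
        using z cmod_cinner_le by (simp add: H_def)
      also have "\<dots> \<le> norm D / (cmod z - norm A) * norm y"
        by (intro mult_right_mono norm_resolvent_le not_in_spectrum z) simp
      finally show "cmod (H z) \<le> norm D * norm y / (cmod z - norm A)" by simp
    qed
    moreover have "((\<lambda>z. norm D * norm y / (cmod z - norm A)) \<longlongrightarrow> 0) at_infinity"
    proof (rule tendsto_divide_0[OF tendsto_const])
      have "filterlim (\<lambda>z::complex. - norm A + norm z) at_top at_infinity"
        by (rule filterlim_tendsto_add_at_top[OF tendsto_const filterlim_norm_at_top])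
      then show "filterlim (\<lambda>z::complex. cmod z - norm A) at_infinity at_infinity"
        by (intro filterlim_at_top_imp_at_infinity) (simp add: add.commute)
    qed
    ultimately have "(H \<longlongrightarrow> 0) at_infinity"
      by (rule Lim_null_comparison)
    from Liouville_weak[OF hol this, of z] z show ?thesis
      by (simp add: H_def)
  qed
  obtain z where z: "z \<notin> \<Omega>"
    using bounded_domain not_bounded_UNIV by (metis UNIV_eq_I)
  have "resolvent z A D = 0"
    by (rule cinner_eqI) (simp add: zero[OF z])
  then have "D = 0"
    using resolvent_inverse(1)[OF not_in_spectrum[OF z], of D] by simp
  then show ?thesis
    by (simp add: D_def)
qed

lemma calculus_eq_if_cauchy_eq:
  assumes "continuous_on (frontier \<Omega>) u" "continuous_on (frontier \<Omega>) v"
    and "\<And>z. z \<in> \<Omega> \<Longrightarrow> cauchy u z = cauchy v z"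
  shows "calculus u = calculus v"
proof (rule blinfun_eqI)
  fix x
  have "calculus (\<lambda>\<zeta>. u \<zeta> - v \<zeta>) x = 0 *\<^sub>C x"
    by (rule calculus_const_cauchy) (simp_all add: assms continuous_on_diff cauchy_diff)
  then show "calculus u x = calculus v x"
    using calculus_diff[OF assms(1,2)] by simp
qed

text \<open>
  Since \<open>\<zeta> R(\<zeta>) = A R(\<zeta>) + I\<close> and the boundary integrals of \<open>p/d\<close> vanish, multiplying the
  symbol \<open>1/d\<close> by a polynomial \<open>p\<close> multiplies the operator by \<open>p(A)\<close>; the choice \<open>p = d\<close>
  identifies the operator with symbol \<open>1/d\<close> as the inverse of \<open>d(A)\<close>.
\<close>

lemma calculus_ratfun:
  assumes d: "\<And>z. z \<in> closure \<Omega> \<Longrightarrow> poly (ratfun_den r) z \<noteq> 0"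
  shows "calculus (ratfun_eval r) = ratfun_op r A"
proof (rule blinfun_eqI)
  fix x
  define d where "d = ratfun_den r"
  define U where "U p \<zeta> = poly p \<zeta> / poly d \<zeta>" for p \<zeta>
  have U: "continuous_on (frontier \<Omega>) (U p)" for p
    unfolding U_def d_def using d frontier_in_closure by (intro continuous_intros) auto
  have mult: "calculus (U p) x = poly_op p A (calculus (U 1) x)" for p
  proof (induction p)
    case 0
    have "cinner (calculus (U 0) x) y = 0" for y
      using cint_cmult[OF continuous_on_const, of 0 0] by (simp add: cinner_calculus U) (simp add: U_def)
    then have "calculus (U 0) x = 0"
      by (intro cinner_eqI[of _ 0]) simp
    then show ?case by simp
  next
    case (pCons a p)
    have "calculus (U (pCons a p)) x = a *\<^sub>C calculus (U 1) x + A (calculus (U p) x)"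
    proof (rule cinner_eqI)
      fix y
      define \<kappa> where "\<kappa> = 1 / (2 * of_real pi * \<i>)"
      define g where "g \<zeta> = cinner (resolvent \<zeta> A x) y" for \<zeta>
      have g: "continuous_on (frontier \<Omega>) g"
        unfolding g_def by (rule continuous_on_frontier_cinner)
      have "cinner (A (calculus (U p) x)) y = \<kappa> * cint (\<lambda>\<zeta>. U p \<zeta> * cinner (A (resolvent \<zeta> A x)) y)"
        unfolding cinner_op_adjoint[OF clinear_A] by (simp add: cinner_calculus[OF U] \<kappa>_def)
      also have "cint (\<lambda>\<zeta>. U p \<zeta> * cinner (A (resolvent \<zeta> A x)) y)
          = cint (\<lambda>\<zeta>. U (pCons 0 p) \<zeta> * g \<zeta> - cinner x y * U p \<zeta>)"
      proof (rule cint_cong)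
        fix \<zeta> assume "\<zeta> \<in> frontier \<Omega>"
        then have "A (resolvent \<zeta> A x) = \<zeta> *\<^sub>C resolvent \<zeta> A x - x"
          using resolvent_inverse(1)[OF frontier_not_in_spectrum, of \<zeta> x] by (simp add: algebra_simps)
        then have e: "cinner (A (resolvent \<zeta> A x)) y = \<zeta> * g \<zeta> - cinner x y"
          by (simp add: cinner_diff_left cinner_scaleC_left g_def)
        show "U p \<zeta> * cinner (A (resolvent \<zeta> A x)) y = U (pCons 0 p) \<zeta> * g \<zeta> - cinner x y * U p \<zeta>"
          unfolding e by (simp add: U_def algebra_simps)
      qed
      also have "\<dots> = cint (\<lambda>\<zeta>. U (pCons 0 p) \<zeta> * g \<zeta>) - cinner x y * cint (U p)"
        by (simp add: cint_diff cint_cmult U g continuous_on_mult continuous_on_const)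
      also have "cint (U p) = 0"
        unfolding U_def d_def by (rule cint_rational[OF d])
      finally have 1: "cinner (A (calculus (U p) x)) y = \<kappa> * cint (\<lambda>\<zeta>. U (pCons 0 p) \<zeta> * g \<zeta>)"
        by simp
      have "cinner (calculus (U (pCons a p)) x) y = \<kappa> * cint (\<lambda>\<zeta>. a * (U 1 \<zeta> * g \<zeta>) + U (pCons 0 p) \<zeta> * g \<zeta>)"
        unfolding cinner_calculus[OF U] \<kappa>_def g_def[symmetric]
        by (intro arg_cong2[where f = "(*)"] refl cint_cong)
           (simp add: U_def add_divide_distrib algebra_simps)
      also have "\<dots> = a * (\<kappa> * cint (\<lambda>\<zeta>. U 1 \<zeta> * g \<zeta>)) + \<kappa> * cint (\<lambda>\<zeta>. U (pCons 0 p) \<zeta> * g \<zeta>)"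
        by (simp add: cint_add cint_cmult U g continuous_on_mult continuous_on_const algebra_simps)
      also have "\<kappa> * cint (\<lambda>\<zeta>. U 1 \<zeta> * g \<zeta>) = cinner (calculus (U 1) x) y"
        by (simp add: cinner_calculus[OF U] \<kappa>_def g_def)
      finally show "cinner (calculus (U (pCons a p)) x) y
          = cinner (a *\<^sub>C calculus (U 1) x + A (calculus (U p) x)) y"
        by (simp add: 1 cinner_add_left cinner_scaleC_left)
    qed
    then show ?case
      by (simp add: pCons.IH poly_op_pCons[OF clinear_A])
  qed
  have "calculus (U d) = calculus (\<lambda>_. 1)"
    by (rule calculus_cong) (use d frontier_in_closure in \<open>simp add: U_def d_def\<close>)
  then have "calculus (U d) x = x"
    using calculus_const_cauchy[OF continuous_on_const cauchy_const, of 1 x] by simp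
  then have inv: "poly_op d A (calculus (U 1) x) = x"
    using mult[of d] by simp
  have "\<exists>S. is_op_inverse (poly_op d A) S"
    unfolding d_def
    by (rule poly_op_invertible[OF clinear_A])
       (use d spectrum_A closure_subset in auto)
  then obtain S where S: "is_op_inverse (poly_op d A) S" by blast
  have "calculus (U 1) x = S x"
    using is_op_inverse_apply(2)[OF S, of "calculus (U 1) x"] inv by simp
  moreover have "calculus (ratfun_eval r) = calculus (U (ratfun_num r))"
    by (simp add: ratfun_eval_def[abs_def] U_def[abs_def] d_def)
  ultimately show "calculus (ratfun_eval r) x = ratfun_op r A x"
    using mult[of "ratfun_num r"] by (simp add: ratfun_op_def op_inverse_eq[OF S] flip: d_def)
qed

text \<open>
  The two halves of \<open>\<mu>(\<sigma>, A)\<close> are adjoint to each other: the factor \<open>1/(2 \<pi> \<i>)\<close> is minus its own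
  conjugate, and the resolvent of \<open>A\<^sup>*\<close> at the conjugate point is the adjoint of the resolvent of \<open>A\<close>.
  Thus the integral of \<open>f\<close> against the second half is the adjoint of the operator with the symbol
  \<open>cnj f\<close>.
\<close>

lemma cinner_S_op:
  assumes f: "continuous_on (frontier \<Omega>) f"
  shows "cinner (S_op \<Omega> L \<sigma> f A x) y = cinner (calculus f x) y + cinner x (calculus (\<lambda>\<zeta>. cnj (f \<zeta>)) y)"
proof -
  define \<kappa> where "\<kappa> = 1 / (2 * complex_of_real pi * \<i>)"
  have \<kappa>: "cnj \<kappa> = - \<kappa>" by (simp add: \<kappa>_def)
  define R' where "R' \<zeta> = resolvent (cnj \<zeta>) (op_adjoint A)" for \<zeta>
  note bb = bounded_bilinear_scaleC_blinfun
  have R': "continuous_on (frontier \<Omega>) R'"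
    unfolding R'_def
    by (rule continuous_on_compose2[OF continuous_on_resolvent[OF clinear_op_adjoint[OF clinear_A]],
          of "- op_spectrum (op_adjoint A)"])
       (use op_spectrum_adjoint[OF clinear_A frontier_not_in_spectrum] in \<open>auto intro!: continuous_intros\<close>)
  have f1: "continuous_on (frontier \<Omega>) (\<lambda>\<zeta>. \<kappa> * f \<zeta>)" and f2: "continuous_on (frontier \<Omega>) (\<lambda>\<zeta>. - \<kappa> * f \<zeta>)"
    by (intro continuous_intros f)+
  have i1: "boundary_integrable (\<lambda>\<zeta> \<tau>. \<tau> *\<^sub>C ((\<kappa> * f \<zeta>) *\<^sub>C resolvent \<zeta> A))"
    by (rule boundary_integrable_bilinear(1)[OF bb bounded_bilinear.continuous_on[OF bb f1 continuous_on_frontier_resolvent]])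
  have i2: "boundary_integrable (\<lambda>\<zeta> \<tau>. cnj \<tau> *\<^sub>C ((- \<kappa> * f \<zeta>) *\<^sub>C R' \<zeta>))"
    by (rule boundary_integrable_bilinear(2)[OF bb bounded_bilinear.continuous_on[OF bb f2 R']])
  have "S_op \<Omega> L \<sigma> f A = bint (\<lambda>\<zeta> \<tau>. \<tau> *\<^sub>C ((\<kappa> * f \<zeta>) *\<^sub>C resolvent \<zeta> A) + cnj \<tau> *\<^sub>C ((- \<kappa> * f \<zeta>) *\<^sub>C R' \<zeta>))"
    unfolding S_op_def mu_op_def
    by (rule boundary_integral_cong, rule blinfun_eqI)
       (simp add: blinfun.add_left blinfun.diff_left scaleC_diff_right scaleC_scaleC mult_ac \<kappa>_def R'_def
         scaleC_minus_left scaleC_minus_right)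
  then have "S_op \<Omega> L \<sigma> f A = bint (\<lambda>\<zeta> \<tau>. \<tau> *\<^sub>C ((\<kappa> * f \<zeta>) *\<^sub>C resolvent \<zeta> A)) + bint (\<lambda>\<zeta> \<tau>. cnj \<tau> *\<^sub>C ((- \<kappa> * f \<zeta>) *\<^sub>C R' \<zeta>))"
    by (simp only: boundary_integral_add(1)[OF i1 i2])
  then have "cinner (S_op \<Omega> L \<sigma> f A x) y = bint (\<lambda>\<zeta> \<tau>. \<tau> * (\<kappa> * f \<zeta> * cinner (resolvent \<zeta> A x) y))
      + bint (\<lambda>\<zeta> \<tau>. cnj \<tau> * (- \<kappa> * f \<zeta> * cinner (R' \<zeta> x) y))"
    using boundary_integral_linear(1)[OF bounded_linear_cinner_apply i1, of x y]
      boundary_integral_linear(1)[OF bounded_linear_cinner_apply i2, of x y]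
    by (simp add: blinfun.add_left cinner_add_left cinner_scaleC_left)
  moreover have "bint (\<lambda>\<zeta> \<tau>. \<tau> * (\<kappa> * f \<zeta> * cinner (resolvent \<zeta> A x) y)) = cinner (calculus f x) y"
    using cint_cmult[OF continuous_on_mult[OF f continuous_on_frontier_cinner[of x y]], of \<kappa>]
    by (simp add: cinner_calculus[OF f] \<kappa>_def cint_def mult_ac)
  moreover have "bint (\<lambda>\<zeta> \<tau>. cnj \<tau> * (- \<kappa> * f \<zeta> * cinner (R' \<zeta> x) y)) = cinner x (calculus (\<lambda>\<zeta>. cnj (f \<zeta>)) y)"
  proof -
    have cf: "continuous_on (frontier \<Omega>) (\<lambda>\<zeta>. cnj (f \<zeta>))"
      by (intro continuous_intros f)
    have cont: "continuous_on (frontier \<Omega>) (\<lambda>\<zeta>. cnj (f \<zeta>) * cinner (resolvent \<zeta> A y) x)"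
      by (intro continuous_on_mult cf continuous_on_frontier_cinner)
    have "cinner x (calculus (\<lambda>\<zeta>. cnj (f \<zeta>)) y) = cnj (\<kappa> * cint (\<lambda>\<zeta>. cnj (f \<zeta>) * cinner (resolvent \<zeta> A y) x))"
      by (subst cinner_commute) (simp add: cinner_calculus[OF cf] \<kappa>_def)
    also have "\<dots> = cnj (cint (\<lambda>\<zeta>. \<kappa> * (cnj (f \<zeta>) * cinner (resolvent \<zeta> A y) x)))"
      by (simp only: cint_cmult[OF cont])
    also have "\<dots> = bint (\<lambda>\<zeta> \<tau>. cnj (\<kappa> * (cnj (f \<zeta>) * cinner (resolvent \<zeta> A y) x) * \<tau>))"
      unfolding cint_def
      by (rule boundary_integral_linear(1)[OF bounded_linear_cnj boundary_integrable_mult, symmetric])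
         (intro continuous_on_mult continuous_on_const cont)
    also have "\<dots> = bint (\<lambda>\<zeta> \<tau>. cnj \<tau> * (- \<kappa> * f \<zeta> * cinner (R' \<zeta> x) y))"
    proof (rule boundary_integral_cong)
      fix \<zeta> \<tau> assume "\<zeta> \<in> frontier \<Omega>"
      then have "cinner (R' \<zeta> x) y = cnj (cinner (resolvent \<zeta> A y) x)"
        unfolding R'_def
        by (subst resolvent_op_adjoint[OF clinear_A frontier_not_in_spectrum]) (auto intro: cinner_commute)
      then show "cnj (\<kappa> * (cnj (f \<zeta>) * cinner (resolvent \<zeta> A y) x) * \<tau>) = cnj \<tau> * (- \<kappa> * f \<zeta> * cinner (R' \<zeta> x) y)"
        by (simp add: \<kappa> mult_ac)
    qed
    finally show ?thesis by simp
  qed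
  ultimately show ?thesis by simp
qed

end

section \<open>Cauchy transforms of Lipschitz functions up to the boundary\<close>

context rectifiable_domain
begin

text \<open>
  Subtracting the value at \<open>z\<close> removes the singularity of the Cauchy kernel, so this formula makes
  sense on the closure. At a boundary point the integrand takes the harmless value \<open>0\<close>
  whenever the curve passes through \<open>z\<close>.
\<close>

definition cauchy_closure :: "(complex \<Rightarrow> complex) \<Rightarrow> complex \<Rightarrow> complex"
  where "cauchy_closure f z =
    f z + 1 / (2 * of_real pi * \<i>) * bint (\<lambda>\<zeta> \<tau>. (f \<zeta> - f z) / (\<zeta> - z) * \<tau>)"

lemma cauchy_closure_eq:
  assumes f: "continuous_on (frontier \<Omega>) f" and z: "z \<in> \<Omega>"
  shows "cauchy_closure f z = cauchy f z"
proof -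
  have "cauchy f z - f z = cauchy (\<lambda>\<zeta>. f \<zeta> - f z) z"
    using cauchy_diff[OF f continuous_on_const z, of "f z"] by (simp add: cauchy_const[OF z])
  also have "\<dots> = 1 / (2 * of_real pi * \<i>) * bint (\<lambda>\<zeta> \<tau>. (f \<zeta> - f z) / (\<zeta> - z) * \<tau>)"
    by (simp add: cauchy_def cint_def)
  finally show ?thesis
    by (simp add: cauchy_closure_def algebra_simps)
qed

context
  fixes f :: "complex \<Rightarrow> complex" and B :: real
  assumes B: "0 \<le> B"
    and lip: "\<And>x y. x \<in> closure \<Omega> \<Longrightarrow> y \<in> closure \<Omega> \<Longrightarrow> cmod (f x - f y) \<le> B * cmod (x - y)"
begin

lemma continuous_on_lipschitz: "continuous_on (closure \<Omega>) f"
proof (rule continuous_onI)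
  fix x e :: real assume "0 < e"
  fix x :: complex assume x: "x \<in> closure \<Omega>"
  have "dist (f y) (f x) \<le> e" if "y \<in> closure \<Omega>" "dist y x < e / (B + 1)" for y
  proof -
    have "dist (f y) (f x) \<le> B * dist y x"
      using lip[OF that(1) x] by (simp add: dist_norm)
    also have "\<dots> \<le> (B + 1) * (e / (B + 1))"
      using that B by (intro mult_mono) auto
    finally show ?thesis using B by simp
  qed
  then show "\<exists>d>0. \<forall>y\<in>closure \<Omega>. dist y x < d \<longrightarrow> dist (f y) (f x) \<le> e"
    using \<open>0 < e\<close> B by (intro exI[of _ "e / (B + 1)"]) auto
qed

text \<open>
  The quotients are bounded by the Lipschitz constant of \<open>f\<close>. They converge wherever the curve avoids
  the limit point \<open>z\<close>; the curve meets \<open>z\<close> with a nonzero tangent only on a null set, and where the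
  tangent vanishes all integrands are zero.
\<close>

lemma kernel_limit:
  assumes C: "C \<in> components (frontier \<Omega>)"
    and w: "w \<longlonglongrightarrow> z" "\<And>n. w n \<in> closure \<Omega>" and z: "z \<in> closure \<Omega>"
    and int: "\<And>n. (\<lambda>s. (f (\<sigma> C s) - f (w n)) / (\<sigma> C s - w n) * tangent (\<sigma> C) (L C) s) integrable_on {0..L C}"
  shows "(\<lambda>s. (f (\<sigma> C s) - f z) / (\<sigma> C s - z) * tangent (\<sigma> C) (L C) s) integrable_on {0..L C}" (is ?int)
    and "(\<lambda>n. integral {0..L C} (\<lambda>s. (f (\<sigma> C s) - f (w n)) / (\<sigma> C s - w n) * tangent (\<sigma> C) (L C) s))
      \<longlonglongrightarrow> integral {0..L C} (\<lambda>s. (f (\<sigma> C s) - f z) / (\<sigma> C s - z) * tangent (\<sigma> C) (L C) s)" (is ?lim)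
proof -
  define K where "K v s = (f (\<sigma> C s) - f v) / (\<sigma> C s - v) * tangent (\<sigma> C) (L C) s" for v s
  define E where "E = {s\<in>{0..L C}. \<sigma> C s = z \<and> tangent (\<sigma> C) (L C) s \<noteq> 0}"
  have E: "negligible E"
    unfolding E_def by (rule negligible_fibre)
  have bound: "cmod (if s \<in> E then 0 else K v s) \<le> B" if "s \<in> {0..L C}" "v \<in> closure \<Omega>" for s v
  proof -
    have "cmod (f (\<sigma> C s) - f v) \<le> B * cmod (\<sigma> C s - v)"
      by (intro lip that frontier_in_closure arc_in_frontier[OF C])
    then have "cmod ((f (\<sigma> C s) - f v) / (\<sigma> C s - v)) \<le> B"
      using B by (cases "\<sigma> C s = v") (simp_all add: norm_divide divide_le_eq)
    then have "cmod (K v s) \<le> B * 1"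
      unfolding K_def norm_mult using norm_tangent_le[OF arc_component(2)[OF C]] B
      by (intro mult_mono) auto
    then show ?thesis using B by simp
  qed
  have lim: "(\<lambda>n. if s \<in> E then 0 else K (w n) s) \<longlonglongrightarrow> (if s \<in> E then 0 else K z s)" if s: "s \<in> {0..L C}" for s
  proof (cases "s \<in> E \<or> tangent (\<sigma> C) (L C) s = 0")
    case False
    then have "\<sigma> C s - z \<noteq> 0" using s by (auto simp: E_def)
    moreover have "(\<lambda>n. f (w n)) \<longlonglongrightarrow> f z"
      using continuous_on_lipschitz w z unfolding continuous_on_sequentially by (auto simp: o_def)
    ultimately have "(\<lambda>n. K (w n) s) \<longlonglongrightarrow> K z s"
      unfolding K_def using w(1) by (intro tendsto_mult tendsto_divide tendsto_diff tendsto_const)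
    then show ?thesis using False by simp
  qed (auto simp: K_def)
  have int': "(\<lambda>s. if s \<in> E then 0 else K (w n) s) integrable_on {0..L C}" for n
    by (rule integrable_spike[OF int[of n] E]) (simp add: K_def)
  have DC: "(\<lambda>s. if s \<in> E then 0 else K z s) integrable_on {0..L C}"
    "(\<lambda>n. integral {0..L C} (\<lambda>s. if s \<in> E then 0 else K (w n) s))
      \<longlonglongrightarrow> integral {0..L C} (\<lambda>s. if s \<in> E then 0 else K z s)"
    by (rule dominated_convergence[OF int' integrable_const_ivl[of B]],
        rule bound[OF _ w(2)], assumption, rule lim, assumption)+
  have off: "(if s \<in> E then 0 else K v s) = K v s" if "s \<in> {0..L C} - E" for v s
    using that by auto
  have "K z integrable_on {0..L C}"
    by (rule integrable_spike[OF DC(1) E]) (rule off[symmetric])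
  then show ?int
    unfolding K_def .
  have "integral {0..L C} (K v) = integral {0..L C} (\<lambda>s. if s \<in> E then 0 else K v s)" for v
    by (rule integral_spike[OF E]) (rule off)
  note this[symmetric]
  from DC(2)[unfolded this] show ?lim
    unfolding K_def .
qed

text \<open>
  For \<open>z\<close> on the boundary the integrand need not be continuous off a null set, and integrability is
  inherited from the limit of the integrands for interior points.
\<close>

lemma kernel_integrable:
  assumes C: "C \<in> components (frontier \<Omega>)" and z: "z \<in> closure \<Omega>"
  shows "(\<lambda>s. (f (\<sigma> C s) - f z) / (\<sigma> C s - z) * tangent (\<sigma> C) (L C) s) integrable_on {0..L C}"
proof -
  obtain w where w: "\<And>n. w n \<in> \<Omega>" "w \<longlonglongrightarrow> z"
    using z unfolding closure_sequential by blast
  have "(\<lambda>s. (f (\<sigma> C s) - f (w n)) / (\<sigma> C s - w n) * tangent (\<sigma> C) (L C) s) integrable_on {0..L C}" for n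
  proof -
    have "continuous_on (frontier \<Omega>) f"
      by (rule continuous_on_subset[OF continuous_on_lipschitz]) (use frontier_in_closure in blast)
    then have "continuous_on (frontier \<Omega>) (\<lambda>\<zeta>. (f \<zeta> - f (w n)) / (\<zeta> - w n))"
      by (intro continuous_on_cauchy_kernel continuous_on_diff continuous_on_const w)
    from boundary_integrable_mult[OF this] C show ?thesis
      by (simp add: boundary_integrable_def)
  qed
  moreover have "w n \<in> closure \<Omega>" for n
    using w(1) closure_subset by blast
  ultimately show ?thesis
    using kernel_limit(1)[OF C w(2) _ z] by blast
qed

lemma continuous_on_cauchy_closure: "continuous_on (closure \<Omega>) (cauchy_closure f)"
  unfolding continuous_on_sequentially
proof (intro allI ballI impI)
  fix w z assume "z \<in> closure \<Omega>" "(\<forall>n. w n \<in> closure \<Omega>) \<and> w \<longlonglongrightarrow> z"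
  then have z: "z \<in> closure \<Omega>" and w: "\<And>n. w n \<in> closure \<Omega>" "w \<longlonglongrightarrow> z" by auto
  have "(\<lambda>n. bint (\<lambda>\<zeta> \<tau>. (f \<zeta> - f (w n)) / (\<zeta> - w n) * \<tau>)) \<longlonglongrightarrow> bint (\<lambda>\<zeta> \<tau>. (f \<zeta> - f z) / (\<zeta> - z) * \<tau>)"
    unfolding boundary_integral_tangent
    by (intro tendsto_sum kernel_limit(2) w z kernel_integrable)
  moreover have "(\<lambda>n. f (w n)) \<longlonglongrightarrow> f z"
    using continuous_on_lipschitz w z unfolding continuous_on_sequentially by (auto simp: o_def)
  ultimately show "(cauchy_closure f \<circ> w) \<longlonglongrightarrow> cauchy_closure f z"
    unfolding cauchy_closure_def[abs_def] o_def by (intro tendsto_add tendsto_mult tendsto_const)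
qed

lemma continuous_extension_cauchy:
  assumes z: "z \<in> closure \<Omega>"
  shows "continuous_extension \<Omega> (cauchy f) z = cauchy_closure f z"
proof (cases "z \<in> \<Omega>")
  case True
  have "continuous_on (frontier \<Omega>) f"
    by (rule continuous_on_subset[OF continuous_on_lipschitz]) (use frontier_in_closure in blast)
  with True show ?thesis
    by (simp add: continuous_extension_def cauchy_closure_eq)
next
  case False
  have f: "continuous_on (frontier \<Omega>) f"
    by (rule continuous_on_subset[OF continuous_on_lipschitz]) (use frontier_in_closure in blast)
  have "(cauchy_closure f \<longlongrightarrow> cauchy_closure f z) (at z within closure \<Omega>)"
    using continuous_on_cauchy_closure z by (simp add: continuous_on_def)
  then have "(cauchy_closure f \<longlongrightarrow> cauchy_closure f z) (at z within \<Omega>)"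
    by (rule tendsto_within_subset[OF _ closure_subset])
  moreover have "\<forall>\<^sub>F w in at z within \<Omega>. cauchy_closure f w = cauchy f w"
    unfolding eventually_at_filter by (rule always_eventually) (simp add: cauchy_closure_eq[OF f])
  ultimately have "(cauchy f \<longlongrightarrow> cauchy_closure f z) (at z within \<Omega>)"
    by (rule Lim_transform_eventually)
  moreover have "\<not> trivial_limit (at z within \<Omega>)"
    using False z by (simp add: trivial_limit_within closure_def)
  ultimately have "Lim (at z within \<Omega>) (cauchy f) = cauchy_closure f z"
    by (intro tendsto_Lim)
  with False show ?thesis
    by (simp add: continuous_extension_def)
qed

end

lemma cauchy_bounded:
  assumes z: "z \<in> \<Omega>"
  shows "\<exists>K\<ge>0. \<forall>u M. continuous_on (frontier \<Omega>) u \<longrightarrow> (\<forall>\<zeta>\<in>frontier \<Omega>. cmod (u \<zeta>) \<le> M) \<longrightarrow> 0 \<le> M \<longrightarrow>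
     norm (cauchy u z) \<le> K * M"
proof -
  have c: "continuous_on (frontier \<Omega>) (\<lambda>\<zeta>. 1 / (\<zeta> - z))"
    by (intro continuous_on_cauchy_kernel continuous_on_const z)
  have "bounded ((\<lambda>\<zeta>. 1 / (\<zeta> - z)) ` frontier \<Omega>)"
    by (rule compact_imp_bounded[OF compact_continuous_image[OF c compact_frontier_domain]])
  then obtain R where R: "R > 0" "\<And>\<zeta>. \<zeta> \<in> frontier \<Omega> \<Longrightarrow> cmod (1 / (\<zeta> - z)) \<le> R"
    unfolding bounded_pos by blast
  define K where "K = R * len / (2 * pi)"
  have "norm (cauchy u z) \<le> K * M"
    if u: "continuous_on (frontier \<Omega>) u" "\<forall>\<zeta>\<in>frontier \<Omega>. cmod (u \<zeta>) \<le> M" "0 \<le> M" for u M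
  proof -
    have "cmod (cint (\<lambda>\<zeta>. u \<zeta> / (\<zeta> - z))) \<le> (M * R) * len"
    proof (rule cint_bound[OF continuous_on_cauchy_kernel[OF u(1) z]])
      fix \<zeta> assume \<zeta>: "\<zeta> \<in> frontier \<Omega>"
      have "cmod (u \<zeta>) * cmod (1 / (\<zeta> - z)) \<le> M * R"
        using u(2,3) R(2) \<zeta> by (intro mult_mono) auto
      then show "cmod (u \<zeta> / (\<zeta> - z)) \<le> M * R"
        by (simp add: norm_divide)
    qed (use u R in simp)
    then show ?thesis
      by (simp add: cauchy_def norm_mult norm_divide K_def divide_le_eq mult_ac)
  qed
  moreover have "0 \<le> K" using R len_nonneg by (simp add: K_def)
  ultimately show ?thesis by blast
qed

text \<open>A linear map that is bounded by the maximum of the symbol on the boundary respects uniform limits.\<close>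

lemma tendsto_of_uniform_limit:
  fixes T :: "(complex \<Rightarrow> complex) \<Rightarrow> 'b::real_normed_vector"
  assumes bounded: "\<exists>K\<ge>0. \<forall>u M. continuous_on (frontier \<Omega>) u \<longrightarrow> (\<forall>\<zeta>\<in>frontier \<Omega>. cmod (u \<zeta>) \<le> M) \<longrightarrow> 0 \<le> M \<longrightarrow>
      norm (T u) \<le> K * M"
    and diff: "\<And>u v. continuous_on (frontier \<Omega>) u \<Longrightarrow> continuous_on (frontier \<Omega>) v \<Longrightarrow>
      T (\<lambda>\<zeta>. u \<zeta> - v \<zeta>) = T u - T v"
    and h: "\<And>n. continuous_on (frontier \<Omega>) (h n)" and g: "continuous_on (frontier \<Omega>) g"
    and lim: "uniform_limit (frontier \<Omega>) h g sequentially"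
  shows "(\<lambda>n. T (h n)) \<longlonglongrightarrow> T g"
proof -
  obtain K where K: "K \<ge> 0" "\<And>u M. continuous_on (frontier \<Omega>) u \<Longrightarrow> (\<forall>\<zeta>\<in>frontier \<Omega>. cmod (u \<zeta>) \<le> M) \<Longrightarrow> 0 \<le> M \<Longrightarrow>
      norm (T u) \<le> K * M"
    using bounded by blast
  show ?thesis
  proof (rule tendstoI)
    fix e :: real assume e: "0 < e"
    define e' where "e' = e / (K + 1)"
    have e': "0 < e'" using e K by (simp add: e'_def)
    have "K * e' < (K + 1) * e'" using e' by simp
    also have "(K + 1) * e' = e" using K by (simp add: e'_def)
    finally have lt: "K * e' < e" .
    have "\<forall>\<^sub>F n in sequentially. \<forall>\<zeta>\<in>frontier \<Omega>. dist (h n \<zeta>) (g \<zeta>) < e'"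
      using lim e' by (rule uniform_limitD)
    then show "\<forall>\<^sub>F n in sequentially. dist (T (h n)) (T g) < e"
    proof eventually_elim
      case (elim n)
      have "norm (T (\<lambda>\<zeta>. h n \<zeta> - g \<zeta>)) \<le> K * e'"
        using elim e' by (intro K continuous_on_diff h g) (auto simp: dist_norm less_imp_le)
      then show ?case
        using lt by (simp add: dist_norm diff[OF h g])
    qed
  qed
qed

end

section \<open>The spectral constant\<close>

lemma unit_ratfuns_closure:
  assumes "r \<in> unit_ratfuns \<Omega>" "z \<in> closure \<Omega>"
  shows "poly (ratfun_den r) z \<noteq> 0" "cmod (ratfun_eval r z) \<le> 1"
  using ratfun_den_closure[of \<Omega> r 1 z] assms by (auto simp: unit_ratfuns_def)

lemma bounded_ratfuns_closure:
  assumes "r \<in> bounded_ratfuns \<Omega>" "z \<in> closure \<Omega>"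
  shows "poly (ratfun_den r) z \<noteq> 0"
proof -
  obtain M where "\<And>z. z \<in> \<Omega> \<Longrightarrow> cmod (ratfun_eval r z) \<le> M"
    using assms(1) by (auto simp: bounded_ratfuns_def bounded_iff)
  then show ?thesis
    using ratfun_den_closure(1)[of \<Omega> r M z] assms by (auto simp: bounded_ratfuns_def)
qed

lemma zero_in_unit_ratfuns: "0 \<in> unit_ratfuns \<Omega>"
  by (simp add: unit_ratfuns_def ratfun_den_def ratfun_eval_def ratfun_num_def)

lemma ratfun_const:
  "poly (ratfun_den (Fract [:c:] 1)) z \<noteq> 0" "ratfun_eval (Fract [:c:] 1) z = c"
  using ratfun_Fract[of 1 z "[:c:]"] by simp_all

lemma ratfun_op_const:
  fixes A :: "'a::complex_hilbert_space \<Rightarrow>\<^sub>L 'a"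
  assumes "clinear_op A"
  shows "ratfun_op (Fract [:c:] 1) A x = c *\<^sub>C x"
proof -
  have "is_op_inverse (poly_op 1 A) id_blinfun"
    unfolding one_pCons by (rule is_op_inverseI) (simp_all add: poly_op_pCons[OF assms])
  then show ?thesis
    using ratfun_op_Fract[OF assms, of 1 id_blinfun "[:c:]"] by (simp add: poly_op_pCons[OF assms])
qed

context spectral_domain
begin

lemma ratfun_op_mult_closure:
  assumes "\<And>z. z \<in> closure \<Omega> \<Longrightarrow> poly (ratfun_den r) z \<noteq> 0" "\<And>z. z \<in> closure \<Omega> \<Longrightarrow> poly (ratfun_den s) z \<noteq> 0"
  shows "ratfun_op (r * s) A x = ratfun_op r A (ratfun_op s A x)"
  by (rule ratfun_op_mult[OF clinear_A]) (use assms spectrum_A closure_subset[of \<Omega>] in blast)+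

text \<open>
  Scalars are the operators of constant rational functions, so linearity is an instance of
  commutativity of the functional calculus.
\<close>

lemma clinear_op_ratfun_op:
  assumes "\<And>z. z \<in> closure \<Omega> \<Longrightarrow> poly (ratfun_den r) z \<noteq> 0"
  shows "clinear_op (ratfun_op r A)"
  unfolding clinear_op_def
proof (intro allI)
  fix c x
  let ?c = "Fract [:c:] 1 :: ratfun"
  have "ratfun_op r A (ratfun_op ?c A x) = ratfun_op ?c A (ratfun_op r A x)"
    by (simp add: ratfun_const(1) assms mult.commute flip: ratfun_op_mult_closure)
  then show "ratfun_op r A (c *\<^sub>C x) = c *\<^sub>C ratfun_op r A x"
    by (simp add: ratfun_op_const[OF clinear_A])
qed

lemma continuous_on_frontier_ratfun:
  assumes "\<And>z. z \<in> closure \<Omega> \<Longrightarrow> poly (ratfun_den r) z \<noteq> 0"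
  shows "continuous_on (frontier \<Omega>) (ratfun_eval r)"
  by (rule continuous_on_ratfun_eval) (use assms frontier_in_closure in blast)

text \<open>
  Finiteness of this supremum, which the extremal argument needs at the outset, comes from the
  crude bound by the length of the boundary and the maximum of the resolvent.
\<close>

definition norm_sup :: real
  where "norm_sup = (SUP r\<in>unit_ratfuns \<Omega>. norm (ratfun_op r A))"

lemma norm_calculus_unit:
  "\<exists>K\<ge>0. \<forall>r\<in>unit_ratfuns \<Omega>. norm (ratfun_op r A) \<le> K \<and> norm (calculus (\<lambda>\<zeta>. cnj (ratfun_eval r \<zeta>))) \<le> K"
proof -
  obtain K where K: "K \<ge> 0" "\<And>u M. continuous_on (frontier \<Omega>) u \<Longrightarrow> (\<forall>\<zeta>\<in>frontier \<Omega>. cmod (u \<zeta>) \<le> M) \<Longrightarrow> 0 \<le> M \<Longrightarrow>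
      norm (calculus u) \<le> K * M"
    using calculus_bounded by blast
  have "norm (ratfun_op r A) \<le> K \<and> norm (calculus (\<lambda>\<zeta>. cnj (ratfun_eval r \<zeta>))) \<le> K"
    if r: "r \<in> unit_ratfuns \<Omega>" for r
  proof -
    have den: "\<And>z. z \<in> closure \<Omega> \<Longrightarrow> poly (ratfun_den r) z \<noteq> 0"
      by (rule unit_ratfuns_closure[OF r])
    have c: "continuous_on (frontier \<Omega>) (ratfun_eval r)"
      by (rule continuous_on_frontier_ratfun[OF den])
    have le: "cmod (ratfun_eval r \<zeta>) \<le> 1" if "\<zeta> \<in> frontier \<Omega>" for \<zeta>
      by (rule unit_ratfuns_closure[OF r frontier_in_closure[OF that]])
    show ?thesis
      using K(2)[OF c, of 1] K(2)[OF continuous_on_cnj[OF c], of 1] le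
      by (simp add: calculus_ratfun[OF den])
  qed
  with K(1) show ?thesis by blast
qed

lemma norm_le_norm_sup:
  assumes "r \<in> unit_ratfuns \<Omega>"
  shows "norm (ratfun_op r A) \<le> norm_sup"
proof -
  obtain K where "\<forall>r\<in>unit_ratfuns \<Omega>. norm (ratfun_op r A) \<le> K"
    using norm_calculus_unit by blast
  then show ?thesis
    unfolding norm_sup_def using assms by (intro cSUP_upper bdd_aboveI2[of _ _ K]) auto
qed

lemma norm_sup_nonneg: "0 \<le> norm_sup"
  using norm_le_norm_sup[OF zero_in_unit_ratfuns] norm_ge_zero order_trans by blast

text \<open>
  Scaling to the unit ball. For \<open>M = 0\<close> it is replaced by a limit where the lemma is applied.
\<close>

lemma norm_ratfun_op_le:
  assumes den: "\<And>z. z \<in> closure \<Omega> \<Longrightarrow> poly (ratfun_den r) z \<noteq> 0"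
    and M: "\<And>z. z \<in> closure \<Omega> \<Longrightarrow> cmod (ratfun_eval r z) \<le> M" "0 < M"
  shows "norm (ratfun_op r A) \<le> norm_sup * M"
proof -
  let ?c = "Fract [:complex_of_real M:] 1 :: ratfun" and ?d = "Fract [:complex_of_real (1 / M):] 1 :: ratfun"
  have "?d * r \<in> unit_ratfuns \<Omega>"
    unfolding unit_ratfuns_def
  proof (safe)
    fix z assume "z \<in> \<Omega>"
    then have z: "z \<in> closure \<Omega>" using closure_subset by blast
    show "poly (ratfun_den (?d * r)) z = 0 \<Longrightarrow> False"
      using ratfun_mult(1)[OF ratfun_const(1) den[OF z]] by blast
    show "cmod (ratfun_eval (?d * r) z) \<le> 1"
      unfolding ratfun_mult(2)[OF ratfun_const(1) den[OF z]] ratfun_const(2)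
      using M(1)[OF z] M(2) by (simp add: norm_mult norm_divide)
  qed
  then have le: "norm (ratfun_op (?d * r) A) \<le> norm_sup"
    by (rule norm_le_norm_sup)
  have "ratfun_op r A = M *\<^sub>R ratfun_op (?d * r) A"
    using M(2)
    by (intro blinfun_eqI)
       (simp add: blinfun.scaleR_left ratfun_op_mult_closure ratfun_const(1) den
          ratfun_op_const[OF clinear_A] scaleR_eq_scaleC scaleC_scaleC)
  then show ?thesis
    using le M(2) by (simp add: mult.commute)
qed

text \<open>
  The Cauchy transform \<open>g\<close> of the conjugate of \<open>f\<close> is a uniform limit on the closure of rational
  functions \<open>h\<^sub>n\<close>, by the hypothesis on \<open>\<Omega>\<close>, and the operators \<open>h\<^sub>n(A)\<close> converge to the operator with
  the symbol \<open>cnj f\<close> because both symbols have the same Cauchy transform. Hence products with \<open>g(A)\<close>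
  obey the same bounds as those with rational functions.
\<close>

lemma norm_product_le:
  assumes alg: "{f. f holomorphic_on \<Omega> \<and> continuous_on (closure \<Omega>) f} \<subseteq>
      {f. \<exists>r. (\<forall>n. r n \<in> bounded_ratfuns \<Omega>) \<and> uniform_limit (closure \<Omega>) (\<lambda>n. ratfun_eval (r n)) f sequentially}"
    and r: "r \<in> unit_ratfuns \<Omega>"
    and c1: "\<And>z. z \<in> closure \<Omega> \<Longrightarrow>
      cmod (continuous_extension \<Omega> (conj_cauchy \<Omega> L \<sigma> (ratfun_eval r)) z) \<le> c1" and "0 \<le> c1"
  shows "norm (ratfun_op r A o\<^sub>L calculus (\<lambda>\<zeta>. cnj (ratfun_eval r \<zeta>)) o\<^sub>L ratfun_op r A) \<le> norm_sup * c1"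
proof -
  define F where "F = ratfun_op r A"
  define f where "f \<zeta> = cnj (ratfun_eval r \<zeta>)" for \<zeta>
  define g where "g = cauchy_closure f"
  note den = unit_ratfuns_closure(1)[OF r]
  have "compact (closure \<Omega>)" using bounded_domain by (simp add: compact_closure)
  from ratfun_lipschitz_on_compact[OF this den]
  obtain B where "B \<ge> 0" "\<And>x y. x \<in> closure \<Omega> \<Longrightarrow> y \<in> closure \<Omega> \<Longrightarrow> cmod (f x - f y) \<le> B * cmod (x - y)"
    by (auto simp: f_def simp flip: complex_cnj_diff)
  note lip = this
  have f: "continuous_on (frontier \<Omega>) f"
    unfolding f_def by (rule continuous_on_cnj[OF continuous_on_frontier_ratfun[OF den]])
  have g_cont: "continuous_on (closure \<Omega>) g"
    unfolding g_def by (rule continuous_on_cauchy_closure[OF lip])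
  have g_front: "continuous_on (frontier \<Omega>) g"
    by (rule continuous_on_subset[OF g_cont]) (use frontier_in_closure in blast)
  have g_eq: "g z = cauchy f z" if "z \<in> \<Omega>" for z
    unfolding g_def by (rule cauchy_closure_eq[OF f that])
  have g_hol: "g holomorphic_on \<Omega>"
    by (rule holomorphic_transform[OF holomorphic_cauchy[OF f]]) (simp add: g_eq)
  have g_le: "cmod (g z) \<le> c1" if "z \<in> closure \<Omega>" for z
    using c1[OF that] continuous_extension_cauchy[OF lip that]
    by (simp add: g_def f_def[abs_def] conj_cauchy_eq[abs_def])
  obtain h where h: "\<And>n. h n \<in> bounded_ratfuns \<Omega>"
    and lim: "uniform_limit (closure \<Omega>) (\<lambda>n. ratfun_eval (h n)) g sequentially"
    using alg g_cont g_hol by blast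
  note h_den = bounded_ratfuns_closure[OF h]
  have h_cont: "continuous_on (frontier \<Omega>) (ratfun_eval (h n))" for n
    by (rule continuous_on_frontier_ratfun[OF h_den])
  have lim_front: "uniform_limit (frontier \<Omega>) (\<lambda>n. ratfun_eval (h n)) g sequentially"
    by (rule uniform_limit_on_subset[OF lim]) (use frontier_in_closure in blast)
  have "cauchy g z = cauchy f z" if z: "z \<in> \<Omega>" for z
  proof -
    have "(\<lambda>n. cauchy (ratfun_eval (h n)) z) \<longlonglongrightarrow> cauchy g z"
      by (rule tendsto_of_uniform_limit[OF cauchy_bounded[OF z] _ h_cont g_front lim_front])
         (rule cauchy_diff[OF _ _ z])
    moreover have "cauchy (ratfun_eval (h n)) z = ratfun_eval (h n) z" for n
      unfolding ratfun_eval_def using cauchy_rational[OF h_den z] by simp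
    moreover have "(\<lambda>n. ratfun_eval (h n) z) \<longlonglongrightarrow> g z"
      using tendsto_uniform_limitI[OF lim] z closure_subset by blast
    ultimately show ?thesis
      using LIMSEQ_unique g_eq[OF z] by simp
  qed
  then have "calculus g = calculus f"
    by (rule calculus_eq_if_cauchy_eq[OF g_front f])
  moreover have "(\<lambda>n. calculus (ratfun_eval (h n))) \<longlonglongrightarrow> calculus g"
    by (rule tendsto_of_uniform_limit[OF calculus_bounded _ h_cont g_front lim_front])
       (intro blinfun_eqI, simp add: calculus_diff blinfun.diff_left)
  ultimately have conv: "(\<lambda>n. ratfun_op (h n) A) \<longlonglongrightarrow> calculus f"
    by (simp add: calculus_ratfun[OF h_den])
  have le: "norm (F o\<^sub>L calculus f o\<^sub>L F) \<le> norm_sup * (c1 + e)" if e: "0 < e" for e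
  proof (rule Lim_norm_ubound)
    show "(\<lambda>n. F o\<^sub>L ratfun_op (h n) A o\<^sub>L F) \<longlonglongrightarrow> (F o\<^sub>L calculus f o\<^sub>L F)"
      by (intro bounded_bilinear.tendsto[OF bounded_bilinear_blinfun_compose] tendsto_const conv)
    have "\<forall>\<^sub>F n in sequentially. \<forall>z\<in>closure \<Omega>. dist (ratfun_eval (h n) z) (g z) < e"
      using lim e by (rule uniform_limitD)
    then show "\<forall>\<^sub>F n in sequentially. norm (F o\<^sub>L ratfun_op (h n) A o\<^sub>L F) \<le> norm_sup * (c1 + e)"
    proof eventually_elim
      case (elim n)
      have den2: "poly (ratfun_den (h n * r)) z \<noteq> 0" if "z \<in> closure \<Omega>" for z
        by (rule ratfun_mult(1)[OF h_den[OF that] den[OF that]])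
      have "F o\<^sub>L ratfun_op (h n) A o\<^sub>L F = ratfun_op (r * (h n * r)) A"
        by (rule blinfun_eqI) (simp add: F_def ratfun_op_mult_closure den den2 h_den)
      moreover have "norm (ratfun_op (r * (h n * r)) A) \<le> norm_sup * (c1 + e)"
      proof (rule norm_ratfun_op_le)
        fix z assume z: "z \<in> closure \<Omega>"
        show "poly (ratfun_den (r * (h n * r))) z \<noteq> 0"
          by (rule ratfun_mult(1)[OF den[OF z] den2[OF z]])
        have "cmod (ratfun_eval (h n) z) \<le> c1 + e"
          using norm_triangle_sub[of "ratfun_eval (h n) z" "g z"] g_le[OF z] elim z
          by (fastforce simp: dist_norm)
        then have "cmod (ratfun_eval r z) * (cmod (ratfun_eval (h n) z) * cmod (ratfun_eval r z)) \<le> 1 * ((c1 + e) * 1)"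
          using unit_ratfuns_closure(2)[OF r z] \<open>0 \<le> c1\<close> e by (intro mult_mono) auto
        then show "cmod (ratfun_eval (r * (h n * r)) z) \<le> c1 + e"
          by (simp add: ratfun_mult(2)[OF den[OF z] den2[OF z]] ratfun_mult(2)[OF h_den[OF z] den[OF z]] norm_mult)
      qed (use \<open>0 \<le> c1\<close> e in simp)
      ultimately show ?case by simp
    qed
  qed simp
  have "norm (F o\<^sub>L calculus f o\<^sub>L F) \<le> norm_sup * c1"
  proof (rule LIMSEQ_le_const)
    have "(\<lambda>n. c1 + inverse (real (Suc n))) \<longlonglongrightarrow> c1 + 0"
      by (intro tendsto_add tendsto_const LIMSEQ_inverse_real_of_nat)
    from tendsto_mult[OF tendsto_const this]
    show "(\<lambda>n. norm_sup * (c1 + inverse (real (Suc n)))) \<longlonglongrightarrow> norm_sup * c1"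
      by simp
    show "\<exists>N. \<forall>n\<ge>N. norm (F o\<^sub>L calculus f o\<^sub>L F) \<le> norm_sup * (c1 + inverse (real (Suc n)))"
      using le by (intro exI[of _ 0]) (simp del: of_nat_Suc)
  qed
  then show ?thesis
    by (simp add: F_def f_def[abs_def])
qed

text \<open>
  The identity for \<open>F\<^sup>* F F\<^sup>* F\<close> in the introduction, tested on a vector. For \<open>v = F\<^sup>* F x\<close> one has \<open>\<parallel>F x\<parallel>\<^sup>2 \<le> \<parallel>x\<parallel> \<parallel>v\<parallel>\<close> and
  \<open>\<parallel>v\<parallel>\<^sup>2 = \<langle>F v, F x\<rangle> = \<langle>(S + \<gamma>) v, F x\<rangle> - \<gamma> \<langle>F x, F F x\<rangle> - \<langle>F x, F g(A) F x\<rangle>\<close>.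
  The last two terms are controlled since \<open>f f\<close> and \<open>f g f\<close> are again functions with known bounds.
\<close>

lemma quartic_bound:
  assumes r: "r \<in> unit_ratfuns \<Omega>"
    and S: "norm (S_op \<Omega> L \<sigma> (ratfun_eval r) A + \<gamma> *\<^sub>C id_blinfun) \<le> 2 * c2"
    and g: "norm (ratfun_op r A o\<^sub>L calculus (\<lambda>\<zeta>. cnj (ratfun_eval r \<zeta>)) o\<^sub>L ratfun_op r A) \<le> norm_sup * c1"
    and \<gamma>: "cmod \<gamma> \<le> c"
  shows "norm (ratfun_op r A x) ^ 4 \<le> norm x ^ 4 * (2 * c2 * norm_sup ^ 3 + norm_sup ^ 2 * (c1 + c))"
proof -
  define F where "F = ratfun_op r A"
  define G where "G = calculus (\<lambda>\<zeta>. cnj (ratfun_eval r \<zeta>))"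
  define S where "S = S_op \<Omega> L \<sigma> (ratfun_eval r) A"
  define k where "k = norm_sup"
  note den = unit_ratfuns_closure(1)[OF r]
  have F: "clinear_op F" unfolding F_def by (rule clinear_op_ratfun_op[OF den])
  define v where "v = op_adjoint F (F x)"
  define t p where "t = norm x" and "p = norm (F x)"
  have k: "0 \<le> k" "norm F \<le> k"
    unfolding k_def F_def by (rule norm_sup_nonneg, rule norm_le_norm_sup[OF r])
  have c2: "0 \<le> c2" using S norm_ge_zero by (meson order_trans mult_le_cancel_left zero_le_mult_iff zero_le_numeral not_numeral_le_zero)
  have "0 \<le> c" using \<gamma> norm_ge_zero order_trans by blast
  have le_k: "norm (F y) \<le> k * norm y" for y
    using norm_blinfun[of F y] mult_right_mono[OF k(2) norm_ge_zero[of y]] by linarith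
  have p: "0 \<le> p" "p \<le> k * t" and t: "0 \<le> t"
    using le_k[of x] by (simp_all add: p_def t_def)
  have vv: "cinner (F v) (F x) = of_real ((norm v)\<^sup>2)"
    using cinner_op_adjoint[OF F, of v "F x"] by (simp add: v_def cinner_self)
  have move: "cinner v y = cinner (F x) (F y)" for y
    unfolding v_def by (rule cinner_op_adjoint_left[OF F])
  have "(norm v)\<^sup>2 = cmod (cinner (F v) (F x))"
    unfolding vv by (simp add: norm_power)
  also have "\<dots> \<le> norm (F v) * p"
    unfolding p_def by (rule cmod_cinner_le)
  also have "\<dots> \<le> (k * norm v) * p"
    using le_k p by (intro mult_right_mono)
  finally have "norm v * norm v \<le> norm v * (k * p)"
    by (simp add: power2_eq_square mult_ac)
  then have v1: "norm v \<le> k * p"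
    using k p by (cases "v = 0") (auto simp: mult_le_cancel_left)
  also have "\<dots> \<le> k * (k * t)"
    by (intro mult_left_mono p k)
  finally have v2: "norm v \<le> k * (k * t)" .
  have "p\<^sup>2 = cmod (cinner (F x) (F x))"
    by (simp add: p_def cinner_self norm_power)
  also have "\<dots> = cmod (cinner v x)"
    by (simp add: move)
  also have "\<dots> \<le> norm v * t"
    unfolding t_def by (rule cmod_cinner_le)
  finally have p2: "p\<^sup>2 \<le> norm v * t" .
  have FF: "norm (F (F x)) \<le> k * t"
  proof -
    have "r * r \<in> unit_ratfuns \<Omega>"
      using r ratfun_mult[of r _ r] by (auto simp: unit_ratfuns_def norm_mult mult_le_one)
    then have "norm (ratfun_op (r * r) A) \<le> k"
      unfolding k_def by (rule norm_le_norm_sup)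
    then have "norm (ratfun_op (r * r) A x) \<le> k * t"
      using norm_blinfun[of "ratfun_op (r * r) A" x] mult_right_mono[OF _ t] unfolding t_def
      by (meson order_trans norm_ge_zero mult_right_mono)
    then show ?thesis
      by (simp add: F_def ratfun_op_mult_closure den)
  qed
  have FGF: "norm (F (G (F x))) \<le> k * c1 * t"
    using norm_blinfun[of "F o\<^sub>L G o\<^sub>L F" x] mult_right_mono[OF g t]
    unfolding F_def G_def k_def t_def by (auto intro: order_trans)
  have "cinner (S v) (F x) = cinner (F v) (F x) + cinner v (G (F x))"
    unfolding S_def G_def F_def
    by (subst cinner_S_op[OF continuous_on_frontier_ratfun[OF den]]) (simp_all add: calculus_ratfun[OF den])
  then have "cinner (F v) (F x) = cinner ((S + \<gamma> *\<^sub>C id_blinfun) v) (F x) - \<gamma> * cinner v (F x) - cinner v (G (F x))"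
    by (simp add: blinfun.add_left cinner_add_left cinner_scaleC_left)
  then have "(norm v)\<^sup>2 = cmod (cinner ((S + \<gamma> *\<^sub>C id_blinfun) v) (F x) - \<gamma> * cinner (F x) (F (F x)) - cinner (F x) (F (G (F x))))"
    by (simp add: move flip: vv) (metis vv norm_of_real abs_of_nonneg zero_le_power2)
  also have "\<dots> \<le> cmod (cinner ((S + \<gamma> *\<^sub>C id_blinfun) v) (F x)) + cmod (\<gamma> * cinner (F x) (F (F x)))
      + cmod (cinner (F x) (F (G (F x))))"
    by (intro order_trans[OF norm_triangle_ineq4] add_right_mono norm_triangle_ineq4)
  also have "\<dots> \<le> (2 * c2 * norm v) * p + c * (p * (k * t)) + p * (k * c1 * t)"
  proof (intro add_mono)
    have "norm ((S + \<gamma> *\<^sub>C id_blinfun) v) \<le> 2 * c2 * norm v"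
      using norm_blinfun[of "S + \<gamma> *\<^sub>C id_blinfun" v] mult_right_mono[OF S norm_ge_zero[of v]]
      unfolding S_def by linarith
    then show "cmod (cinner ((S + \<gamma> *\<^sub>C id_blinfun) v) (F x)) \<le> (2 * c2 * norm v) * p"
      using cmod_cinner_le[of "(S + \<gamma> *\<^sub>C id_blinfun) v" "F x"] mult_right_mono[of _ _ p] p
      unfolding p_def by (meson order_trans)
    have "cmod (cinner (F x) (F (F x))) \<le> p * (k * t)"
      using cmod_cinner_le[of "F x" "F (F x)"] mult_left_mono[OF FF p(1)] unfolding p_def by linarith
    then show "cmod (\<gamma> * cinner (F x) (F (F x))) \<le> c * (p * (k * t))"
      unfolding norm_mult using \<gamma> \<open>0 \<le> c\<close> by (intro mult_mono) auto
    show "cmod (cinner (F x) (F (G (F x)))) \<le> p * (k * c1 * t)"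
      using cmod_cinner_le[of "F x" "F (G (F x))"] mult_left_mono[OF FGF p(1)] unfolding p_def by linarith
  qed
  finally have v3: "(norm v)\<^sup>2 \<le> 2 * c2 * norm v * p + p * (k * (c1 + c) * t)"
    by (simp add: algebra_simps)
  have c1: "0 \<le> k * (c1 + c)"
    using order_trans[OF norm_ge_zero g] k(1) \<open>0 \<le> c\<close> by (simp add: k_def distrib_left)
  have "2 * c2 * norm v * p \<le> 2 * c2 * (k * (k * t)) * (k * t)"
    using v2 p c2 k t by (intro mult_mono mult_left_mono) auto
  moreover have "p * (k * (c1 + c) * t) \<le> (k * t) * (k * (c1 + c) * t)"
    using p c1 t by (intro mult_right_mono) auto
  ultimately have v4: "(norm v)\<^sup>2 \<le> t\<^sup>2 * (2 * c2 * k ^ 3 + k\<^sup>2 * (c1 + c))"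
    using v3 by (simp add: algebra_simps power2_eq_square power3_eq_cube)
  have "p ^ 4 = (p\<^sup>2)\<^sup>2" by (simp flip: power_mult)
  also have "\<dots> \<le> (norm v * t)\<^sup>2"
    by (rule power_mono[OF p2]) simp
  also have "\<dots> = (norm v)\<^sup>2 * t\<^sup>2"
    by (simp add: power_mult_distrib)
  also have "\<dots> \<le> (t\<^sup>2 * (2 * c2 * k ^ 3 + k\<^sup>2 * (c1 + c))) * t\<^sup>2"
    by (rule mult_right_mono[OF v4]) simp
  also have "\<dots> = t ^ 4 * (2 * c2 * k ^ 3 + k\<^sup>2 * (c1 + c))"
    by (simp add: power4_eq_xxxx power2_eq_square)
  finally show ?thesis
    by (simp add: p_def t_def k_def F_def)
qed

end

lemma quartic_root_bound:
  fixes k c2 b :: real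
  assumes "k ^ 4 \<le> 2 * c2 * k ^ 3 + k\<^sup>2 * b" "0 \<le> k" "0 \<le> c2" "0 \<le> b"
  shows "k \<le> c2 + sqrt (c2\<^sup>2 + b)"
proof (cases "k = 0")
  case False
  then have "k\<^sup>2 * k\<^sup>2 \<le> k\<^sup>2 * (2 * c2 * k + b)"
    using assms(1) by (simp add: power4_eq_xxxx power2_eq_square power3_eq_cube algebra_simps)
  then have "k\<^sup>2 \<le> 2 * c2 * k + b"
    by (rule mult_left_le_imp_le) (use False in simp)
  then have "(k - c2)\<^sup>2 \<le> c2\<^sup>2 + b"
    unfolding power2_diff by (simp add: mult_ac)
  then have "k - c2 \<le> sqrt (c2\<^sup>2 + b)"
    by (rule real_le_rsqrt)
  then show ?thesis by simp
qed (use assms in simp)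

theorem theorem2:
  fixes \<Omega> :: "complex set"
    and L :: "complex set \<Rightarrow> real"
    and \<sigma> :: "complex set \<Rightarrow> real \<Rightarrow> complex"
    and A :: "'a::complex_hilbert_space \<Rightarrow>\<^sub>L 'a"
    and c2 :: real
    and \<gamma> :: "ratfun \<Rightarrow> complex"
  assumes "\<Omega> \<noteq> {}" and "bounded \<Omega>" and "open \<Omega>"
    and "finite (components (frontier \<Omega>))"
    and "arc_length_boundary \<Omega> L \<sigma>"
    and "positively_oriented_boundary \<Omega> L \<sigma>"
    and "{f. \<exists>r. (\<forall>n. r n \<in> bounded_ratfuns \<Omega>) \<and>
              uniform_limit (closure \<Omega>) (\<lambda>n. ratfun_eval (r n)) f sequentially}
         = {f. f holomorphic_on \<Omega> \<and> continuous_on (closure \<Omega>) f}"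
    and "clinear_op A"
    and "op_spectrum A \<subseteq> \<Omega>"
    and "\<forall>r\<in>unit_ratfuns \<Omega>.
           norm (S_op \<Omega> L \<sigma> (ratfun_eval r) A + \<gamma> r *\<^sub>C id_blinfun) \<le> 2 * c2"
    and "c1_const \<Omega> L \<sigma> \<noteq> \<infinity>"
  shows "K_spectral_set
    (c2 + sqrt (c2\<^sup>2 + real_of_ereal (c1_const \<Omega> L \<sigma>)
                 + real_of_ereal (SUP r\<in>unit_ratfuns \<Omega>. ereal (cmod (\<gamma> r)))))
    (closure \<Omega>) A"
proof -
  interpret spectral_domain \<Omega> L \<sigma> A
    by unfold_locales (fact assms)+
  let ?c1 = "real_of_ereal (c1_const \<Omega> L \<sigma>)"
  let ?c = "real_of_ereal (SUP r\<in>unit_ratfuns \<Omega>. ereal (cmod (\<gamma> r)))"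
  define K where "K = c2 + sqrt (c2\<^sup>2 + ?c1 + ?c)"
  have c2: "0 \<le> c2"
  proof -
    have "0 \<le> 2 * c2"
      using assms(10) zero_in_unit_ratfuns[of \<Omega>] norm_ge_zero order_trans by blast
    then show ?thesis by simp
  qed
  have c1_le: "ereal (cmod (continuous_extension \<Omega> (conj_cauchy \<Omega> L \<sigma> (ratfun_eval r)) z)) \<le> c1_const \<Omega> L \<sigma>"
    if "r \<in> unit_ratfuns \<Omega>" "z \<in> closure \<Omega>" for r z
    unfolding c1_const_def by (rule SUP_upper2[OF that(1)], rule SUP_upper[OF that(2)])
  obtain z0 where z0: "z0 \<in> closure \<Omega>"
    using assms(1) closure_subset by blast
  have c1_nonneg: "0 \<le> c1_const \<Omega> L \<sigma>"
    by (rule order_trans[OF _ c1_le[OF zero_in_unit_ratfuns z0]]) simp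
  then have c1_real: "c1_const \<Omega> L \<sigma> = ereal ?c1" "0 \<le> ?c1"
    using assms(11) by (auto simp: ereal_real' real_of_ereal_pos)
  have c1: "cmod (continuous_extension \<Omega> (conj_cauchy \<Omega> L \<sigma> (ratfun_eval r)) z) \<le> ?c1"
    if "r \<in> unit_ratfuns \<Omega>" "z \<in> closure \<Omega>" for r z
    using c1_le[OF that] by (subst (asm) c1_real(1)) simp
  have c_sup: "0 \<le> (SUP r\<in>unit_ratfuns \<Omega>. ereal (cmod (\<gamma> r)))"
    by (rule SUP_upper2[OF zero_in_unit_ratfuns]) simp
  then have c: "0 \<le> ?c"
    by (rule real_of_ereal_pos)
  have K: "0 \<le> K"
    unfolding K_def using c2 c1_real(2) c by simp
  \<comment> \<open>On a nonzero space \<open>\<gamma>\<close> is bounded, because \<open>S(f, A)\<close> is; an infinite supremum would be converted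
    to the default value \<open>0\<close>. On the zero space all norms vanish.\<close>
  have norm_sup: "norm_sup \<le> K"
  proof (cases "\<exists>x :: 'a. x \<noteq> 0")
    case True
    then obtain x0 :: 'a where x0: "x0 \<noteq> 0" by blast
    obtain B where B: "0 \<le> B" "\<And>r. r \<in> unit_ratfuns \<Omega> \<Longrightarrow> norm (ratfun_op r A) \<le> B"
      "\<And>r. r \<in> unit_ratfuns \<Omega> \<Longrightarrow> norm (calculus (\<lambda>\<zeta>. cnj (ratfun_eval r \<zeta>))) \<le> B"
      using norm_calculus_unit by blast
    have \<gamma>_le: "cmod (\<gamma> r) \<le> 2 * c2 + 2 * B" if r: "r \<in> unit_ratfuns \<Omega>" for r
    proof -
      note den = unit_ratfuns_closure(1)[OF r]
      let ?S = "S_op \<Omega> L \<sigma> (ratfun_eval r) A"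
      have "norm ?S \<le> 2 * B"
      proof (rule blinfun_norm_cinnerI)
        fix x y
        have "cmod (cinner (?S x) y) \<le> cmod (cinner (ratfun_op r A x) y) + cmod (cinner x (calculus (\<lambda>\<zeta>. cnj (ratfun_eval r \<zeta>)) y))"
          by (subst cinner_S_op[OF continuous_on_frontier_ratfun[OF den]])
             (simp_all add: calculus_ratfun[OF den] norm_triangle_ineq)
        also have "\<dots> \<le> norm (ratfun_op r A x) * norm y + norm x * norm (calculus (\<lambda>\<zeta>. cnj (ratfun_eval r \<zeta>)) y)"
          by (intro add_mono cmod_cinner_le)
        also have "\<dots> \<le> (B * norm x) * norm y + norm x * (B * norm y)"
          using B(2,3)[OF r]
          by (intro add_mono mult_right_mono mult_left_mono order_trans[OF norm_blinfun]) auto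
        finally show "cmod (cinner (?S x) y) \<le> 2 * B * norm x * norm y"
          by (simp add: algebra_simps)
      qed (use B in simp)
      have "cmod (\<gamma> r) * norm x0 = norm ((\<gamma> r *\<^sub>C id_blinfun) x0 :: 'a)"
        by (simp add: norm_scaleC)
      also have "(\<gamma> r *\<^sub>C id_blinfun) x0 = (?S + \<gamma> r *\<^sub>C id_blinfun) x0 - ?S x0"
        by (simp add: blinfun.add_left)
      also have "norm \<dots> \<le> norm (?S + \<gamma> r *\<^sub>C id_blinfun) * norm x0 + norm ?S * norm x0"
        by (rule order_trans[OF norm_triangle_ineq4 add_mono[OF norm_blinfun norm_blinfun]])
      also have "\<dots> \<le> (2 * c2) * norm x0 + (2 * B) * norm x0"
        using assms(10) r \<open>norm ?S \<le> 2 * B\<close> by (intro add_mono mult_right_mono) auto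
      also have "\<dots> = (2 * c2 + 2 * B) * norm x0"
        by (simp add: algebra_simps)
      finally show ?thesis
        using x0 by (simp add: mult_le_cancel_right)
    qed
    then have "(SUP r\<in>unit_ratfuns \<Omega>. ereal (cmod (\<gamma> r))) \<le> ereal (2 * c2 + 2 * B)"
      by (intro SUP_least) simp
    then have "(SUP r\<in>unit_ratfuns \<Omega>. ereal (cmod (\<gamma> r))) \<noteq> \<infinity>" by auto
    then have sup: "(SUP r\<in>unit_ratfuns \<Omega>. ereal (cmod (\<gamma> r))) = ereal ?c"
      using c_sup by (auto simp: ereal_real')
    have \<gamma>: "cmod (\<gamma> r) \<le> ?c" if "r \<in> unit_ratfuns \<Omega>" for r
      using SUP_upper[OF that, of "\<lambda>r. ereal (cmod (\<gamma> r))"] by (subst (asm) sup) simp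
    define Q where "Q = 2 * c2 * norm_sup ^ 3 + norm_sup ^ 2 * (?c1 + ?c)"
    have Q: "0 \<le> Q"
      unfolding Q_def using c2 c1_real(2) c norm_sup_nonneg by simp
    have "norm (ratfun_op r A) \<le> root 4 Q" if r: "r \<in> unit_ratfuns \<Omega>" for r
    proof (rule norm_blinfun_bound)
      fix x
      have "norm (ratfun_op r A x) ^ 4 \<le> norm x ^ 4 * Q"
        unfolding Q_def
      proof (rule quartic_bound[OF r _ _ \<gamma>[OF r]])
        show "norm (S_op \<Omega> L \<sigma> (ratfun_eval r) A + \<gamma> r *\<^sub>C id_blinfun) \<le> 2 * c2"
          using assms(10) r by blast
        show "norm (ratfun_op r A o\<^sub>L calculus (\<lambda>\<zeta>. cnj (ratfun_eval r \<zeta>)) o\<^sub>L ratfun_op r A) \<le> norm_sup * ?c1"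
          by (rule norm_product_le[OF equalityD2[OF assms(7)] r c1[OF r] c1_real(2)])
      qed
      then have "root 4 (norm (ratfun_op r A x) ^ 4) \<le> root 4 (norm x ^ 4 * Q)"
        by (rule real_root_le_mono[rotated]) simp
      then show "norm (ratfun_op r A x) \<le> root 4 Q * norm x"
        by (simp add: real_root_mult real_root_power_cancel mult.commute)
    qed (use Q in simp)
    then have "norm_sup \<le> root 4 Q"
      unfolding norm_sup_def using zero_in_unit_ratfuns by (intro cSUP_least) blast+
    then have "norm_sup ^ 4 \<le> root 4 Q ^ 4"
      by (rule power_mono[OF _ norm_sup_nonneg])
    then have "norm_sup ^ 4 \<le> Q"
      using Q by simp
    then show ?thesis
      unfolding K_def Q_def add.assoc
      by (rule quartic_root_bound[OF _ norm_sup_nonneg c2]) (use c1_real(2) c in simp)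
  next
    case False
    have "norm (ratfun_op r A) = 0" for r
      using False by (metis blinfun_eqI norm_zero)
    then have "norm_sup \<le> 0"
      unfolding norm_sup_def using zero_in_unit_ratfuns[of \<Omega>] by (intro cSUP_least) auto
    with K show ?thesis by simp
  qed
  have "K_spectral_set K (closure \<Omega>) A"
    unfolding K_spectral_set_def
  proof (intro conjI ballI)
    show "op_spectrum A \<subseteq> closure \<Omega>"
      using assms(9) closure_subset by blast
    fix r assume r: "r \<in> bounded_ratfuns (closure \<Omega>)"
    define M where "M = (SUP z\<in>closure \<Omega>. cmod (ratfun_eval r z))"
    have den: "poly (ratfun_den r) z \<noteq> 0" if "z \<in> closure \<Omega>" for z
      using r that by (simp add: bounded_ratfuns_def)
    obtain a where "\<And>z. z \<in> closure \<Omega> \<Longrightarrow> cmod (ratfun_eval r z) \<le> a"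
      using r by (auto simp: bounded_ratfuns_def bounded_iff)
    then have "bdd_above ((\<lambda>z. cmod (ratfun_eval r z)) ` closure \<Omega>)"
      by (rule bdd_aboveI2)
    then have M: "cmod (ratfun_eval r z) \<le> M" if "z \<in> closure \<Omega>" for z
      unfolding M_def using that by (intro cSUP_upper)
    have M0: "0 \<le> M"
      using M[OF z0] norm_ge_zero order_trans by blast
    have "norm (ratfun_op r A) \<le> norm_sup * (M + e)" if "0 < e" for e
    proof (rule norm_ratfun_op_le[OF den])
      show "cmod (ratfun_eval r z) \<le> M + e" if "z \<in> closure \<Omega>" for z
        using M[OF that] \<open>0 < e\<close> by simp
    qed (use M0 that in simp_all)
    then have le: "norm (ratfun_op r A) \<le> K * (M + e)" if "0 < e" for e
      by (rule order_trans[OF _ mult_right_mono[OF norm_sup]]) (use M0 that in simp_all)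
    show "norm (ratfun_op r A) \<le> K * M"
    proof (rule field_le_epsilon)
      fix e :: real assume "0 < e"
      have "norm (ratfun_op r A) \<le> K * (M + e / (K + 1))"
        using K \<open>0 < e\<close> by (intro le) simp
      also have "\<dots> = K * M + K / (K + 1) * e"
        by (simp add: distrib_left)
      also have "\<dots> \<le> K * M + 1 * e"
        using K \<open>0 < e\<close> by (intro add_left_mono mult_right_mono) auto
      finally show "norm (ratfun_op r A) \<le> K * M + e" by simp
    qed
  qed simp
  then show ?thesis
    by (simp only: K_def)
qed

end
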